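(* Under Assumptions A1–A3 (see context), suppose the saturation function is continuous ($l_k=L_k$, $u_k=U_k$ for all $k$), that $\{\varepsilon_k,\mathcal F_k\}_{k\ge0}$ is a martingale difference sequence, and that for some constant $r>4$, $\sup_{k\ge0}\mathbb E_k[|\varepsilon_{k+1}|^r]<\infty$ a.s. Let $\hat y_{k+1}=S_k(\phi_k^{\mathrm T}\theta_k)$ with $\theta_k$ the TSWLAD estimate, $\sigma_k^2=\mathbb E_k[\varepsilon_{k+1}^2]$, and $E_n=\frac1n\sum_{k=0}^{n-1}b_k|y_{k+1}-\hat y_{k+1}|$. Then, as $n\to\infty$, $$E_n\le\sqrt{\frac{\sum_{k=0}^{n-1}b_k^2\sigma_k^2}{n}}+O\!\left(\sqrt[4]{\frac{\log\log n}{n}}\right)\quad\text{a.s.}$$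
   Context: Setting. Let $\{\mathcal F_k\}_{k\ge0}$ be a nondecreasing sequence of $\sigma$-algebras and write $\mathbb E_k[\cdot]=\mathbb E[\cdot\mid\mathcal F_k]$. Observations follow the saturated model $y_{k+1}=S_k(\phi_k^{\mathrm T}\theta+\varepsilon_{k+1})$, $k=0,1,2,\dots$, where $\phi_k\in\mathbb R^d$ is $\mathcal F_k$-measurable, $\theta\in\mathbb R^d$ is unknown, $\varepsilon_{k+1}\in\mathbb R$ is noise ($\mathcal F_{k+1}$-measurable), and $S_k(x)=L_k$ if $x<l_k$, $S_k(x)=x$ if $l_k\le x\le u_k$, $S_k(x)=U_k$ if $x>u_k$. Assumption A1: $\{\phi_k\}$ is bounded in $k$, and $\theta$ is an interior point of a known convex compact set $D\subseteq\mathbb R^d$. Let $\{C_k\}$ be a bounded $\mathcal F_k$-adapted sequence with $\sup_{x\in D}|\phi_k^{\mathrm T}x|\le C_k$. Assumption A2: $l_k,u_k,L_k,U_k$ are known $\mathcal F_k$-measurable random variables with $L_k\le l_k\le u_k\le U_k$ a.s.; there is a constant $M$ with $\sup_{k\ge0}\max\{l_k,-u_k\}\le M<\infty$ a.s.; and $L_k=l_k=u_k=U_k$ does not hold a.s. The weights $b_k$ are known, $\mathcal F_k$-measurable, with $0<\inf_k b_k\le\sup_k b_k\le 1$. Assumption A3: the conditional distribution function $F_{k+1}$ of $\varepsilon_{k+1}$ given $\mathcal F_k$ satisfies $F_{k+1}(0)=1/2$; its conditional density $f_{k+1}$ is continuous and known; and there is a constant $C\ge\sup_k C_k$ with $0<\inf_{|x|\le\max\{2C,C+M\},k\ge0}f_{k+1}(x)\le\sup_{|x|\le\max\{2C,C+M\},k\ge0}f_{k+1}(x)<\infty$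 a.s. Projection: for positive definite $Q$, $\|x\|_Q^2=x^{\mathrm T}Qx$ and $\Pi_Q(x)=\arg\min_{y\in D}\|x-y\|_Q$. TSWLAD algorithm. Step 1: with $\bar\theta_0\in D$, $\bar P_0>0$, and an $\mathcal F_k$-adapted sequence $\bar\mu_k$ with $0<\inf\bar\mu_k\le\sup\bar\mu_k<\infty$, for $k\ge0$: $\bar\theta_{k+1}=\Pi_{\bar P_{k+1}^{-1}}\{\bar\theta_k+\bar a_k b_k\bar P_k\phi_k\bar v_{k+1}\}$, $\bar v_{k+1}=\operatorname{sgn}[y_{k+1}-S_k(\phi_k^{\mathrm T}\bar\theta_k)]+F_{k+1}(u_k-\phi_k^{\mathrm T}\bar\theta_k)\mathrm I_{[S_k(\phi_k^{\mathrm T}\bar\theta_k)=U_k]}-[1-F_{k+1}(l_k-\phi_k^{\mathrm T}\bar\theta_k)]\mathrm I_{[S_k(\phi_k^{\mathrm T}\bar\theta_k)=L_k]}$, $\bar P_{k+1}=\bar P_k-\bar a_k\bar\beta_k b_k^2\bar P_k\phi_k\phi_k^{\mathrm T}\bar P_k$, $\bar a_k=1/(\bar\mu_k+\bar\beta_k b_k^2\phi_k^{\mathrm T}\bar P_k\phi_k)$, $\bar\beta_k=\inf_{|x|\le\max\{2C_k,C_k+l_k,C_k-u_k\}}f_{k+1}(x)$. Step 2: with $\theta_0\in D$, $P_0>0$, and $\mu_k$ with $0<\inf\mu_k\le\sup\mu_k<\infty$, for $k\ge0$, letting $d_k=\phi_k^{\mathrm T}(\bar\theta_k-\theta_k)$: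 $\theta_{k+1}=\Pi_{P_{k+1}^{-1}}\{\theta_k+a_kb_kP_k\phi_kv_{k+1}\}$, $v_{k+1}=\operatorname{sgn}[y_{k+1}-S_k(\phi_k^{\mathrm T}\theta_k)]+F_{k+1}(u_k-\phi_k^{\mathrm T}\theta_k)\mathrm I_{[S_k(\phi_k^{\mathrm T}\theta_k)=U_k]}-[1-F_{k+1}(l_k-\phi_k^{\mathrm T}\theta_k)]\mathrm I_{[S_k(\phi_k^{\mathrm T}\theta_k)=L_k]}$, $P_{k+1}=P_k-a_k\beta_kb_k^2P_k\phi_k\phi_k^{\mathrm T}P_k$, $a_k=1/(\mu_k+\beta_kb_k^2\phi_k^{\mathrm T}P_k\phi_k)$, and $\beta_k=\frac{F_{k+1}(l_k-\phi_k^{\mathrm T}\theta_k)-F_{k+1}(l_k-\phi_k^{\mathrm T}\bar\theta_k)}{d_k}\mathrm I_{[d_k\ne0]}+f_{k+1}(l_k-\phi_k^{\mathrm T}\theta_k)\mathrm I_{[d_k=0]}$ if $S_k(\phi_k^{\mathrm T}\theta_k)=L_k$; $\beta_k=\frac{1-2F_{k+1}(\phi_k^{\mathrm T}\theta_k-\phi_k^{\mathrm T}\bar\theta_k)}{d_k}\mathrm I_{[d_k\ne0]}+2f_{k+1}(0)\mathrm I_{[d_k=0]}$ if $L_k<S_k(\phi_k^{\mathrm T}\theta_k)<U_k$; $\beta_k=\frac{F_{k+1}(u_k-\phi_k^{\mathrm T}\theta_k)-F_{k+1}(u_k-\phi_k^{\mathrm T}\bar\theta_k)}{d_k}\mathrm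 I_{[d_k\ne0]}+f_{k+1}(u_k-\phi_k^{\mathrm T}\theta_k)\mathrm I_{[d_k=0]}$ if $S_k(\phi_k^{\mathrm T}\theta_k)=U_k$. Here $\operatorname{sgn}$ is the sign function and $\mathrm I_{[\cdot]}$ the indicator. *)

theory Defs
  imports "HOL-Probability.Probability"
begin

definition sat :: "real \<Rightarrow> real \<Rightarrow> real \<Rightarrow> real \<Rightarrow> real \<Rightarrow> real" where
  "sat l u L U x = (if x < l then L else if u < x then U else x)"

definition qform :: "real^'d^'d \<Rightarrow> real^'d \<Rightarrow> real" where
  "qform Q x = x \<bullet> (Q *v x)"

definition pos_def :: "real^'d^'d \<Rightarrow> bool" where
  "pos_def Q \<longleftrightarrow> transpose Q = Q \<and> (\<forall>x. x \<noteq> 0 \<longrightarrow> 0 < qform Q x)"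

definition proj :: "real^'d^'d \<Rightarrow> (real^'d) set \<Rightarrow> real^'d \<Rightarrow> real^'d" where
  "proj Q D x = (SOME y. y \<in> D \<and> (\<forall>z\<in>D. qform Q (x - y) \<le> qform Q (x - z)))"

definition outer :: "real^'d \<Rightarrow> real^'d \<Rightarrow> real^'d^'d" where
  "outer a c = (\<chi> i j. a $ i * c $ j)"

definition ind :: "bool \<Rightarrow> real" where
  "ind P = (if P then 1 else 0)"

text \<open>Innovation v_{k+1} given cdf F = F_{k+1}, thresholds, observation y = y_{k+1}
  and z = phi_k^T theta (current prediction argument).\<close>
definition innov :: "(real \<Rightarrow> real) \<Rightarrow> real \<Rightarrow> real \<Rightarrow> real \<Rightarrow> real \<Rightarrow> real \<Rightarrow> real \<Rightarrow> real" where
  "innov F l u L U y z =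
     sgn (y - sat l u L U z)
     + F (u - z) * ind (sat l u L U z = U)
     - (1 - F (l - z)) * ind (sat l u L U z = L)"

text \<open>Adaptive gain beta_k of step 2; z = phi_k^T theta_k, zb = phi_k^T thetabar_k,
  so d_k = zb - z.\<close>
definition beta2 :: "(real \<Rightarrow> real) \<Rightarrow> (real \<Rightarrow> real) \<Rightarrow> real \<Rightarrow> real \<Rightarrow> real \<Rightarrow> real \<Rightarrow> real \<Rightarrow> real \<Rightarrow> real" where
  "beta2 F f l u L U z zb =
     (let d = zb - z; s = sat l u L U z in
      if s = L then (F (l - z) - F (l - zb)) / d * ind (d \<noteq> 0) + f (l - z) * ind (d = 0)
      else if L < s \<and> s < U then (1 - 2 * F (z - zb)) / d * ind (d \<noteq> 0) + 2 * f 0 * ind (d = 0)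
      else if s = U then (F (u - z) - F (u - zb)) / d * ind (d \<noteq> 0) + f (u - z) * ind (d = 0)
      else 0)"

end

theory Submission
  imports Defs "HOL-Real_Asymp.Real_Asymp"
begin

text \<open>Since the saturation is nonexpansive, the prediction error is at most \<open>\<bar>h k\<bar> + \<bar>\<epsilon> (k + 1)\<bar>\<close>
  with \<open>h k = \<phi>\<^sub>k\<^sup>T (\<theta> - \<theta>\<^sub>k)\<close>, and an error of order \<open>n powr (3/4)\<close> in the sums is affordable.
  The law of the iterated logarithm and the logarithmic regret bound are therefore not needed.

  For the noise, \<open>exp\<close> of the centred sum, truncated at level \<open>n powr (1/4)\<close>, is a supermartingale; a Chernoff
  bound and Borel-Cantelli give \<open>\<Sum> b\<^sub>k \<bar>\<epsilon>\<bar> \<le> \<Sum> b\<^sub>k \<sigma>\<^sub>k + O(n powr (3/4))\<close>, and the \<open>r\<close>-th moments with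
  \<open>r > 4\<close> make the truncation harmless. Cauchy-Schwarz turns \<open>\<Sum> b\<^sub>k \<sigma>\<^sub>k\<close> into the square root in the statement.

  For the regret, \<open>\<Sum> h\<^sub>k\<^sup>2 = O(sqrt n)\<close> suffices. It follows from the Lyapunov function
  \<open>(\<theta>\<^sub>k - \<theta>)\<^sup>T P\<^sub>k\<^sup>-\<^sup>1 (\<theta>\<^sub>k - \<theta>)\<close>: the conditional mean of the innovation is a slope of the conditional
  distribution function times \<open>h\<close>, the quadratic term is summed by Cauchy-Schwarz and the decrease of the trace
  of \<open>P\<^sub>k\<close>, and the martingale term is absorbed by the same exponential bound. In step 1 the gain
  is a lower bound of the slope; in step 2 the gain differs from the slope by a multiple of the
  error of step 1, whose squares are already summed.\<close>

subsection \<open>Quadratic forms, projections and the gain recursion\<close>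

text \<open>The bounds on regressors, weights, normalisers, densities and moments vary with the
  path, so hardly any constant can be fixed before the path is. The probabilistic estimates are
  therefore two almost sure bounds that presuppose no such constant: one for the absolute noise, and
  a self-normalised martingale bound valid for all \<open>d > 0\<close> at once. The regret argument
  is then deterministic, with \<open>d\<close> chosen from the constants of the path. The other
  obstacle is that A3 describes \<open>Fd\<close> at fixed real arguments, while the algorithm
  evaluates it at random ones. The conditional distribution function has to be transferred to random
  thresholds, and ties between the noise and such a threshold excluded, since \<open>sgn\<close>
  vanishes there. It must also be shown that the estimates, which pass through infima of densities
  and projections in random norms, are adapted.\<close>

lemma inner_sym_matrix:
  fixes Q :: "real^'d^'d"
  assumes "transpose Q = Q"
  shows "x \<bullet> (Q *v y) = (Q *v x) \<bullet> y"
  by (metis assms dot_lmul_matrix transpose_matrix_vector)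

lemma outer_mult_vector: "outer a c *v x = (c \<bullet> x) *\<^sub>R a"
  by (simp add: vec_eq_iff outer_def matrix_vector_mult_def inner_vec_def sum_distrib_left mult_ac)

lemma scaleR_matrix_mult_vector: "(c *\<^sub>R (A::real^'d^'e)) *v x = c *\<^sub>R (A *v x)"
  by (simp add: vec_eq_iff matrix_vector_mult_def sum_distrib_left mult_ac)

lemma qform_outer: "qform (outer a a) x = (a \<bullet> x)\<^sup>2"
  by (simp add: qform_def outer_mult_vector power2_eq_square inner_commute)

lemma qform_add_matrix: "qform (A + c *\<^sub>R B) x = qform A x + c * qform B x"
  by (simp add: qform_def matrix_vector_mult_add_rdistrib scaleR_matrix_mult_vector inner_add_right)

lemma qform_add_vector:
  assumes "transpose Q = Q"
  shows "qform Q (x + y) = qform Q x + 2 * (y \<bullet> (Q *v x)) + qform Q y"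
proof -
  have "x \<bullet> (Q *v y) = y \<bullet> (Q *v x)"
    using inner_sym_matrix[OF assms] by (simp add: inner_commute)
  then show ?thesis
    by (simp add: qform_def matrix_vector_right_distrib inner_add_left inner_add_right)
qed

lemma qform_scaleR: "qform Q (c *\<^sub>R x) = c\<^sup>2 * qform Q x"
  by (simp add: qform_def matrix_vector_mult_scaleR power2_eq_square)

section \<open>Continuity of the matrix operations in the recursions\<close>

lemma continuous_on_matrix_vector_mult [continuous_intros]:
  fixes A :: "'b::topological_space \<Rightarrow> real^'d^'e"
  assumes "continuous_on S A" "continuous_on S x"
  shows "continuous_on S (\<lambda>t. A t *v x t)"
  unfolding matrix_vector_mult_def
  by (intro continuous_intros continuous_on_vec_lambda assms)

lemma continuous_on_matrix_matrix_mult [continuous_intros]: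
  fixes A :: "'b::topological_space \<Rightarrow> real^'d^'e" and B :: "'b \<Rightarrow> real^'f^'d"
  assumes "continuous_on S A" "continuous_on S B"
  shows "continuous_on S (\<lambda>t. A t ** B t)"
  unfolding matrix_matrix_mult_def
  by (intro continuous_intros continuous_on_vec_lambda assms)

lemma continuous_on_outer [continuous_intros]:
  fixes x y :: "'b::topological_space \<Rightarrow> real^'d"
  assumes "continuous_on S x" "continuous_on S y"
  shows "continuous_on S (\<lambda>t. outer (x t) (y t))"
  unfolding outer_def
proof (intro continuous_on_vec_lambda)
  show "continuous_on S (\<lambda>t. x t $ i * y t $ j)" for i j
    by (intro continuous_on_mult continuous_on_component assms)
qed

lemma continuous_on_qform [continuous_intros]:
  assumes "continuous_on S Q" "continuous_on S x"
  shows "continuous_on S (\<lambda>t. qform (Q t) (x t))"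
  unfolding qform_def by (intro continuous_on_inner continuous_on_matrix_vector_mult assms)

section \<open>Projection in a quadratic norm\<close>

lemma proj_minimizes:
  assumes "compact D" "D \<noteq> {}"
  shows "proj Q D x \<in> D" "z \<in> D \<Longrightarrow> qform Q (x - proj Q D x) \<le> qform Q (x - z)"
proof -
  have "\<exists>y\<in>D. \<forall>z\<in>D. qform Q (x - y) \<le> qform Q (x - z)"
    by (intro continuous_attains_inf assms continuous_intros)
  then have "\<exists>y. y \<in> D \<and> (\<forall>z\<in>D. qform Q (x - y) \<le> qform Q (x - z))" by blast
  from someI_ex[OF this] show "proj Q D x \<in> D" "z \<in> D \<Longrightarrow> qform Q (x - proj Q D x) \<le> qform Q (x - z)"
    unfolding proj_def[symmetric] by auto
qed

text \<open>First-order optimality: a step of size \<open>t\<close> from \<open>y\<close> towards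
  \<open>z\<close> stays in \<open>D\<close> and changes the form by
  \<open>- 2 * t * B + t^2 * q\<close>, which is negative for small \<open>t\<close> if
  \<open>B > 0\<close>.\<close>

lemma qform_minimizer_variational:
  assumes Q: "transpose Q = Q" and D: "convex D" "y \<in> D" "z \<in> D"
    and min: "\<And>w. w \<in> D \<Longrightarrow> qform Q (x - y) \<le> qform Q (x - w)"
  shows "(z - y) \<bullet> (Q *v (x - y)) \<le> 0"
proof (rule ccontr)
  define B where "B = (z - y) \<bullet> (Q *v (x - y))"
  define q where "q = qform Q (z - y)"
  assume "\<not> ?thesis"
  then have B: "B > 0" by (simp add: B_def)
  have le: "2 * B \<le> t * q" if t: "0 < t" "t \<le> 1" for t
  proof -
    have "(1 - t) *\<^sub>R y + t *\<^sub>R z \<in> D"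
      using D t by (intro convexD_alt) auto
    then have "qform Q (x - y) \<le> qform Q (x - ((1 - t) *\<^sub>R y + t *\<^sub>R z))"
      by (rule min)
    also have "x - ((1 - t) *\<^sub>R y + t *\<^sub>R z) = (x - y) + (- t) *\<^sub>R (z - y)"
      by (simp add: algebra_simps)
    also have "qform Q \<dots> = qform Q (x - y) - 2 * t * B + t\<^sup>2 * q"
      by (subst qform_add_vector[OF Q], subst qform_scaleR) (simp add: B_def q_def)
    finally have "t * (2 * B) \<le> t * (t * q)" by (simp add: power2_eq_square)
    then show ?thesis using t by simp
  qed
  \<comment> \<open>\<open>q\<close> may have either sign, hence \<open>\<bar>q\<bar> + 1\<close>.
    With this \<open>t\<close> the product \<open>t * q\<close> is at most \<open>B\<close>, which
    contradicts \<open>2 * B \<le> t * q\<close>.\<close>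
  define t where "t = min 1 (B / (\<bar>q\<bar> + 1))"
  have t: "0 < t" "t \<le> 1" using B by (auto simp: t_def)
  have "2 * B \<le> t * q" by (rule le[OF t])
  also have "\<dots> \<le> t * \<bar>q\<bar>" using t by (intro mult_left_mono) auto
  also have "\<dots> \<le> B / (\<bar>q\<bar> + 1) * \<bar>q\<bar>" by (intro mult_right_mono) (auto simp: t_def)
  also have "\<dots> \<le> B" using B by (simp add: field_simps)
  finally show False using B by simp
qed

text \<open>Pythagorean inequality in the norm of \<open>Q\<close>: in the expansion around the
  projection the cross term is nonnegative by the variational inequality. Applied at the true
  parameter, it shows that projecting never increases the error.\<close>

lemma proj_contracts:
  assumes Q: "pos_def Q" and D: "convex D" "compact D" "z \<in> D"
  shows "qform Q (proj Q D x - z) \<le> qform Q (x - z)"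
proof -
  define y where "y = proj Q D x"
  have sym: "transpose Q = Q" using Q by (simp add: pos_def_def)
  have y: "y \<in> D" "\<And>w. w \<in> D \<Longrightarrow> qform Q (x - y) \<le> qform Q (x - w)"
    using proj_minimizes[OF D(2)] D(3) unfolding y_def by blast+
  have nonneg: "0 \<le> qform Q w" for w
    using Q by (cases "w = 0") (auto simp: pos_def_def qform_def less_imp_le)
  have "qform Q (x - z) = qform Q ((x - y) + (y - z))" by simp
  also have "\<dots> = qform Q (x - y) + 2 * ((y - z) \<bullet> (Q *v (x - y))) + qform Q (y - z)"
    by (rule qform_add_vector[OF sym])
  also have "(y - z) \<bullet> (Q *v (x - y)) = - ((z - y) \<bullet> (Q *v (x - y)))"
    by (metis inner_minus_left minus_diff_eq)
  finally show ?thesis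
    using qform_minimizer_variational[OF sym D(1) y(1) D(3) y(2)] nonneg[of "x - y"]
    by (simp add: y_def)
qed

text \<open>A fixed lower bound \<open>c\<close> makes the set closed, which the positive definite
  matrices are not. One \<open>c\<close> serves a whole recursion, because inverse gains only grow
  in the order of quadratic forms.\<close>

definition coercive_forms :: "real \<Rightarrow> (real^'d^'d) set" where
  "coercive_forms c = {Q. transpose Q = Q \<and> (\<forall>x. c * (norm x)\<^sup>2 \<le> qform Q x)}"

lemma pos_def_coercive:
  fixes Q :: "real^'d^'d"
  assumes "pos_def Q"
  obtains c where "c > 0" "Q \<in> coercive_forms c"
proof -
  have "sphere (0::real^'d) 1 \<noteq> {}" by simp
  moreover have "continuous_on (sphere (0::real^'d) 1) (qform Q)"
    by (intro continuous_intros)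
  ultimately obtain m where m: "m \<in> sphere 0 1" "\<And>x. x \<in> sphere 0 1 \<Longrightarrow> qform Q m \<le> qform Q x"
    using continuous_attains_inf[of "sphere (0::real^'d) 1" "qform Q"] compact_sphere by blast
  have "m \<noteq> 0" using m(1) by auto
  then have c: "qform Q m > 0" using assms by (simp add: pos_def_def)
  have "qform Q m * (norm x)\<^sup>2 \<le> qform Q x" for x
  proof (cases "x = 0")
    case False
    then have "qform Q m \<le> qform Q ((1 / norm x) *\<^sub>R x)"
      by (intro m(2)) simp
    then show ?thesis using False
      unfolding qform_scaleR by (simp add: field_simps)
  qed (simp add: qform_def)
  then show thesis using c assms by (intro that[of "qform Q m"]) (auto simp: coercive_forms_def pos_def_def)
qed

lemma closed_coercive_forms: "closed (coercive_forms c :: (real^'d^'d) set)"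
proof -
  have "coercive_forms c = {Q::real^'d^'d. transpose Q = Q} \<inter> (\<Inter>x. {Q. c * (norm x)\<^sup>2 \<le> qform Q x})"
    by (auto simp: coercive_forms_def)
  moreover have "closed {Q::real^'d^'d. transpose Q = Q}"
    unfolding transpose_def
    by (intro closed_Collect_eq continuous_on_vec_lambda continuous_on_component continuous_on_id)
  moreover have "closed {Q::real^'d^'d. c * (norm x)\<^sup>2 \<le> qform Q x}" for x
    by (intro closed_Collect_le continuous_intros)
  ultimately show ?thesis by (simp add: closed_Int closed_INT)
qed

text \<open>Closed graph theorem with compact range. The graph is cut out by the minimality
  inequalities, each of them closed. These determine the point, because adding the variational
  inequalities of two minimisers forces their difference to have nonpositive form, hence to vanish
  by coercivity. Joint continuity in norm and point is what makes the random projection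
  measurable.\<close>

lemma continuous_on_proj:
  assumes D: "convex D" "compact D" "D \<noteq> {}" and c: "c > 0"
  shows "continuous_on (coercive_forms c \<times> UNIV) (\<lambda>p. proj (fst p) D (snd p))"
proof (rule continuous_from_closed_graph[OF D(2)])
  let ?S = "coercive_forms c \<times> (UNIV :: (real^'a) set)"
  show "(\<lambda>p. proj (fst p) D (snd p)) \<in> ?S \<rightarrow> D"
    using proj_minimizes(1)[OF D(2,3)] by auto
  let ?G = "((?S \<times> UNIV) \<inter> (UNIV \<times> D)) \<inter>
      (\<Inter>z\<in>D. {p. qform (fst (fst p)) (snd (fst p) - snd p) \<le> qform (fst (fst p)) (snd (fst p) - z)})"
  have eq: "y = proj Q D x" if Q: "Q \<in> coercive_forms c" and y: "y \<in> D"
    and min: "\<And>z. z \<in> D \<Longrightarrow> qform Q (x - y) \<le> qform Q (x - z)" for Q x y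
  proof -
    define w where "w = proj Q D x"
    have sym: "transpose Q = Q" using Q by (simp add: coercive_forms_def)
    have w: "w \<in> D" "\<And>z. z \<in> D \<Longrightarrow> qform Q (x - w) \<le> qform Q (x - z)"
      using proj_minimizes[OF D(2,3)] by (auto simp: w_def)
    have "(w - y) \<bullet> (Q *v (x - y)) \<le> 0"
      by (rule qform_minimizer_variational[OF sym D(1) y w(1) min])
    moreover have "(y - w) \<bullet> (Q *v (x - w)) \<le> 0"
      by (rule qform_minimizer_variational[OF sym D(1) w(1) y w(2)])
    moreover have "qform Q (w - y) = (w - y) \<bullet> (Q *v (x - y)) + (y - w) \<bullet> (Q *v (x - w))"
      by (simp add: qform_def algebra_simps inner_diff_left inner_diff_right)
    moreover have "c * (norm (w - y))\<^sup>2 \<le> qform Q (w - y)"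
      using Q by (simp add: coercive_forms_def)
    ultimately have "c * (norm (w - y))\<^sup>2 \<le> 0" by linarith
    then have "w = y" using c by (simp add: mult_le_0_iff)
    then show ?thesis by (simp add: w_def)
  qed
  have "(\<lambda>p. (p, proj (fst p) D (snd p))) ` ?S = ?G"
  proof (intro equalityI subsetI)
    fix t assume "t \<in> (\<lambda>p. (p, proj (fst p) D (snd p))) ` ?S"
    then show "t \<in> ?G" using proj_minimizes[OF D(2,3)] by auto
  next
    fix t assume t: "t \<in> ?G"
    obtain Q x y where [simp]: "t = ((Q, x), y)" by (metis surj_pair)
    have "y = proj Q D x" using t by (intro eq) auto
    then show "t \<in> (\<lambda>p. (p, proj (fst p) D (snd p))) ` ?S" using t by force
  qed
  moreover have "closed {p::((real^'a^'a) \<times> (real^'a)) \<times> (real^'a).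
      qform (fst (fst p)) (snd (fst p) - snd p) \<le> qform (fst (fst p)) (snd (fst p) - z)}" for z
    by (intro closed_Collect_le continuous_intros)
  then have "closed ?G"
    by (intro closed_Int closed_Times closed_INT ballI closed_coercive_forms closed_UNIV
        compact_imp_closed[OF D(2)])
  ultimately show "closed ((\<lambda>p. (p, proj (fst p) D (snd p))) ` ?S)" by simp
qed

section \<open>Inverse gains and the trace\<close>

lemma matrix_eqI_vector: "(\<And>x. A *v x = B *v x) \<Longrightarrow> A = (B::real^'d^'e)"
  by (simp add: matrix_eq)

lemma pos_def_invertible:
  fixes Q :: "real^'d^'d"
  assumes "pos_def Q"
  shows "invertible Q"
proof -
  have "x = 0" if "Q *v x = 0" for x
  proof (rule ccontr)
    assume "x \<noteq> 0"
    then have "0 < qform Q x" using assms by (simp add: pos_def_def)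
    then show False using that by (simp add: qform_def)
  qed
  then have "\<exists>B. B ** Q = mat 1" by (subst matrix_left_invertible_ker) blast
  then show ?thesis unfolding invertible_left_inverse .
qed

lemma matrix_inv_eqI:
  fixes A B :: "real^'d^'d"
  assumes "A ** B = mat 1"
  shows "matrix_inv A = B"
proof -
  have "B ** A = mat 1" using assms by (rule matrix_left_right_inverse[THEN iffD1])
  then have "\<exists>C. A ** C = mat 1 \<and> C ** A = mat 1" using assms by blast
  from someI_ex[OF this] have inv: "A ** matrix_inv A = mat 1"
    unfolding matrix_inv_def[symmetric] by simp
  have "matrix_inv A = (B ** A) ** matrix_inv A"
    by (simp add: \<open>B ** A = mat 1\<close>)
  also have "\<dots> = B ** (A ** matrix_inv A)" by (simp add: matrix_mul_assoc)
  also have "\<dots> = B" using inv by simp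
  finally show ?thesis .
qed

lemma pos_def_matrix_inv:
  fixes Q :: "real^'d^'d"
  assumes "pos_def Q"
  shows "pos_def (matrix_inv Q)" "Q ** matrix_inv Q = mat 1" "matrix_inv Q ** Q = mat 1"
proof -
  have inv: "invertible Q" by (rule pos_def_invertible[OF assms])
  show Q: "Q ** matrix_inv Q = mat 1" "matrix_inv Q ** Q = mat 1"
    using someI_ex[OF inv[unfolded invertible_def]] by (auto simp: matrix_inv_def)
  have sym: "transpose Q = Q" using assms by (simp add: pos_def_def)
  have "Q ** transpose (matrix_inv Q) = transpose (matrix_inv Q ** Q)"
    by (simp add: matrix_transpose_mul sym)
  also have "\<dots> = mat 1" by (simp add: Q)
  finally have "transpose (matrix_inv Q) = matrix_inv Q" by (rule matrix_inv_eqI[symmetric])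
  moreover have "0 < qform (matrix_inv Q) x" if "x \<noteq> 0" for x
  proof -
    define w where "w = matrix_inv Q *v x"
    have x: "x = Q *v w" by (simp add: w_def matrix_vector_mul_assoc Q)
    then have "w \<noteq> 0" using that by auto
    then have "0 < qform Q w" using assms by (auto simp: pos_def_def)
    then show ?thesis by (simp add: qform_def w_def[symmetric] x[symmetric] inner_commute)
  qed
  ultimately show "pos_def (matrix_inv Q)" by (simp add: pos_def_def)
qed

lemma pos_def_nonneg: "pos_def Q \<Longrightarrow> 0 \<le> qform Q x"
  by (cases "x = 0") (auto simp: pos_def_def qform_def less_imp_le)

lemma sandwich_mult_vector:
  assumes "transpose P = P"
  shows "(P ** outer a a ** P) *v x = (a \<bullet> (P *v x)) *\<^sub>R (P *v a)"
  by (simp add: matrix_vector_mul_assoc[symmetric] outer_mult_vector matrix_vector_mult_scaleR)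

text \<open>Matrix inversion lemma: the gain recursion for \<open>P\<close> is an additive recursion for its inverse.\<close>

lemma gain_update:
  fixes P :: "real^'d^'d"
  assumes P: "pos_def P" and mu: "m > 0" and s: "s \<ge> 0"
    and a: "a = 1 / (m + s * qform P v)"
    and P': "P' = P - (a * s) *\<^sub>R (P ** outer v v ** P)"
  shows "matrix_inv P' = matrix_inv P + (s / m) *\<^sub>R outer v v"
    and "pos_def P'"
    and "matrix_inv P' *v (P *v v) = (1 / (a * m)) *\<^sub>R v"
    and "0 < a" "a \<le> 1 / m"
proof -
  define W where "W = matrix_inv P"
  define W' where "W' = W + (s / m) *\<^sub>R outer v v"
  define q where "q = qform P v"
  have q: "q \<ge> 0" unfolding q_def by (rule pos_def_nonneg[OF P])
  have pos: "m + s * q > 0" using mu s q by (simp add: add_pos_nonneg)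
  show a0: "0 < a" "a \<le> 1 / m"
    using pos mu s q by (auto simp: a q_def[symmetric] field_simps)
  have sym: "transpose P = P" using P by (simp add: pos_def_def)
  have inv: "P ** W = mat 1" "W ** P = mat 1" and W: "pos_def W"
    using pos_def_matrix_inv[OF P] by (auto simp: W_def)
  have WP: "W *v (P *v x) = x" for x
    by (simp add: matrix_vector_mul_assoc inv)
  \<comment> \<open>\<open>a\<close> is the reciprocal of \<open>m + s * q\<close>; this makes the
    rank-one terms in the product of \<open>W'\<close> and \<open>P'\<close> cancel.\<close>
  have coef: "a * s + (s / m) * (a * s) * q = s / m"
  proof -
    have "a * s + (s / m) * (a * s) * q = (s / m) * (a * (m + s * q))"
      using mu by (simp add: field_simps)
    also have "a * (m + s * q) = 1" using pos by (simp add: a q_def[symmetric])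
    finally show ?thesis by simp
  qed
  have "W' *v (P' *v x) = x" for x
  proof -
    have "P' *v x = P *v x - (a * s * (v \<bullet> (P *v x))) *\<^sub>R (P *v v)"
      by (simp add: P' matrix_vector_mult_diff_rdistrib scaleR_matrix_mult_vector
          sandwich_mult_vector[OF sym])
    moreover have "W' *v z = W *v z + ((s / m) * (v \<bullet> z)) *\<^sub>R v" for z
      by (simp add: W'_def matrix_vector_mult_add_rdistrib scaleR_matrix_mult_vector outer_mult_vector)
    ultimately have "W' *v (P' *v x) = W *v (P *v x - (a * s * (v \<bullet> (P *v x))) *\<^sub>R (P *v v))
        + ((s / m) * (v \<bullet> (P *v x - (a * s * (v \<bullet> (P *v x))) *\<^sub>R (P *v v)))) *\<^sub>R v"
      by simp
    also have "W *v (P *v x - (a * s * (v \<bullet> (P *v x))) *\<^sub>R (P *v v))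
        = x - (a * s * (v \<bullet> (P *v x))) *\<^sub>R v"
      by (simp add: matrix_vector_mult_diff_distrib matrix_vector_mult_scaleR WP)
    also have "v \<bullet> (P *v x - (a * s * (v \<bullet> (P *v x))) *\<^sub>R (P *v v))
        = (v \<bullet> (P *v x)) * (1 - a * s * q)"
      by (simp add: inner_diff_right q_def qform_def algebra_simps)
    also have "x - (a * s * (v \<bullet> (P *v x))) *\<^sub>R v + ((s / m) * ((v \<bullet> (P *v x)) * (1 - a * s * q))) *\<^sub>R v
        = x + ((v \<bullet> (P *v x)) * ((s / m) - (a * s + (s / m) * (a * s) * q))) *\<^sub>R v"
      by (simp add: algebra_simps flip: scaleR_add_left scaleR_diff_left)
    finally show ?thesis unfolding coef by simp
  qed
  then have W'P': "W' ** P' = mat 1"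
    by (intro matrix_eqI_vector) (simp add: matrix_vector_mul_assoc)
  then have P'W': "P' ** W' = mat 1" by (rule matrix_left_right_inverse[THEN iffD1])
  show "matrix_inv P' = matrix_inv P + (s / m) *\<^sub>R outer v v"
    using matrix_inv_eqI[OF P'W'] by (simp add: W'_def W_def)
  have symW: "transpose W = W" using W by (simp add: pos_def_def)
  have "transpose W' = W + (s / m) *\<^sub>R outer v v"
    unfolding W'_def using symW by (simp add: vec_eq_iff transpose_def outer_def mult_ac)
  moreover have "0 < qform W' x" if "x \<noteq> 0" for x
  proof -
    have "0 < qform W x" using W that by (simp add: pos_def_def)
    moreover have "0 \<le> (s / m) * qform (outer v v) x" using s mu by (simp add: qform_outer)
    ultimately show ?thesis unfolding W'_def qform_add_matrix by linarith
  qed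
  ultimately have "pos_def W'" by (simp add: pos_def_def W'_def)
  then have "pos_def (matrix_inv W')" by (rule pos_def_matrix_inv)
  moreover have "matrix_inv W' = P'" by (rule matrix_inv_eqI[OF W'P'])
  ultimately show "pos_def P'" by simp
  \<comment> \<open>The new inverse gain sends the update direction \<open>P *v v\<close> to a
    multiple of \<open>v\<close>. In the Lyapunov function the update therefore meets the error only
    through the scalar prediction error.\<close>
  have "1 + (s / m) * q = 1 / (a * m)" using pos mu by (simp add: a q_def[symmetric] field_simps)
  moreover have "W' *v (P *v v) = (1 + (s / m) * q) *\<^sub>R v"
    by (simp add: W'_def matrix_vector_mult_add_rdistrib scaleR_matrix_mult_vector outer_mult_vector
        WP q_def qform_def algebra_simps)
  ultimately show "matrix_inv P' *v (P *v v) = (1 / (a * m)) *\<^sub>R v"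
    using matrix_inv_eqI[OF P'W'] by simp
qed

text \<open>\<open>P v v^T P\<close> has trace \<open>|P v|^2\<close>, so the squared update
  directions, weighted by \<open>a * s\<close>, telescope and sum to at most the trace of the
  initial gain.\<close>

lemma trace_gain_update:
  assumes "pos_def P" and P': "P' = P - (a * s) *\<^sub>R (P ** outer v v ** P)"
  shows "trace P' = trace P - a * s * (norm (P *v v))\<^sup>2"
proof -
  have sym: "transpose P = P" using assms by (simp add: pos_def_def)
  have "(P ** outer v v ** P) $ i $ i = ((P *v v) $ i)\<^sup>2" for i
  proof -
    have "(P ** outer v v ** P) $ i $ i = ((P ** outer v v ** P) *v axis i 1) $ i"
      by (simp add: matrix_vector_mult_basis column_def)
    also have "\<dots> = (v \<bullet> (P *v axis i 1)) * (P *v v) $ i"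
      by (simp add: sandwich_mult_vector[OF sym])
    also have "v \<bullet> (P *v axis i 1) = (P *v v) $ i"
      unfolding inner_sym_matrix[OF sym] by (simp add: inner_axis)
    finally show ?thesis by (simp add: power2_eq_square)
  qed
  then show ?thesis
    unfolding P' trace_def
    by (simp add: sum_subtractf sum_distrib_left norm_eq_sqrt_inner inner_vec_def power2_eq_square
        sum_nonneg)
qed

lemma trace_pos_def_nonneg:
  assumes "pos_def P"
  shows "0 \<le> trace P"
  unfolding trace_def
proof (rule sum_nonneg)
  fix i
  have "0 \<le> qform P (axis i 1)" by (rule pos_def_nonneg[OF assms])
  then show "0 \<le> P $ i $ i"
    by (simp add: qform_def matrix_vector_mult_basis column_def inner_axis')
qed

text \<open>The norm of the new inverse gain serves twice: projecting does not increase the error in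
  it, and the additive recursion rewrites it as the old form plus \<open>(s / m) * h^2\<close>.
  Since \<open>h = p \<bullet> (t - x)\<close>, an innovation with the sign of \<open>h\<close> acts
  to lower the form through the cross term.\<close>

lemma lyapunov_step:
  fixes P :: "real^'d^'d"
  assumes P: "pos_def P" and mu: "m > 0" and s: "s \<ge> 0"
    and a: "a = 1 / (m + s * qform P p)"
    and P': "P' = P - (a * s) *\<^sub>R (P ** outer p p ** P)"
    and D: "convex D" "compact D" "t \<in> D"
    and x': "x' = proj (matrix_inv P') D (x + (a * b * v) *\<^sub>R (P *v p))"
    and h: "h = p \<bullet> (t - x)"
  shows "qform (matrix_inv P') (x' - t) \<le> qform (matrix_inv P) (x - t) + (s / m) * h\<^sup>2
            - 2 * (b / m) * h * v + a * b\<^sup>2 * v\<^sup>2 * qform P p / m"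
proof -
  note G = gain_update[OF P mu s a P']
  define W' where "W' = matrix_inv P'"
  have W': "pos_def W'" unfolding W'_def by (rule pos_def_matrix_inv(1)[OF G(2)])
  then have sym: "transpose W' = W'" by (simp add: pos_def_def)
  have "qform W' (x' - t) \<le> qform W' (x + (a * b * v) *\<^sub>R (P *v p) - t)"
    unfolding x' W'_def[symmetric] by (rule proj_contracts[OF W' D])
  also have "x + (a * b * v) *\<^sub>R (P *v p) - t = (x - t) + (a * b * v) *\<^sub>R (P *v p)"
    by simp
  also have "qform W' \<dots> = qform W' (x - t) + 2 * (a * b * v) * ((x - t) \<bullet> (W' *v (P *v p)))
      + (a * b * v)\<^sup>2 * qform W' (P *v p)"
    by (subst qform_add_vector[OF sym], subst qform_scaleR)
      (simp add: inner_sym_matrix[OF sym, of "x - t"] inner_commute[of "P *v p"])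
  also have "qform W' (P *v p) = qform P p / (a * m)"
    using G(3) by (simp add: W'_def qform_def inner_commute)
  also have "(x - t) \<bullet> (W' *v (P *v p)) = - h / (a * m)"
    using G(3) by (simp add: W'_def h inner_commute inner_diff_left inner_diff_right diff_divide_distrib)
  also have "qform W' (x - t) = qform (matrix_inv P) (x - t) + (s / m) * h\<^sup>2"
  proof -
    have "(p \<bullet> (x - t))\<^sup>2 = h\<^sup>2" by (simp add: h inner_diff_right power2_commute)
    then show ?thesis unfolding W'_def G(1) qform_add_matrix qform_outer by simp
  qed
  also have "2 * (a * b * v) * (- h / (a * m)) = - 2 * (b / m) * h * v"
    using G(4) mu by simp
  also have "(a * b * v)\<^sup>2 * (qform P p / (a * m)) = a * b\<^sup>2 * v\<^sup>2 * qform P p / m"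
    using G(4) by (simp add: power_mult_distrib power2_eq_square)
  finally show ?thesis
    by (simp add: W'_def)
qed

section \<open>Regret along a single path\<close>

lemma sum_le_sqrt_card:
  fixes f :: "nat \<Rightarrow> real"
  shows "(\<Sum>k<n. f k) \<le> sqrt (real n * (\<Sum>k<n. (f k)\<^sup>2))"
  using sum_squared_le_sum_of_squares[of f "{..<n}"]
  by (intro real_le_rsqrt) (simp add: mult.commute)

text \<open>A deterministic statement about one path. \<open>dissip\<close> splits the innovation:
  its mean yields \<open>- kap * h^2\<close> up to an inherited error \<open>e\<close>, and
  \<open>z\<close> is the martingale part. What remains of the Lyapunov step is the quadratic term,
  carried by \<open>T\<close>.\<close>

lemma regret_sqrt:
  fixes P :: "nat \<Rightarrow> real^'d^'d" and x p :: "nat \<Rightarrow> real^'d"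
    and a be b m h v e z :: "nat \<Rightarrow> real"
  assumes P0: "pos_def (P 0)"
    and be: "\<And>k. c \<le> be k" "0 < c"
    and b: "\<And>k. 0 \<le> b k" "\<And>k. b k \<le> 1"
    and m: "\<And>k. m0 \<le> m k" "\<And>k. m k \<le> m1" "0 < m0"
    and p: "\<And>k. norm (p k) \<le> K"
    and a: "\<And>k. a k = 1 / (m k + be k * (b k)\<^sup>2 * qform (P k) (p k))"
    and P_Suc: "\<And>k. P (Suc k) = P k - (a k * be k * (b k)\<^sup>2) *\<^sub>R (P k ** outer (p k) (p k) ** P k)"
    and x_Suc: "\<And>k. x (Suc k) = proj (matrix_inv (P (Suc k))) D (x k + (a k * b k * v k) *\<^sub>R (P k *v p k))"
    and D: "convex D" "compact D" "t \<in> D"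
    and h: "\<And>k. h k = p k \<bullet> (t - x k)"
    and v: "\<And>k. \<bar>v k\<bar> \<le> 2"
    and dissip: "\<And>k. be k * (b k)\<^sup>2 * (h k)\<^sup>2 - 2 * b k * h k * v k
        \<le> - kap * (h k)\<^sup>2 + K2 * (e k)\<^sup>2 - 2 * z k" and kap: "kap > 0" "K2 \<ge> 0"
    and e: "\<exists>K3. \<forall>\<^sub>F n in sequentially. (\<Sum>k<n. (e k)\<^sup>2) \<le> K3 * sqrt (real n)"
    and mart: "\<And>d. d > 0 \<Longrightarrow> \<exists>K4. \<forall>\<^sub>F n in sequentially.
        - (\<Sum>k<n. z k / m k) \<le> d * (\<Sum>k<n. (h k)\<^sup>2) + K4 * sqrt (real n)"
  shows "\<exists>K. \<forall>\<^sub>F n in sequentially. (\<Sum>k<n. (h k)\<^sup>2) \<le> K * sqrt (real n)"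
proof -
  define q where "q k = qform (P k) (p k)" for k
  define T where "T k = a k * (b k)\<^sup>2 * q k" for k
  define V where "V k = qform (matrix_inv (P k)) (x k - t)" for k
  have m_pos: "m k > 0" for k using m(1)[of k] m(3) by linarith
  have m1: "m1 > 0" using m_pos[of 0] m(2)[of 0] by linarith
  have be_pos: "be k > 0" for k using be(1)[of k] be(2) by linarith
  have s: "be k * (b k)\<^sup>2 \<ge> 0" for k using be_pos[of k] by simp
  have a': "a k = 1 / (m k + (be k * (b k)\<^sup>2) * qform (P k) (p k))" for k
    by (simp add: a)
  have P': "P (Suc k) = P k - (a k * (be k * (b k)\<^sup>2)) *\<^sub>R (P k ** outer (p k) (p k) ** P k)" for k
    by (simp add: P_Suc mult.assoc)
  have pd: "pos_def (P k)" for k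
    by (induction k) (use P0 gain_update(2)[OF _ m_pos s a' P'] in auto)
  note G = gain_update[OF pd m_pos s a' P']
  have q: "q k \<ge> 0" for k unfolding q_def by (rule pos_def_nonneg[OF pd])
  have ap: "a k > 0" "a k \<le> 1 / m0" for k
  proof -
    show "a k > 0" by (rule G(4))
    have "a k \<le> 1 / m k" by (rule G(5))
    also have "\<dots> \<le> 1 / m0" using m(1)[of k] m(3) by (simp add: frac_le)
    finally show "a k \<le> 1 / m0" .
  qed
  have T0: "T k \<ge> 0" for k using ap[of k] q[of k] by (simp add: T_def)
  have K0: "K \<ge> 0" using p[of 0] norm_ge_zero order_trans by blast
  have Vnn: "V k \<ge> 0" for k
    unfolding V_def by (intro pos_def_nonneg pos_def_matrix_inv(1) pd)
  have step: "V (Suc k) \<le> V k - kap / m1 * (h k)\<^sup>2 + K2 / m0 * (e k)\<^sup>2 - 2 * (z k / m k) + 4 / m0 * T k" for k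
  proof -
    have "V (Suc k) \<le> V k + (be k * (b k)\<^sup>2 / m k) * (h k)\<^sup>2 - 2 * (b k / m k) * h k * v k
        + a k * (b k)\<^sup>2 * (v k)\<^sup>2 * qform (P k) (p k) / m k"
      unfolding V_def by (rule lyapunov_step[OF pd m_pos s a' P' D x_Suc h])
    also have "\<dots> = V k + (be k * (b k)\<^sup>2 * (h k)\<^sup>2 - 2 * b k * h k * v k) / m k + T k * (v k)\<^sup>2 / m k"
      by (simp add: T_def q_def diff_divide_distrib)
    finally have V: "V (Suc k) \<le> V k + (be k * (b k)\<^sup>2 * (h k)\<^sup>2 - 2 * b k * h k * v k) / m k
        + T k * (v k)\<^sup>2 / m k" .
    have "(be k * (b k)\<^sup>2 * (h k)\<^sup>2 - 2 * b k * h k * v k) / m k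
        \<le> (- kap * (h k)\<^sup>2 + K2 * (e k)\<^sup>2 - 2 * z k) / m k"
      using dissip[of k] m_pos[of k] by (intro divide_right_mono) auto
    also have "\<dots> = - (kap * (h k)\<^sup>2 / m k) + K2 * (e k)\<^sup>2 / m k - 2 * (z k / m k)"
      by (simp add: diff_divide_distrib add_divide_distrib)
    finally have A: "(be k * (b k)\<^sup>2 * (h k)\<^sup>2 - 2 * b k * h k * v k) / m k
        \<le> - (kap * (h k)\<^sup>2 / m k) + K2 * (e k)\<^sup>2 / m k - 2 * (z k / m k)" .
    have B: "kap * (h k)\<^sup>2 / m1 \<le> kap * (h k)\<^sup>2 / m k"
      using kap m(2)[of k] m_pos[of k] m1 by (intro divide_left_mono) auto
    have C: "K2 * (e k)\<^sup>2 / m k \<le> K2 * (e k)\<^sup>2 / m0"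
      using kap m(1)[of k] m(3) m_pos[of k] by (intro divide_left_mono) auto
    have "T k * (v k)\<^sup>2 / m k \<le> T k * 4 / m0"
    proof (intro frac_le mult_left_mono T0 m)
      show "(v k)\<^sup>2 \<le> 4" using v[of k] abs_le_square_iff[of "v k" 2] by simp
    qed (use T0[of k] in auto)
    then have "T k * (v k)\<^sup>2 / m k \<le> 4 * T k / m0" by (simp add: mult.commute)
    then show ?thesis using V A B C by simp
  qed
  have "V n + kap / m1 * (\<Sum>k<n. (h k)\<^sup>2)
      \<le> V 0 + K2 / m0 * (\<Sum>k<n. (e k)\<^sup>2) - 2 * (\<Sum>k<n. z k / m k) + 4 / m0 * (\<Sum>k<n. T k)" for n
  proof (induction n)
    case (Suc n)
    then show ?case using step[of n] by (simp add: distrib_left)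
  qed simp
  then have tele: "kap / m1 * (\<Sum>k<n. (h k)\<^sup>2)
      \<le> V 0 + K2 / m0 * (\<Sum>k<n. (e k)\<^sup>2) - 2 * (\<Sum>k<n. z k / m k) + 4 / m0 * (\<Sum>k<n. T k)" for n
    using Vnn[of n] by (smt (verit, best))
  define R where "R k = a k * (be k * (b k)\<^sup>2) * (norm (P k *v p k))\<^sup>2" for k
  have "trace (P n) + (\<Sum>k<n. R k) = trace (P 0)" for n
    by (induction n) (simp_all add: trace_gain_update[OF pd P'] R_def)
  then have R: "(\<Sum>k<n. R k) \<le> trace (P 0)" for n
    using trace_pos_def_nonneg[OF pd, of n] by (smt (verit, best))
  \<comment> \<open>Cauchy-Schwarz bounds \<open>q k\<close> by \<open>K\<close> times the length of
    \<open>P k *v p k\<close>, so it is the square of \<open>T k\<close> that compares with the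
    trace decrement \<open>R k\<close>; \<open>b k \<le> 1\<close> and \<open>be k \<ge> c\<close>
    turn \<open>b^4\<close> into a multiple of \<open>be * b^2\<close>.\<close>
  have T2: "(T k)\<^sup>2 \<le> K\<^sup>2 / (m0 * c) * R k" for k
  proof -
    define N where "N = norm (P k *v p k)"
    have "q k \<le> norm (p k) * N"
      unfolding q_def qform_def N_def by (rule norm_cauchy_schwarz)
    also have "\<dots> \<le> K * N" using p by (intro mult_right_mono) (auto simp: N_def)
    finally have "(q k)\<^sup>2 \<le> (K * N)\<^sup>2" using q by (intro power_mono) auto
    then have "(T k)\<^sup>2 \<le> (a k)\<^sup>2 * (b k)^4 * (K * N)\<^sup>2"
      unfolding T_def power_mult_distrib by (simp add: mult_left_mono flip: power_mult)
    also have "\<dots> = K\<^sup>2 * (a k * (a k * ((b k)^4 * N\<^sup>2)))"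
      by (simp add: power_mult_distrib power2_eq_square)
    also have "\<dots> \<le> K\<^sup>2 * (1 / m0 * (a k * ((be k / c * (b k)\<^sup>2) * N\<^sup>2)))"
    proof (intro mult_left_mono mult_mono mult_right_mono ap)
      have "(b k)^4 = (b k)\<^sup>2 * (b k)\<^sup>2" by (simp flip: power_add)
      also have "\<dots> \<le> 1 * (b k)\<^sup>2" using b by (intro mult_right_mono power_le_one) auto
      also have "1 * (b k)\<^sup>2 \<le> be k / c * (b k)\<^sup>2"
        using be by (intro mult_right_mono) (auto simp: field_simps)
      finally show "(b k)^4 \<le> be k / c * (b k)\<^sup>2" .
    qed (use ap[of k] m(3) be_pos[of k] be(2) in \<open>auto intro: less_imp_le\<close>)
    also have "\<dots> = K\<^sup>2 / (m0 * c) * R k"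
      by (simp add: R_def N_def)
    finally show ?thesis .
  qed
  define K5 where "K5 = sqrt (K\<^sup>2 / (m0 * c) * trace (P 0))"
  \<comment> \<open>The squares have a bounded sum; passing back to first powers costs
    \<open>sqrt n\<close>, the order of regret aimed at.\<close>
  have sumT: "(\<Sum>k<n. T k) \<le> K5 * sqrt (real n)" for n
  proof -
    have "(\<Sum>k<n. (T k)\<^sup>2) \<le> (\<Sum>k<n. K\<^sup>2 / (m0 * c) * R k)" by (intro sum_mono T2)
    also have "\<dots> \<le> K\<^sup>2 / (m0 * c) * trace (P 0)"
      unfolding sum_distrib_left[symmetric] using R m(3) be(2) by (intro mult_left_mono) auto
    finally have "real n * (\<Sum>k<n. (T k)\<^sup>2) \<le> real n * (K\<^sup>2 / (m0 * c) * trace (P 0))"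
      by (intro mult_left_mono) auto
    then have "sqrt (real n * (\<Sum>k<n. (T k)\<^sup>2)) \<le> K5 * sqrt (real n)"
      unfolding K5_def real_sqrt_mult[symmetric] by (simp add: mult.commute)
    then show ?thesis using sum_le_sqrt_card[of T n] by linarith
  qed
  obtain K3 where K3: "\<forall>\<^sub>F n in sequentially. (\<Sum>k<n. (e k)\<^sup>2) \<le> K3 * sqrt (real n)"
    using e by blast
  \<comment> \<open>A quarter of the dissipation rate \<open>kap / m1\<close>: the martingale sum
    enters with factor 2, so half of the dissipation survives.\<close>
  obtain K4 where K4: "\<forall>\<^sub>F n in sequentially.
      - (\<Sum>k<n. z k / m k) \<le> kap / (4 * m1) * (\<Sum>k<n. (h k)\<^sup>2) + K4 * sqrt (real n)"
    using mart[of "kap / (4 * m1)"] kap m1 by auto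
  let ?B = "V 0 + K2 / m0 * K3 + 2 * K4 + 4 / m0 * K5"
  have "\<forall>\<^sub>F n in sequentially. (\<Sum>k<n. (h k)\<^sup>2) \<le> (2 * m1 / kap * ?B) * sqrt (real n)"
    using K3 K4 eventually_ge_at_top[of 1]
  proof eventually_elim
    case (elim n)
    have n: "sqrt (real n) \<ge> 1" using elim(3) by simp
    let ?H = "\<Sum>k<n. (h k)\<^sup>2"
    have V0: "V 0 * 1 \<le> V 0 * sqrt (real n)" by (intro mult_left_mono Vnn n)
    have E: "K2 / m0 * (\<Sum>k<n. (e k)\<^sup>2) \<le> K2 / m0 * (K3 * sqrt (real n))"
      using elim(1) kap m(3) by (intro mult_left_mono) auto
    have T: "4 / m0 * (\<Sum>k<n. T k) \<le> 4 / m0 * (K5 * sqrt (real n))"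
      using sumT m(3) by (intro mult_left_mono) auto
    have H: "kap / (4 * m1) * ?H = (kap / m1 * ?H) / 4" by simp
    have B: "?B * sqrt (real n) = V 0 * sqrt (real n) + K2 / m0 * (K3 * sqrt (real n))
        + 2 * (K4 * sqrt (real n)) + 4 / m0 * (K5 * sqrt (real n))"
      by (simp add: distrib_right)
    \<comment> \<open>Stated over fresh reals, so that linear arithmetic treats the sums and
      products as atoms.\<close>
    have arith: "H / 2 \<le> S" if "v0 * 1 \<le> v" "A \<le> A'" "T \<le> T'" "G = H / 4"
      "S = v + A' + 2 * Z' + T'" "H \<le> v0 + A - 2 * z + T" "- z \<le> G + Z'"
      for H S v0 v A A' T T' G Z' z :: real
      using that by linarith
    have "(kap / m1 * ?H) / 2 \<le> ?B * sqrt (real n)"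
      by (rule arith[OF V0 E T H B tele elim(2)])
    also have "(kap / m1 * ?H) / 2 = kap / (2 * m1) * ?H"
      by simp
    finally show ?case using kap m1 by (simp add: field_simps)
  qed
  then show ?thesis by blast
qed

subsection \<open>Exponential supermartingales\<close>

locale filtered_prob_space = prob_space M for M :: "'a measure" +
  fixes Fk :: "nat \<Rightarrow> 'a measure"
  assumes filt: "filtration (space M) Fk" and subalg: "\<And>k. subalgebra M (Fk k)"
begin

lemma sigma_finite_Fk: "sigma_finite_subalgebra M (Fk k)"
  by (intro finite_measure_subalgebra_is_sigma_finite finite_measure_subalgebra.intro
      finite_measure_subalgebra_axioms.intro subalg) unfold_locales

lemma measurable_Fk: "f \<in> borel_measurable (Fk k) \<Longrightarrow> f \<in> borel_measurable M"
  by (rule measurable_from_subalg[OF subalg])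

lemma subalgebra_Fk: "i \<le> j \<Longrightarrow> subalgebra (Fk j) (Fk i)"
  using filtration.space_F[OF filt] filtration.sets_F_mono[OF filt] by (simp add: subalgebra_def)

lemma measurable_Fk_mono: "i \<le> j \<Longrightarrow> f \<in> borel_measurable (Fk i) \<Longrightarrow> f \<in> borel_measurable (Fk j)"
  by (rule measurable_from_subalg[OF subalgebra_Fk])

lemma cond_exp_unit_interval:
  fixes f :: "'a \<Rightarrow> real"
  assumes "f \<in> borel_measurable M" "\<And>\<omega>. 0 \<le> f \<omega>" "\<And>\<omega>. f \<omega> \<le> 1"
  shows "AE \<omega> in M. 0 \<le> real_cond_exp M (Fk k) f \<omega> \<and> real_cond_exp M (Fk k) f \<omega> \<le> 1"
proof -
  interpret sigma_finite_subalgebra M "Fk k" by (rule sigma_finite_Fk)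
  have int: "integrable M f"
    by (rule integrable_const_bound[where B = 1]) (use assms in auto)
  show ?thesis
    using real_cond_exp_ge_c[OF int, of 0] real_cond_exp_le_c[OF int, of 1] assms by auto
qed

text \<open>The partial products form a supermartingale: the first \<open>n\<close> factors are
  known at time \<open>n\<close> and leave the conditional expectation, and the last one has
  conditional mean at most 1. Working with nonnegative integrals spares the integrability of the
  exponentials.\<close>

lemma nn_integral_exp_sum_le_1:
  fixes X :: "nat \<Rightarrow> 'a \<Rightarrow> real"
  assumes X: "\<And>k. X k \<in> borel_measurable (Fk (Suc k))"
    and cond: "\<And>k. AE \<omega> in M. nn_cond_exp M (Fk k) (\<lambda>\<omega>. ennreal (exp (X k \<omega>))) \<omega> \<le> 1"
  shows "(\<integral>\<^sup>+\<omega>. ennreal (exp (\<Sum>k<n. X k \<omega>)) \<partial>M) \<le> 1"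
proof (induction n)
  case (Suc n)
  interpret sigma_finite_subalgebra M "Fk n" by (rule sigma_finite_Fk)
  have meas: "(\<lambda>\<omega>. \<Sum>k<n. X k \<omega>) \<in> borel_measurable (Fk n)"
    by (intro borel_measurable_sum measurable_Fk_mono[OF _ X]) auto
  then have [measurable]: "(\<lambda>\<omega>. ennreal (exp (\<Sum>k<n. X k \<omega>))) \<in> borel_measurable (Fk n)"
    by measurable
  have [measurable]: "X n \<in> borel_measurable M" by (rule measurable_Fk[OF X])
  have "(\<integral>\<^sup>+\<omega>. ennreal (exp (\<Sum>k<Suc n. X k \<omega>)) \<partial>M)
      = (\<integral>\<^sup>+\<omega>. ennreal (exp (\<Sum>k<n. X k \<omega>)) * ennreal (exp (X n \<omega>)) \<partial>M)"
    by (simp add: exp_add ennreal_mult)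
  also have "\<dots> = (\<integral>\<^sup>+\<omega>. ennreal (exp (\<Sum>k<n. X k \<omega>))
      * nn_cond_exp M (Fk n) (\<lambda>\<omega>. ennreal (exp (X n \<omega>))) \<omega> \<partial>M)"
    by (rule nn_cond_exp_intg[symmetric]) measurable
  also have "\<dots> \<le> (\<integral>\<^sup>+\<omega>. ennreal (exp (\<Sum>k<n. X k \<omega>)) \<partial>M)"
  proof (rule nn_integral_mono_AE)
    show "AE \<omega> in M. ennreal (exp (\<Sum>k<n. X k \<omega>))
      * nn_cond_exp M (Fk n) (\<lambda>\<omega>. ennreal (exp (X n \<omega>))) \<omega> \<le> ennreal (exp (\<Sum>k<n. X k \<omega>))"
      using cond[of n]
    proof eventually_elim
      case (elim \<omega>)
      then show ?case using mult_left_mono[OF elim, of "ennreal (exp (\<Sum>k<n. X k \<omega>))"] by simp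
    qed
  qed
  also have "\<dots> \<le> 1" by (rule Suc)
  finally show ?case .
qed (simp add: emeasure_space_1)

text \<open>Since \<open>exp (- sqrt n)\<close> is summable, a Chernoff bound and Borel-Cantelli suffice here;
  no maximal inequality is needed, at the price of the additive \<open>sqrt n\<close>.\<close>

lemma AE_sum_le_sqrt:
  fixes X :: "nat \<Rightarrow> nat \<Rightarrow> 'a \<Rightarrow> real"
  assumes X: "\<And>n k. X n k \<in> borel_measurable (Fk (Suc k))"
    and cond: "\<And>n k. AE \<omega> in M. nn_cond_exp M (Fk k) (\<lambda>\<omega>. ennreal (exp (X n k \<omega>))) \<omega> \<le> 1"
  shows "AE \<omega> in M. \<forall>\<^sub>F n in sequentially. (\<Sum>k<n. X n k \<omega>) \<le> sqrt (real n)"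
proof -
  \<comment> \<open>Only one event per horizon \<open>n\<close> is controlled, so the row
    \<open>X n\<close> may change with \<open>n\<close>; the truncation level of the noise uses this
    freedom.\<close>
  define A where "A n = {\<omega> \<in> space M. (\<Sum>k<n. X n k \<omega>) \<ge> sqrt (real n)}" for n
  have [measurable]: "X n k \<in> borel_measurable M" for n k by (rule measurable_Fk[OF X])
  have A[measurable]: "A n \<in> sets M" for n unfolding A_def by measurable
  have le: "measure M (A n) \<le> exp (- sqrt (real n))" for n
  proof -
    have "ennreal (exp (sqrt (real n))) * emeasure M (A n)
        = (\<integral>\<^sup>+\<omega>. ennreal (exp (sqrt (real n))) * indicator (A n) \<omega> \<partial>M)"
      by (simp add: nn_integral_cmult_indicator)
    also have "\<dots> \<le> (\<integral>\<^sup>+\<omega>. ennreal (exp (\<Sum>k<n. X n k \<omega>)) \<partial>M)"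
      by (intro nn_integral_mono) (auto simp: A_def indicator_def)
    also have "\<dots> \<le> 1" by (rule nn_integral_exp_sum_le_1[OF X cond])
    finally have "ennreal (exp (sqrt (real n)) * measure M (A n)) \<le> ennreal 1"
      by (simp add: emeasure_eq_measure ennreal_mult)
    then have "exp (sqrt (real n)) * measure M (A n) \<le> 1" by (subst (asm) ennreal_le_iff) auto
    then show ?thesis by (simp add: exp_minus field_simps)
  qed
  have "summable (\<lambda>n. exp (- sqrt (real n)))"
  proof (rule summable_comparison_test_bigo)
    show "summable (\<lambda>n. norm (real n powr (-2)))" by (simp add: summable_real_powr_iff)
    show "(\<lambda>n. exp (- sqrt (real n))) \<in> O(\<lambda>n. real n powr (-2))" by real_asymp
  qed
  then have "summable (\<lambda>n. measure M (A n))"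
    by (rule summable_comparison_test'[where N = 0]) (use le in auto)
  then have "AE \<omega> in M. \<forall>\<^sub>F n in sequentially. \<omega> \<in> space M - A n"
    by (intro borel_cantelli_AE1 A) (auto simp: emeasure_eq_measure)
  then show ?thesis
    by eventually_elim (auto elim!: eventually_mono simp: A_def)
qed

end

text \<open>Hoeffding's bound for a fair two-point law, since \<open>(1 + exp (2 * t)) / 2\<close>
  is \<open>exp t * cosh t\<close>. Evenness covers negative \<open>t\<close>.\<close>

lemma cosh_le_exp_half_square: "cosh t \<le> exp (t\<^sup>2 / 2)" for t :: real
proof -
  have main: "cosh t \<le> exp (t\<^sup>2 / 2)" if "t \<ge> 0" for t :: real
  proof -
    have "- (2 * t) * (1 / 2) + ln (1 + 1 / 2 * (exp (2 * t) - 1)) \<le> (2 * t)\<^sup>2 / 8"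
      by (rule Hoeffdings_lemma_aux) (use that in auto)
    then have "ln ((1 + exp (2 * t)) / 2) \<le> t\<^sup>2 / 2 + t"
      by (simp add: power_mult_distrib field_simps)
    then have "exp (ln ((1 + exp (2 * t)) / 2)) \<le> exp (t\<^sup>2 / 2 + t)" by simp
    then have "(1 + exp (2 * t)) / 2 \<le> exp (t\<^sup>2 / 2 + t)"
      by (subst (asm) exp_ln) (auto intro: add_pos_pos)
    then have "(1 + exp t * exp t) / 2 \<le> exp (t\<^sup>2 / 2) * exp t"
      by (simp add: exp_add flip: exp_double power2_eq_square)
    moreover have "exp t * cosh t = (1 + exp t * exp t) / 2"
      by (simp add: cosh_def exp_minus field_simps)
    ultimately have "exp t * cosh t \<le> exp t * exp (t\<^sup>2 / 2)" by (simp only: mult.commute)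
    then show ?thesis by simp
  qed
  show ?thesis using main[of t] main[of "- t"] by (cases "t \<ge> 0") auto
qed

text \<open>A convex function lies below its chord over \<open>[-1, 1]\<close>. The chord is affine
  in \<open>w\<close>, so a centred \<open>w\<close> contributes only \<open>cosh t\<close> in the
  mean.\<close>

lemma exp_mult_le_cosh_sinh:
  fixes t w :: real
  assumes "\<bar>w\<bar> \<le> 1"
  shows "exp (t * w) \<le> cosh t + w * sinh t"
proof -
  define s where "s = (1 + w) / 2"
  have s: "0 \<le> s" "s \<le> 1" using assms by (auto simp: s_def abs_le_iff)
  have "t * w = (1 - s) *\<^sub>R (- t) + s *\<^sub>R t"
    by (simp add: s_def field_simps)
  also have "exp \<dots> \<le> (1 - s) * exp (- t) + s * exp t"
    using convex_onD[OF exp_convex s, of "- t" t] by simp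
  also have "\<dots> = cosh t + w * sinh t"
    by (simp add: s_def cosh_def sinh_def field_simps)
  finally show ?thesis .
qed

context filtered_prob_space
begin

text \<open>Self-normalised: the coefficients \<open>x k\<close> are adapted and may be unbounded,
  since their squares are subtracted in the exponent. With \<open>t = 2 * d * x k\<close> the
  compensator \<open>t^2 / 2\<close> is \<open>2 * d\<close> times \<open>d * (x k)^2\<close>, and
  dividing the exponential bound by \<open>2 * d\<close> gives the two terms on the right.\<close>

lemma AE_martingale_bound:
  assumes x: "\<And>k. x k \<in> borel_measurable (Fk k)"
    and B: "\<And>k. B k \<in> borel_measurable (Fk (Suc k))" "\<And>k \<omega>. 0 \<le> B k \<omega>" "\<And>k \<omega>. B k \<omega> \<le> (1::real)"
    and d: "d > 0"
  shows "AE \<omega> in M. \<forall>\<^sub>F n in sequentially.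
    (\<Sum>k<n. x k \<omega> * (real_cond_exp M (Fk k) (B k) \<omega> - B k \<omega>))
      \<le> d * (\<Sum>k<n. (x k \<omega>)\<^sup>2) + sqrt (real n) / (2 * d)"
proof -
  define w where "w k \<omega> = real_cond_exp M (Fk k) (B k) \<omega> - B k \<omega>" for k \<omega>
  define t where "t k \<omega> = 2 * d * x k \<omega>" for k \<omega>
  define X where "X k \<omega> = t k \<omega> * w k \<omega> - (t k \<omega>)\<^sup>2 / 2" for k \<omega>
  have BM[measurable]: "B k \<in> borel_measurable M" for k by (rule measurable_Fk[OF B(1)])
  have t[measurable]: "t k \<in> borel_measurable (Fk k)" for k
    unfolding t_def using x by measurable
  have [measurable]: "t k \<in> borel_measurable M" for k by (rule measurable_Fk[OF t])
  have w[measurable]: "w k \<in> borel_measurable M" for k unfolding w_def by measurable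
  have w1: "AE \<omega> in M. \<bar>w k \<omega>\<bar> \<le> 1" for k
    using cond_exp_unit_interval[OF BM B(2,3), of k k]
  proof eventually_elim
    case (elim \<omega>)
    then show ?case using B(2,3)[of k \<omega>] by (auto simp: w_def)
  qed
  have "AE \<omega> in M. \<forall>\<^sub>F n in sequentially. (\<Sum>k<n. X k \<omega>) \<le> sqrt (real n)"
  proof (rule AE_sum_le_sqrt)
    fix k
    have "t k \<in> borel_measurable (Fk (Suc k))" by (rule measurable_Fk_mono[OF _ t]) simp
    moreover have "real_cond_exp M (Fk k) (B k) \<in> borel_measurable (Fk (Suc k))"
      by (rule measurable_Fk_mono[of k]) auto
    ultimately show "X k \<in> borel_measurable (Fk (Suc k))"
      unfolding X_def w_def using B(1)[of k] by measurable
    interpret sigma_finite_subalgebra M "Fk k" by (rule sigma_finite_Fk)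
    \<comment> \<open>\<open>exp (X k)\<close> is dominated by \<open>1 + H * w k\<close>. Damping
      \<open>sinh\<close> by \<open>exp (- t^2 / 2)\<close> keeps \<open>H\<close> in
      \<open>[-1, 1]\<close>, so this majorant is almost surely nonnegative and integrable, and its
      conditional mean is exactly 1 because \<open>w k\<close> is centred.\<close>
    define H where "H \<omega> = exp (- (t k \<omega>)\<^sup>2 / 2) * sinh (t k \<omega>)" for \<omega>
    have H[measurable]: "H \<in> borel_measurable (Fk k)" unfolding H_def sinh_def by measurable
    have [measurable]: "H \<in> borel_measurable M" by (rule measurable_Fk[OF H])
    have H1: "\<bar>H \<omega>\<bar> \<le> 1" for \<omega>
    proof -
      have "\<bar>sinh (t k \<omega>)\<bar> \<le> cosh (t k \<omega>)"
        by (simp add: sinh_def cosh_def abs_le_iff)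
      also have "\<dots> \<le> exp ((t k \<omega>)\<^sup>2 / 2)" by (rule cosh_le_exp_half_square)
      finally show ?thesis by (simp add: H_def abs_mult exp_minus field_simps)
    qed
    have Hw: "AE \<omega> in M. \<bar>H \<omega> * w k \<omega>\<bar> \<le> 1"
      using w1[of k] by eventually_elim (use H1 in \<open>auto simp: abs_mult intro: mult_le_one\<close>)
    have Hw_int: "integrable M (\<lambda>\<omega>. H \<omega> * w k \<omega>)"
      by (rule integrable_const_bound[where B = 1]) (use Hw in auto)
    have "AE \<omega> in M. 1 = nn_cond_exp M (Fk k) (\<lambda>\<omega>. ennreal (1 + H \<omega> * w k \<omega>)) \<omega>"
    proof (rule nn_cond_exp_charact)
      fix A assume A: "A \<in> sets (Fk k)"
      then have [measurable]: "A \<in> sets M" using subalg by (auto simp: subalgebra_def)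
      have IA[measurable]: "(\<lambda>\<omega>. indicator A \<omega> * H \<omega> :: real) \<in> borel_measurable (Fk k)"
        using A by measurable
      have int: "integrable M (\<lambda>\<omega>. (indicator A \<omega> * H \<omega>) * B k \<omega>)"
        by (rule integrable_const_bound[where B = 1])
          (use B H1 in \<open>auto simp: abs_mult indicator_def intro!: mult_le_one\<close>)
      have "(\<integral>\<omega>. indicator A \<omega> * (H \<omega> * w k \<omega>) \<partial>M)
          = (\<integral>\<omega>. (indicator A \<omega> * H \<omega>) * real_cond_exp M (Fk k) (B k) \<omega>
              - (indicator A \<omega> * H \<omega>) * B k \<omega> \<partial>M)"
        by (intro Bochner_Integration.integral_cong) (auto simp: w_def algebra_simps)
      also have "\<dots> = 0"
        using real_cond_exp_intg[OF int IA BM] int by (subst Bochner_Integration.integral_diff) auto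
      finally have zero: "(\<integral>\<omega>. indicator A \<omega> * (H \<omega> * w k \<omega>) \<partial>M) = 0" .
      have int1: "integrable M (\<lambda>\<omega>. indicator A \<omega> * (H \<omega> * w k \<omega>))"
        using integrable_mult_indicator[OF \<open>A \<in> sets M\<close> Hw_int] by simp
      have intA: "integrable M (indicator A :: 'a \<Rightarrow> real)"
        by (simp add: integrable_indicator_iff emeasure_eq_measure)
      have "(\<integral>\<^sup>+\<omega>. ennreal (1 + H \<omega> * w k \<omega>) * indicator A \<omega> \<partial>M)
          = (\<integral>\<^sup>+\<omega>. ennreal (indicator A \<omega> + indicator A \<omega> * (H \<omega> * w k \<omega>)) \<partial>M)"
        by (intro nn_integral_cong) (auto simp: indicator_def)
      also have "\<dots> = ennreal (\<integral>\<omega>. indicator A \<omega> + indicator A \<omega> * (H \<omega> * w k \<omega>) \<partial>M)"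
      proof (rule nn_integral_eq_integral)
        show "AE \<omega> in M. 0 \<le> indicator A \<omega> + indicator A \<omega> * (H \<omega> * w k \<omega>)"
          using Hw by eventually_elim (auto simp: indicator_def)
      qed (use int1 intA in auto)
      also have "\<dots> = ennreal (measure M A)"
        using int1 intA zero by simp
      finally show "(\<integral>\<^sup>+\<omega>\<in>A. ennreal (1 + H \<omega> * w k \<omega>) \<partial>M) = (\<integral>\<^sup>+\<omega>\<in>A. 1 \<partial>M)"
        by (simp add: emeasure_eq_measure)
    qed auto
    moreover have "AE \<omega> in M. nn_cond_exp M (Fk k) (\<lambda>\<omega>. ennreal (exp (X k \<omega>))) \<omega>
        \<le> nn_cond_exp M (Fk k) (\<lambda>\<omega>. ennreal (1 + H \<omega> * w k \<omega>)) \<omega>"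
    proof (rule nn_cond_exp_mono)
      show "AE \<omega> in M. ennreal (exp (X k \<omega>)) \<le> ennreal (1 + H \<omega> * w k \<omega>)"
        using w1[of k]
      proof eventually_elim
        case (elim \<omega>)
        let ?t = "t k \<omega>"
        have "exp (X k \<omega>) = exp (- ?t\<^sup>2 / 2) * exp (?t * w k \<omega>)"
          by (simp add: X_def flip: exp_add)
        also have "\<dots> \<le> exp (- ?t\<^sup>2 / 2) * (cosh ?t + w k \<omega> * sinh ?t)"
          using exp_mult_le_cosh_sinh[OF elim] by simp
        also have "\<dots> = exp (- ?t\<^sup>2 / 2) * cosh ?t + H \<omega> * w k \<omega>"
          by (simp add: H_def algebra_simps)
        also have "exp (- ?t\<^sup>2 / 2) * cosh ?t \<le> exp (- ?t\<^sup>2 / 2) * exp (?t\<^sup>2 / 2)"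
          using cosh_le_exp_half_square[of ?t] by simp
        also have "\<dots> = 1" by (simp flip: exp_add)
        finally show ?case by (intro ennreal_leI) simp
      qed
    qed (unfold X_def, measurable)
    ultimately show "AE \<omega> in M. nn_cond_exp M (Fk k) (\<lambda>\<omega>. ennreal (exp (X k \<omega>))) \<omega> \<le> 1"
      by eventually_elim simp
  qed
  then show ?thesis
  proof eventually_elim
    case (elim \<omega>)
    then show ?case
    proof eventually_elim
      case (elim n)
      have "(\<Sum>k<n. X k \<omega>) = 2 * d * ((\<Sum>k<n. x k \<omega> * w k \<omega>) - d * (\<Sum>k<n. (x k \<omega>)\<^sup>2))"
        by (simp add: X_def t_def sum_subtractf sum_distrib_left power_mult_distrib power2_eq_square algebra_simps)
      with elim have "(\<Sum>k<n. x k \<omega> * w k \<omega>) - d * (\<Sum>k<n. (x k \<omega>)\<^sup>2) \<le> sqrt (real n) / (2 * d)"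
        using d by (simp add: pos_le_divide_eq mult.commute)
      then show ?case by (simp add: w_def)
    qed
  qed
qed

end

subsection \<open>The sum of the absolute noise\<close>

context filtered_prob_space
begin

text \<open>Markov's inequality at level \<open>(k + 1)^(1/4)\<close> gives probabilities of order
  \<open>(k + 1)^(- r / 4)\<close>, summable because \<open>r > 4\<close>. The conditional moments
  are bounded only path by path, so the events are localised to \<open>p k \<le> N\<close>, an event
  of \<open>Fk k\<close>, and \<open>N\<close> is chosen for each path at the end.\<close>

lemma AE_eventually_le_root:
  assumes X: "\<And>k. X k \<in> borel_measurable M" and r: "r > 4"
    and moment: "AE \<omega> in M. (SUP k. nn_cond_exp M (Fk k) (\<lambda>\<omega>. ennreal (\<bar>X k \<omega>\<bar> powr r)) \<omega>) < \<infinity>"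
  shows "AE \<omega> in M. \<forall>\<^sub>F k in sequentially. \<bar>X k \<omega>\<bar> \<le> real (Suc k) powr (1 / 4)"
proof -
  define p where "p k = nn_cond_exp M (Fk k) (\<lambda>\<omega>. ennreal (\<bar>X k \<omega>\<bar> powr r))" for k
  define A where "A N k = {\<omega> \<in> space M. p k \<omega> \<le> of_nat N \<and> real (Suc k) powr (1 / 4) < \<bar>X k \<omega>\<bar>}"
    for N k :: nat
  have [measurable]: "X k \<in> borel_measurable M" for k by (rule X)
  have [measurable]: "p k \<in> borel_measurable M" for k unfolding p_def by measurable
  have A[measurable]: "A N k \<in> sets M" for N k unfolding A_def by measurable
  have le: "measure M (A N k) \<le> real N * real (Suc k) powr (- (r / 4))" for N k
  proof -
    interpret sigma_finite_subalgebra M "Fk k" by (rule sigma_finite_Fk)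
    define I where "I \<omega> = (if p k \<omega> \<le> of_nat N then 1 else 0 :: ennreal)" for \<omega>
    have pk: "p k \<in> borel_measurable (Fk k)" unfolding p_def by (rule borel_measurable_nn_cond_exp)
    then have I[measurable]: "I \<in> borel_measurable (Fk k)" unfolding I_def by measurable
    have [measurable]: "I \<in> borel_measurable M"
      by (rule measurable_from_subalg[OF subalg I])
    have "ennreal (real (Suc k) powr (r / 4)) * emeasure M (A N k)
        = (\<integral>\<^sup>+\<omega>. ennreal (real (Suc k) powr (r / 4)) * indicator (A N k) \<omega> \<partial>M)"
      by (simp add: nn_integral_cmult_indicator)
    also have "\<dots> \<le> (\<integral>\<^sup>+\<omega>. I \<omega> * ennreal (\<bar>X k \<omega>\<bar> powr r) \<partial>M)"
    proof (rule nn_integral_mono)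
      fix \<omega>
      have "real (Suc k) powr (r / 4) \<le> \<bar>X k \<omega>\<bar> powr r" if "real (Suc k) powr (1 / 4) < \<bar>X k \<omega>\<bar>"
      proof -
        have "(real (Suc k) powr (1 / 4)) powr r \<le> \<bar>X k \<omega>\<bar> powr r"
          using that r by (intro powr_mono2) auto
        then show ?thesis by (simp add: powr_powr)
      qed
      then show "ennreal (real (Suc k) powr (r / 4)) * indicator (A N k) \<omega> \<le> I \<omega> * ennreal (\<bar>X k \<omega>\<bar> powr r)"
        by (auto simp: A_def I_def indicator_def intro!: ennreal_leI)
    qed
    also have "\<dots> = (\<integral>\<^sup>+\<omega>. I \<omega> * p k \<omega> \<partial>M)"
      unfolding p_def by (rule nn_cond_exp_intg[symmetric]) measurable
    also have "\<dots> \<le> (\<integral>\<^sup>+\<omega>. of_nat N \<partial>M)"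
      by (rule nn_integral_mono) (auto simp: I_def)
    also have "\<dots> = of_nat N" by (simp add: emeasure_space_1)
    finally have "ennreal (real (Suc k) powr (r / 4) * measure M (A N k)) \<le> ennreal (real N)"
      by (simp add: emeasure_eq_measure ennreal_mult ennreal_of_nat_eq_real_of_nat)
    then have "real (Suc k) powr (r / 4) * measure M (A N k) \<le> real N"
      by (subst (asm) ennreal_le_iff) auto
    then show ?thesis by (simp add: powr_minus field_simps)
  qed
  have "AE \<omega> in M. \<forall>\<^sub>F k in sequentially. \<omega> \<in> space M - A N k" for N
  proof (intro borel_cantelli_AE1 A)
    have "summable (\<lambda>k. real k powr (- (r / 4)))" using r by (simp add: summable_real_powr_iff)
    then have "summable (\<lambda>k. real N * real (Suc k) powr (- (r / 4)))"
      by (intro summable_mult) (subst summable_Suc_iff)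
    then show "summable (\<lambda>k. measure M (A N k))"
      by (rule summable_comparison_test'[where N = 0]) (use le in auto)
  qed (auto simp: emeasure_eq_measure)
  then have "AE \<omega> in M. \<forall>N. \<forall>\<^sub>F k in sequentially. \<omega> \<in> space M - A N k"
    by (subst AE_all_countable) blast
  then show ?thesis using moment
  proof eventually_elim
    case (elim \<omega>)
    have "(SUP k. p k \<omega>) < \<infinity>" using elim(2) by (simp add: p_def)
    then obtain N :: nat where "(SUP k. p k \<omega>) < of_nat N"
      using ennreal_Ex_less_of_nat by (auto simp: infinity_ennreal_def)
    then have N: "p k \<omega> \<le> of_nat N" for k
      by (meson SUP_upper UNIV_I less_imp_le order_trans)
    have "\<forall>\<^sub>F k in sequentially. \<omega> \<in> space M - A N k" using elim(1) by blast
    then show ?case by eventually_elim (use N in \<open>auto simp: A_def\<close>)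
  qed
qed

text \<open>Links the real conditional variance of the theorem with the extended nonnegative one of
  the exponential bounds. By \<open>x^2 \<le> 1 + \<bar>x\<bar> powr r\<close> the latter is finite,
  uniformly in \<open>k\<close> on each path, so \<open>enn2real\<close> loses nothing.\<close>

lemma AE_cond_second_moment:
  assumes X[measurable]: "\<And>k. X k \<in> borel_measurable M" and r: "r > 4"
    and moment: "AE \<omega> in M. (SUP k. nn_cond_exp M (Fk k) (\<lambda>\<omega>. ennreal (\<bar>X k \<omega>\<bar> powr r)) \<omega>) < \<infinity>"
  shows "AE \<omega> in M. \<exists>N::real. \<forall>k.
    nn_cond_exp M (Fk k) (\<lambda>\<omega>. ennreal ((X k \<omega>)\<^sup>2)) \<omega> = ennreal (real_cond_exp M (Fk k) (\<lambda>\<omega>. (X k \<omega>)\<^sup>2) \<omega>)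
    \<and> 0 \<le> real_cond_exp M (Fk k) (\<lambda>\<omega>. (X k \<omega>)\<^sup>2) \<omega> \<and> real_cond_exp M (Fk k) (\<lambda>\<omega>. (X k \<omega>)\<^sup>2) \<omega> \<le> N"
proof -
  define p where "p k = nn_cond_exp M (Fk k) (\<lambda>\<omega>. ennreal (\<bar>X k \<omega>\<bar> powr r))" for k
  define s where "s k = nn_cond_exp M (Fk k) (\<lambda>\<omega>. ennreal ((X k \<omega>)\<^sup>2))" for k
  have sp: "AE \<omega> in M. s k \<omega> \<le> 1 + p k \<omega>" for k
  proof -
    interpret sigma_finite_subalgebra M "Fk k" by (rule sigma_finite_Fk)
    have "AE \<omega> in M. s k \<omega> \<le> nn_cond_exp M (Fk k) (\<lambda>\<omega>. 1 + ennreal (\<bar>X k \<omega>\<bar> powr r)) \<omega>"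
      unfolding s_def
    proof (rule nn_cond_exp_mono)
      have "(X k \<omega>)\<^sup>2 \<le> 1 + \<bar>X k \<omega>\<bar> powr r" for \<omega>
      proof (cases "\<bar>X k \<omega>\<bar> \<le> 1")
        case True
        then have "(X k \<omega>)\<^sup>2 \<le> 1" by (simp add: abs_square_le_1)
        then show ?thesis by (smt (verit) powr_ge_zero)
      next
        case False
        then have "\<bar>X k \<omega>\<bar> powr 2 \<le> \<bar>X k \<omega>\<bar> powr r" using r by (intro powr_mono) auto
        then show ?thesis using False by (simp add: powr_numeral)
      qed
      then show "AE \<omega> in M. ennreal ((X k \<omega>)\<^sup>2) \<le> 1 + ennreal (\<bar>X k \<omega>\<bar> powr r)"
        by (intro AE_I2) (metis ennreal_1 ennreal_leI ennreal_plus powr_ge_zero zero_le_one)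
    qed auto
    moreover have "AE \<omega> in M. nn_cond_exp M (Fk k) (\<lambda>_. 1) \<omega> + p k \<omega>
        = nn_cond_exp M (Fk k) (\<lambda>\<omega>. 1 + ennreal (\<bar>X k \<omega>\<bar> powr r)) \<omega>"
      unfolding p_def by (rule nn_cond_exp_sum) auto
    moreover have "AE \<omega> in M. 1 = nn_cond_exp M (Fk k) (\<lambda>_. 1) \<omega>"
      by (rule nn_cond_exp_F_meas) auto
    ultimately show ?thesis by eventually_elim simp
  qed
  have real: "AE \<omega> in M. real_cond_exp M (Fk k) (\<lambda>\<omega>. (X k \<omega>)\<^sup>2) \<omega> = enn2real (s k \<omega>)" for k
  proof -
    interpret sigma_finite_subalgebra M "Fk k" by (rule sigma_finite_Fk)
    have "AE \<omega> in M. 0 = nn_cond_exp M (Fk k) (\<lambda>_. 0) \<omega>"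
      by (rule nn_cond_exp_F_meas) auto
    moreover have "(\<lambda>\<omega>. ennreal (- ((X k \<omega>)\<^sup>2))) = (\<lambda>_. 0)"
      by (auto simp: ennreal_neg)
    ultimately show ?thesis
      unfolding real_cond_exp_def s_def by (auto elim!: eventually_mono)
  qed
  have "AE \<omega> in M. \<forall>k. s k \<omega> \<le> 1 + p k \<omega> \<and>
      real_cond_exp M (Fk k) (\<lambda>\<omega>. (X k \<omega>)\<^sup>2) \<omega> = enn2real (s k \<omega>)"
    using sp real by (subst AE_all_countable) auto
  then show ?thesis using moment
  proof eventually_elim
    case (elim \<omega>)
    have fin: "(SUP k. p k \<omega>) < \<infinity>" using elim(2) by (simp add: p_def)
    have le: "s k \<omega> \<le> 1 + (SUP k. p k \<omega>)" for k
      using elim(1) by (meson SUP_upper UNIV_I add_left_mono order_trans)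
    have top: "1 + (SUP k. p k \<omega>) < \<infinity>"
      using fin by (simp add: infinity_ennreal_def ennreal_add_eq_top less_top)
    have s: "s k \<omega> < \<infinity>" "enn2real (s k \<omega>) \<le> enn2real (1 + (SUP k. p k \<omega>))" for k
      using le_less_trans[OF le top] enn2real_mono[OF le] top by (auto simp: infinity_ennreal_def)
    show ?case
      using elim(1) s by (intro exI[of _ "enn2real (1 + (SUP k. p k \<omega>))"])
        (auto simp: s_def[symmetric] infinity_ennreal_def less_top[symmetric])
  qed
qed

end

text \<open>The right side is affine in \<open>x^2\<close>, so its conditional mean depends only on
  the variance. Truncation at \<open>1 / l\<close> keeps the exponent at most 1, where
  \<open>exp s \<le> 1 + s + s^2\<close>. The linear term is handled by
  \<open>\<bar>x\<bar> \<le> d / 2 + x^2 / (2 * d)\<close>, whose mean is least when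
  \<open>d\<close> is the standard deviation.\<close>

lemma exp_truncated_le:
  fixes l b d x :: real
  assumes "l > 0" "0 \<le> b" "b \<le> 1" "d > 0"
  shows "exp (l * b * min \<bar>x\<bar> (1 / l)) \<le> (1 + l * b * d / 2) + (l * b / (2 * d) + l\<^sup>2) * x\<^sup>2"
proof -
  define m where "m = min \<bar>x\<bar> (1 / l)"
  have m: "0 \<le> m" "m \<le> \<bar>x\<bar>" "l * m \<le> 1" using assms by (auto simp: m_def min_def field_simps)
  have "l * b * m \<le> l * m" using assms m by (simp add: mult_left_le mult_right_mono)
  then have s: "0 \<le> l * b * m" "l * b * m \<le> l * \<bar>x\<bar>" "l * b * m \<le> 1"
  proof -
    show "0 \<le> l * b * m" using assms m by simp
    show "l * b * m \<le> 1" using \<open>l * b * m \<le> l * m\<close> m(3) by linarith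
    have "l * m \<le> l * \<bar>x\<bar>" using m(2) assms by (intro mult_left_mono) auto
    then show "l * b * m \<le> l * \<bar>x\<bar>" using \<open>l * b * m \<le> l * m\<close> by linarith
  qed
  have "exp (l * b * m) \<le> 1 + l * b * m + (l * b * m)\<^sup>2"
    by (rule exp_bound[OF s(1,3)])
  also have "(l * b * m)\<^sup>2 \<le> l\<^sup>2 * x\<^sup>2"
    using power_mono[OF s(2,1), of 2] by (simp add: power_mult_distrib)
  also have "l * b * m \<le> (l * b) * (d / 2 + x\<^sup>2 / (2 * d))"
  proof (rule mult_left_mono)
    have "(\<bar>x\<bar> - d)\<^sup>2 = x\<^sup>2 + d * d - 2 * d * \<bar>x\<bar>"
      unfolding power2_diff by (simp add: power2_eq_square)
    then have "2 * d * \<bar>x\<bar> \<le> d * d + x\<^sup>2" using zero_le_power2[of "\<bar>x\<bar> - d"] by linarith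
    then have "\<bar>x\<bar> \<le> d / 2 + x\<^sup>2 / (2 * d)"
      using assms by (simp add: field_simps power2_eq_square)
    then show "m \<le> d / 2 + x\<^sup>2 / (2 * d)" using m by linarith
  qed (use assms in auto)
  finally show ?thesis by (simp add: m_def algebra_simps)
qed

context filtered_prob_space
begin

text \<open>Compensating by the conditional standard deviation is what produces \<open>sigma\<close>
  in the final bound. Before damping by \<open>exp (- c)\<close> the majorant has conditional mean
  at most \<open>1 + c\<close>, and \<open>1 + c \<le> exp c\<close>.\<close>

lemma cond_exp_truncated_le_1:
  fixes X b :: "'a \<Rightarrow> real"
  assumes X[measurable]: "X \<in> borel_measurable M"
    and b[measurable]: "b \<in> borel_measurable (Fk k)"
    and b01: "\<And>\<omega>. \<omega> \<in> space M \<Longrightarrow> 0 \<le> b \<omega>" "\<And>\<omega>. \<omega> \<in> space M \<Longrightarrow> b \<omega> \<le> 1"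
    and s2_meas[measurable]: "s2 \<in> borel_measurable (Fk k)" and s2_nonneg: "AE \<omega> in M. 0 \<le> s2 \<omega>"
    and s2: "AE \<omega> in M. nn_cond_exp M (Fk k) (\<lambda>\<omega>. ennreal ((X \<omega>)\<^sup>2)) \<omega> = ennreal (s2 \<omega>)"
    and l: "l > 0"
  shows "AE \<omega> in M. nn_cond_exp M (Fk k) (\<lambda>\<omega>. ennreal (exp (l * b \<omega> * min \<bar>X \<omega>\<bar> (1 / l)
      - (l * b \<omega> * (sqrt (s2 \<omega>) + l) + l\<^sup>2 * s2 \<omega>)))) \<omega> \<le> 1"
proof -
  interpret sigma_finite_subalgebra M "Fk k" by (rule sigma_finite_Fk)
  \<comment> \<open>The standard deviation, shifted by \<open>l\<close> so that dividing by
    \<open>d\<close> is legitimate where the variance vanishes; the shift adds only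
    \<open>l^2 * b\<close> to the compensator.\<close>
  define d where "d \<omega> = sqrt (s2 \<omega>) + l" for \<omega>
  define c where "c \<omega> = l * b \<omega> * d \<omega> + l\<^sup>2 * s2 \<omega>" for \<omega>
  define A where "A \<omega> = exp (- c \<omega>) * (1 + l * b \<omega> * d \<omega> / 2)" for \<omega>
  define B where "B \<omega> = exp (- c \<omega>) * (l * b \<omega> / (2 * d \<omega>) + l\<^sup>2)" for \<omega>
  have A[measurable]: "(\<lambda>\<omega>. ennreal (A \<omega>)) \<in> borel_measurable (Fk k)"
    unfolding A_def c_def d_def by measurable
  have B[measurable]: "(\<lambda>\<omega>. ennreal (B \<omega>)) \<in> borel_measurable (Fk k)"
    unfolding B_def c_def d_def by measurable
  have [measurable]: "(\<lambda>\<omega>. ennreal (A \<omega>)) \<in> borel_measurable M" "(\<lambda>\<omega>. ennreal (B \<omega>)) \<in> borel_measurable M"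
    by (rule measurable_from_subalg[OF subalg A], rule measurable_from_subalg[OF subalg B])
  have [measurable]: "b \<in> borel_measurable M" "s2 \<in> borel_measurable M"
    by (rule measurable_from_subalg[OF subalg b], rule measurable_from_subalg[OF subalg s2_meas])
  have [measurable]: "(\<lambda>\<omega>. exp (l * b \<omega> * min \<bar>X \<omega>\<bar> (1 / l) - c \<omega>)) \<in> borel_measurable M"
    unfolding c_def d_def by measurable
  have "AE \<omega> in M. nn_cond_exp M (Fk k) (\<lambda>\<omega>. ennreal (exp (l * b \<omega> * min \<bar>X \<omega>\<bar> (1 / l) - c \<omega>))) \<omega>
    \<le> nn_cond_exp M (Fk k) (\<lambda>\<omega>. ennreal (A \<omega>) + ennreal (B \<omega>) * ennreal ((X \<omega>)\<^sup>2)) \<omega>"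
  proof (rule nn_cond_exp_mono)
    show "AE \<omega> in M. ennreal (exp (l * b \<omega> * min \<bar>X \<omega>\<bar> (1 / l) - c \<omega>))
        \<le> ennreal (A \<omega>) + ennreal (B \<omega>) * ennreal ((X \<omega>)\<^sup>2)"
      using s2_nonneg AE_space
    proof eventually_elim
      case (elim \<omega>)
      have d: "d \<omega> > 0" using elim l by (simp add: d_def add_nonneg_pos)
      have "exp (l * b \<omega> * min \<bar>X \<omega>\<bar> (1 / l) - c \<omega>) = exp (- c \<omega>) * exp (l * b \<omega> * min \<bar>X \<omega>\<bar> (1 / l))"
        by (simp flip: exp_add)
      also have "\<dots> \<le> exp (- c \<omega>) * ((1 + l * b \<omega> * d \<omega> / 2) + (l * b \<omega> / (2 * d \<omega>) + l\<^sup>2) * (X \<omega>)\<^sup>2)"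
        by (intro mult_left_mono exp_truncated_le l b01 elim d) auto
      also have "\<dots> = A \<omega> + B \<omega> * (X \<omega>)\<^sup>2" by (simp add: A_def B_def algebra_simps)
      finally have "ennreal (exp (l * b \<omega> * min \<bar>X \<omega>\<bar> (1 / l) - c \<omega>)) \<le> ennreal (A \<omega> + B \<omega> * (X \<omega>)\<^sup>2)"
        by (rule ennreal_leI)
      also have "\<dots> = ennreal (A \<omega>) + ennreal (B \<omega>) * ennreal ((X \<omega>)\<^sup>2)"
        using d l b01[OF elim(2)] by (simp add: ennreal_plus ennreal_mult A_def B_def)
      finally show ?case .
    qed
  qed measurable
  moreover have "AE \<omega> in M. nn_cond_exp M (Fk k) (\<lambda>\<omega>. ennreal (A \<omega>)) \<omega>
      + nn_cond_exp M (Fk k) (\<lambda>\<omega>. ennreal (B \<omega>) * ennreal ((X \<omega>)\<^sup>2)) \<omega>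
      = nn_cond_exp M (Fk k) (\<lambda>\<omega>. ennreal (A \<omega>) + ennreal (B \<omega>) * ennreal ((X \<omega>)\<^sup>2)) \<omega>"
    by (rule nn_cond_exp_sum) measurable
  moreover have "AE \<omega> in M. ennreal (A \<omega>) = nn_cond_exp M (Fk k) (\<lambda>\<omega>. ennreal (A \<omega>)) \<omega>"
    by (rule nn_cond_exp_F_meas) measurable
  moreover have "AE \<omega> in M. ennreal (B \<omega>) * nn_cond_exp M (Fk k) (\<lambda>\<omega>. ennreal ((X \<omega>)\<^sup>2)) \<omega>
      = nn_cond_exp M (Fk k) (\<lambda>\<omega>. ennreal (B \<omega>) * ennreal ((X \<omega>)\<^sup>2)) \<omega>"
    by (rule nn_cond_exp_prod) measurable
  ultimately have "AE \<omega> in M. nn_cond_exp M (Fk k) (\<lambda>\<omega>. ennreal (exp (l * b \<omega> * min \<bar>X \<omega>\<bar> (1 / l) - c \<omega>))) \<omega> \<le> 1"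
    using s2 s2_nonneg AE_space
  proof eventually_elim
    case (elim \<omega>)
    have d: "d \<omega> > 0" using elim l by (simp add: d_def add_nonneg_pos)
    have sd: "sqrt (s2 \<omega>) \<le> d \<omega>" "0 \<le> sqrt (s2 \<omega>)" using l elim by (auto simp: d_def)
    have "s2 \<omega> = sqrt (s2 \<omega>) * sqrt (s2 \<omega>)" using elim by simp
    also have "\<dots> \<le> d \<omega> * d \<omega>" using sd d by (intro mult_mono) auto
    finally have "s2 \<omega> / d \<omega> \<le> d \<omega>" using d by (simp add: field_simps)
    then have le: "l * b \<omega> * (s2 \<omega> / d \<omega>) \<le> l * b \<omega> * d \<omega>"
      using l b01[OF elim(7)] by (intro mult_left_mono) auto
    have eq: "(l * b \<omega> / (2 * d \<omega>) + l\<^sup>2) * s2 \<omega> = (l * b \<omega> * (s2 \<omega> / d \<omega>)) / 2 + l\<^sup>2 * s2 \<omega>"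
      by (simp add: algebra_simps)
    have arith: "1 + p / 2 + q \<le> 1 + (p + r)" if "t \<le> p" "q = t / 2 + r" for p q r t :: real
      using that by linarith
    have "(1 + l * b \<omega> * d \<omega> / 2) + (l * b \<omega> / (2 * d \<omega>) + l\<^sup>2) * s2 \<omega> \<le> 1 + c \<omega>"
      unfolding c_def by (rule arith[OF le eq])
    moreover have "A \<omega> + B \<omega> * s2 \<omega>
        = exp (- c \<omega>) * ((1 + l * b \<omega> * d \<omega> / 2) + (l * b \<omega> / (2 * d \<omega>) + l\<^sup>2) * s2 \<omega>)"
      by (simp add: A_def B_def distrib_left mult.assoc)
    ultimately have "A \<omega> + B \<omega> * s2 \<omega> \<le> exp (- c \<omega>) * (1 + c \<omega>)"
      by simp
    also have "\<dots> \<le> exp (- c \<omega>) * exp (c \<omega>)"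
      using exp_ge_add_one_self[of "c \<omega>"] by (intro mult_left_mono) (auto simp: add.commute)
    also have "\<dots> = 1" by (simp flip: exp_add)
    finally have "ennreal (A \<omega> + B \<omega> * s2 \<omega>) \<le> 1" by (simp add: ennreal_le_1)
    moreover have "ennreal (A \<omega> + B \<omega> * s2 \<omega>) = ennreal (A \<omega>) + ennreal (B \<omega>) * ennreal (s2 \<omega>)"
      using d l b01[OF elim(7)] elim(6) by (simp add: ennreal_plus ennreal_mult A_def B_def)
    moreover have "nn_cond_exp M (Fk k) (\<lambda>\<omega>. ennreal (A \<omega>) + ennreal (B \<omega>) * ennreal ((X \<omega>)\<^sup>2)) \<omega>
        = ennreal (A \<omega>) + ennreal (B \<omega>) * ennreal (s2 \<omega>)"
      unfolding elim(2)[symmetric] elim(3)[symmetric] elim(4)[symmetric] elim(5) ..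
    ultimately show ?case using elim(1) by simp
  qed
  then show ?thesis by (simp add: c_def d_def)
qed

lemma AE_weighted_abs_sum_le:
  fixes X b :: "nat \<Rightarrow> 'a \<Rightarrow> real"
  assumes X: "\<And>k. X k \<in> borel_measurable (Fk (Suc k))" and r: "r > 4"
    and moment: "AE \<omega> in M. (SUP k. nn_cond_exp M (Fk k) (\<lambda>\<omega>. ennreal (\<bar>X k \<omega>\<bar> powr r)) \<omega>) < \<infinity>"
    and b: "\<And>k. b k \<in> borel_measurable (Fk k)"
    and b01: "\<And>k \<omega>. \<omega> \<in> space M \<Longrightarrow> 0 \<le> b k \<omega>" "\<And>k \<omega>. \<omega> \<in> space M \<Longrightarrow> b k \<omega> \<le> 1"
  shows "AE \<omega> in M. \<exists>K. \<forall>\<^sub>F n in sequentially. (\<Sum>k<n. b k \<omega> * \<bar>X k \<omega>\<bar>)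
    \<le> sqrt (real n * (\<Sum>k<n. (b k \<omega>)\<^sup>2 * real_cond_exp M (Fk k) (\<lambda>\<omega>. (X k \<omega>)\<^sup>2) \<omega>)) + K * real n powr (3 / 4)"
proof -
  define s2 where "s2 k = real_cond_exp M (Fk k) (\<lambda>\<omega>. (X k \<omega>)\<^sup>2)" for k
  \<comment> \<open>Two errors balance at this rate: after division by \<open>l n\<close>, both the
    Chernoff term \<open>sqrt n\<close> and the compensator excess of order
    \<open>n * (l n)^2\<close> are of order \<open>n powr (3/4)\<close>. The truncation level
    \<open>1 / l n\<close> also dominates the almost sure eventual bound on
    \<open>\<bar>X k\<bar>\<close> for \<open>k < n\<close>.\<close>
  define l where "l n = real (Suc n) powr (- 1 / 4)" for n
  have l: "l n > 0" for n by (simp add: l_def)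
  have il: "1 / l n = real (Suc n) powr (1 / 4)" for n by (simp add: l_def powr_minus divide_simps)
  have XM: "X k \<in> borel_measurable M" for k by (rule measurable_Fk[OF X])
  have second: "AE \<omega> in M. \<exists>N::real. \<forall>k.
    nn_cond_exp M (Fk k) (\<lambda>\<omega>. ennreal ((X k \<omega>)\<^sup>2)) \<omega> = ennreal (s2 k \<omega>) \<and> 0 \<le> s2 k \<omega> \<and> s2 k \<omega> \<le> N"
    unfolding s2_def by (rule AE_cond_second_moment[OF XM r moment])
  define Z where "Z n k \<omega> = l n * b k \<omega> * min \<bar>X k \<omega>\<bar> (1 / l n)
      - (l n * b k \<omega> * (sqrt (s2 k \<omega>) + l n) + (l n)\<^sup>2 * s2 k \<omega>)" for n k \<omega>
  have s2F: "s2 k \<in> borel_measurable (Fk k)" for k unfolding s2_def by measurable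
  have "AE \<omega> in M. \<forall>\<^sub>F n in sequentially. (\<Sum>k<n. Z n k \<omega>) \<le> sqrt (real n)"
  proof (rule AE_sum_le_sqrt)
    fix n k
    have [measurable]: "s2 k \<in> borel_measurable (Fk (Suc k))" "b k \<in> borel_measurable (Fk (Suc k))"
      "X k \<in> borel_measurable (Fk (Suc k))"
      using measurable_Fk_mono[OF _ s2F] measurable_Fk_mono[OF _ b] X by auto
    show "Z n k \<in> borel_measurable (Fk (Suc k))" unfolding Z_def by measurable
    have "AE \<omega> in M. 0 \<le> s2 k \<omega>" using second by eventually_elim blast
    moreover have "AE \<omega> in M. nn_cond_exp M (Fk k) (\<lambda>\<omega>. ennreal ((X k \<omega>)\<^sup>2)) \<omega> = ennreal (s2 k \<omega>)"
      using second by eventually_elim blast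
    ultimately show "AE \<omega> in M. nn_cond_exp M (Fk k) (\<lambda>\<omega>. ennreal (exp (Z n k \<omega>))) \<omega> \<le> 1"
      unfolding Z_def by (intro cond_exp_truncated_le_1 XM b b01 s2F l)
  qed
  then show ?thesis
    using AE_eventually_le_root[OF XM r moment] second AE_space
  proof eventually_elim
    case (elim \<omega>)
    obtain N where N: "\<And>k. 0 \<le> s2 k \<omega>" "\<And>k. s2 k \<omega> \<le> N" using elim(3) by blast
    then have N0: "N \<ge> 0" using order_trans by blast
    note b = b01[OF elim(4)]
    obtain k0 where k0: "\<And>k. k \<ge> k0 \<Longrightarrow> \<bar>X k \<omega>\<bar> \<le> real (Suc k) powr (1 / 4)"
      using elim(2) by (auto simp: eventually_sequentially)
    \<comment> \<open>Finitely many early terms may exceed the truncation level; they are charged in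
      full to this constant.\<close>
    define C where "C = (\<Sum>k<k0. \<bar>X k \<omega>\<bar>)"
    have C0: "C \<ge> 0" by (simp add: C_def sum_nonneg)
    have "\<forall>\<^sub>F n in sequentially. (\<Sum>k<n. b k \<omega> * \<bar>X k \<omega>\<bar>)
      \<le> sqrt (real n * (\<Sum>k<n. (b k \<omega>)\<^sup>2 * s2 k \<omega>)) + (C + 1 + N + 2) * real n powr (3 / 4)"
      using elim(1) eventually_ge_at_top[of 1]
    proof eventually_elim
      case (elim n)
      define m where "m k = min \<bar>X k \<omega>\<bar> (1 / l n)" for k
      have n: "real n \<ge> 1" using elim(2) by simp
      have trunc: "b k \<omega> * \<bar>X k \<omega>\<bar> \<le> b k \<omega> * m k + (if k < k0 then \<bar>X k \<omega>\<bar> else 0)" if "k < n" for k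
      proof (cases "k < k0")
        case True
        have "b k \<omega> * \<bar>X k \<omega>\<bar> \<le> \<bar>X k \<omega>\<bar>" using b[of k] by (simp add: mult_left_le_one_le)
        moreover have "0 \<le> b k \<omega> * m k" using b[of k] l[of n] by (simp add: m_def)
        ultimately show ?thesis using True by simp
      next
        case False
        then have "\<bar>X k \<omega>\<bar> \<le> real (Suc k) powr (1 / 4)" by (intro k0) simp
        also have "\<dots> \<le> 1 / l n" unfolding il using that by (intro powr_mono2) auto
        finally show ?thesis using False by (simp add: m_def)
      qed
      have "(\<Sum>k<n. b k \<omega> * \<bar>X k \<omega>\<bar>) \<le> (\<Sum>k<n. b k \<omega> * m k + (if k < k0 then \<bar>X k \<omega>\<bar> else 0))"
        by (intro sum_mono trunc) auto
      also have "\<dots> = (\<Sum>k<n. b k \<omega> * m k) + (\<Sum>k\<in>{..<n} \<inter> {k. k < k0}. \<bar>X k \<omega>\<bar>)"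
        by (simp add: sum.distrib sum.inter_restrict)
      also have "(\<Sum>k\<in>{..<n} \<inter> {k. k < k0}. \<bar>X k \<omega>\<bar>) \<le> C"
        unfolding C_def by (intro sum_mono2) auto
      finally have 1: "(\<Sum>k<n. b k \<omega> * \<bar>X k \<omega>\<bar>) \<le> (\<Sum>k<n. b k \<omega> * m k) + C" by simp
      have "l n * b k \<omega> * m k \<le> Z n k \<omega> + l n * (b k \<omega> * sqrt (s2 k \<omega>)) + (l n)\<^sup>2 * (1 + N)" for k
      proof -
        have "b k \<omega> * (l n)\<^sup>2 \<le> 1 * (l n)\<^sup>2" using b[of k] by (intro mult_right_mono) auto
        moreover have "(l n)\<^sup>2 * s2 k \<omega> \<le> (l n)\<^sup>2 * N" using N by (intro mult_left_mono) auto
        ultimately show ?thesis by (simp add: Z_def m_def algebra_simps power2_eq_square)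
      qed
      then have "(\<Sum>k<n. l n * b k \<omega> * m k)
          \<le> (\<Sum>k<n. Z n k \<omega> + l n * (b k \<omega> * sqrt (s2 k \<omega>)) + (l n)\<^sup>2 * (1 + N))"
        by (intro sum_mono)
      then have "l n * (\<Sum>k<n. b k \<omega> * m k)
          \<le> sqrt (real n) + l n * (\<Sum>k<n. b k \<omega> * sqrt (s2 k \<omega>)) + real n * ((l n)\<^sup>2 * (1 + N))"
        using elim(1) by (simp add: sum.distrib sum_distrib_left mult.assoc)
      also have "\<dots> = l n * (sqrt (real n) * (1 / l n) + (\<Sum>k<n. b k \<omega> * sqrt (s2 k \<omega>)) + real n * l n * (1 + N))"
        using l[of n] by (simp add: algebra_simps power2_eq_square)
      finally have 2: "(\<Sum>k<n. b k \<omega> * m k)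
          \<le> sqrt (real n) * (1 / l n) + (\<Sum>k<n. b k \<omega> * sqrt (s2 k \<omega>)) + real n * l n * (1 + N)"
        using l[of n] by (simp only: mult_le_cancel_left_pos)
      have "(\<Sum>k<n. b k \<omega> * sqrt (s2 k \<omega>)) \<le> sqrt (real n * (\<Sum>k<n. (b k \<omega> * sqrt (s2 k \<omega>))\<^sup>2))"
        by (rule sum_le_sqrt_card)
      also have "(\<Sum>k<n. (b k \<omega> * sqrt (s2 k \<omega>))\<^sup>2) = (\<Sum>k<n. (b k \<omega>)\<^sup>2 * s2 k \<omega>)"
        using N by (simp add: power_mult_distrib)
      finally have 3: "(\<Sum>k<n. b k \<omega> * sqrt (s2 k \<omega>)) \<le> sqrt (real n * (\<Sum>k<n. (b k \<omega>)\<^sup>2 * s2 k \<omega>))" .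
      have "real n * l n \<le> real n * real n powr (- 1 / 4)"
        unfolding l_def using n by (intro mult_left_mono powr_mono2') auto
      also have "\<dots> = real n powr (3 / 4)"
        using n powr_add[of "real n" 1 "- 1 / 4"] by simp
      finally have 4: "real n * l n * (1 + N) \<le> real n powr (3 / 4) * (1 + N)"
        using N0 by (intro mult_right_mono) auto
      \<comment> \<open>\<open>n + 1 \<le> 16 * n\<close>, with 16 chosen for its fourth root
        2.\<close>
      have "1 / l n \<le> (16 * real n) powr (1 / 4)"
        unfolding il using n by (intro powr_mono2) auto
      also have "\<dots> = 2 * real n powr (1 / 4)"
      proof -
        have "(16::real) powr (1 / 4) = (2 powr 4) powr (1 / 4)" by (simp add: powr_numeral)
        also have "\<dots> = 2" by (subst powr_powr) simp
        finally show ?thesis using n by (simp add: powr_mult)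
      qed
      finally have "sqrt (real n) * (1 / l n) \<le> sqrt (real n) * (2 * real n powr (1 / 4))"
        by (intro mult_left_mono) auto
      also have "\<dots> = real n powr (1 / 2) * (2 * real n powr (1 / 4))"
        using n by (simp add: powr_half_sqrt)
      also have "\<dots> = 2 * real n powr (3 / 4)"
        using n powr_add[of "real n" "1 / 2" "1 / 4"] by simp
      finally have 5: "sqrt (real n) * (1 / l n) \<le> 2 * real n powr (3 / 4)" .
      have "1 \<le> real n powr (3 / 4)" using n by (simp add: ge_one_powr_ge_zero)
      then have "C * 1 \<le> C * real n powr (3 / 4)" using C0 by (rule mult_left_mono)
      with 1 2 3 4 5 show ?case by (simp add: algebra_simps)
    qed
    then show ?case unfolding s2_def by blast
  qed
qed

end

subsection \<open>Estimates adapted up to null sets\<close>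

text \<open>Clamping rationals into the interval replaces an interval with random endpoints by one
  fixed countable index set; by continuity the rationals suffice.\<close>

lemma INF_symmetric_interval_rationals:
  fixes f :: "real \<Rightarrow> real"
  assumes f: "continuous_on UNIV f" and R: "0 \<le> R" and nonneg: "\<And>x. \<bar>x\<bar> \<le> R \<Longrightarrow> 0 \<le> f x"
  shows "(INF x\<in>{x. \<bar>x\<bar> \<le> R}. f x) = (INF q\<in>\<rat>. max 0 (f (max (- R) (min R q))))"
proof -
  define g where "g q = f (max (- R) (min R q))" for q
  have clamp: "\<bar>max (- R) (min R q)\<bar> \<le> R" for q using R by auto
  have g0: "0 \<le> g q" for q unfolding g_def by (rule nonneg[OF clamp])
  have bdd: "bdd_below (f ` {x. \<bar>x\<bar> \<le> R})" using nonneg by (intro bdd_belowI[of _ 0]) auto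
  have bdd_g: "bdd_below (g ` \<rat>)" using g0 by (intro bdd_belowI[of _ 0]) auto
  have g_cont: "continuous_on UNIV g"
    unfolding g_def by (intro continuous_on_compose2[OF f] continuous_intros) auto
  have "(INF q\<in>\<rat>. g q) \<le> f x" if "\<bar>x\<bar> \<le> R" for x
  proof -
    have "closed {q. (INF q\<in>\<rat>. g q) \<le> g q}"
      by (intro closed_Collect_le continuous_intros g_cont)
    moreover have "\<rat> \<subseteq> {q. (INF q\<in>\<rat>. g q) \<le> g q}" using cINF_lower[OF bdd_g] by auto
    ultimately have "closure \<rat> \<subseteq> {q. (INF q\<in>\<rat>. g q) \<le> g q}" by (rule closure_minimal[rotated])
    then have "(INF q\<in>\<rat>. g q) \<le> g x" by (auto simp: Rats_closure_real)
    moreover have "g x = f x" using that by (auto simp: g_def min_def max_def abs_le_iff)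
    ultimately show ?thesis by simp
  qed
  then have "(INF q\<in>\<rat>. g q) \<le> (INF x\<in>{x. \<bar>x\<bar> \<le> R}. f x)"
    using R by (intro cINF_greatest) (auto intro: exI[of _ 0])
  moreover have "(INF x\<in>{x. \<bar>x\<bar> \<le> R}. f x) \<le> (INF q\<in>\<rat>. g q)"
  proof (rule cINF_greatest)
    show "\<rat> \<noteq> ({} :: real set)" using Rats_0 by blast
    show "(INF x\<in>{x. \<bar>x\<bar> \<le> R}. f x) \<le> g q" for q
      unfolding g_def by (rule cINF_lower[OF bdd]) (use clamp in simp)
  qed
  ultimately show ?thesis using g0 by (simp add: g_def max_absorb2)
qed

text \<open>Rounds strictly up to the grid of mesh \<open>1 / (n + 1)\<close>. Countably many values
  allow a random function to be evaluated cell by cell, and approach from above makes the indicators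
  of \<open>e \<le> round_above n x\<close> converge to that of \<open>e \<le> x\<close>.\<close>

definition round_above :: "nat \<Rightarrow> real \<Rightarrow> real" where
  "round_above n x = (real_of_int \<lfloor>real (Suc n) * x\<rfloor> + 1) / real (Suc n)"

lemma round_above: "x < round_above n x" "round_above n x \<le> x + 1 / real (Suc n)"
proof -
  have "real (Suc n) * x < real_of_int \<lfloor>real (Suc n) * x\<rfloor> + 1" by linarith
  then show "x < round_above n x" by (simp add: round_above_def field_simps)
  have "real_of_int \<lfloor>real (Suc n) * x\<rfloor> + 1 \<le> real (Suc n) * x + 1" by linarith
  then have "round_above n x \<le> (real (Suc n) * x + 1) / real (Suc n)"
    unfolding round_above_def by (intro divide_right_mono) auto
  also have "\<dots> = x + 1 / real (Suc n)"
    unfolding add_divide_distrib by (subst nonzero_mult_div_cancel_left) auto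
  finally show "round_above n x \<le> x + 1 / real (Suc n)" .
qed

lemma round_above_tendsto: "(\<lambda>n. round_above n x) \<longlonglongrightarrow> x"
proof (rule tendsto_sandwich[of "\<lambda>_. x" _ _ "\<lambda>n. x + 1 / real (Suc n)"])
  have "(\<lambda>n. x + 1 / real (Suc n)) \<longlonglongrightarrow> x + 0"
    by (intro tendsto_add tendsto_const LIMSEQ_Suc lim_1_over_n)
  then show "(\<lambda>n. x + 1 / real (Suc n)) \<longlonglongrightarrow> x" by simp
qed (intro always_eventually allI less_imp_le[OF round_above(1)] round_above(2) tendsto_const)+

lemma indicator_round_above_tendsto:
  "(\<lambda>n. indicator {z. z \<le> round_above n x} e :: real) \<longlonglongrightarrow> indicator {z. z \<le> x} e"
proof (cases "e \<le> x")
  case True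
  then have "e \<le> round_above n x" for n using round_above(1) less_imp_le order_trans by blast
  then show ?thesis using True by simp
next
  case False
  then have "\<forall>\<^sub>F n in sequentially. round_above n x < e"
    by (intro order_tendstoD(2)[OF round_above_tendsto]) simp
  then have "\<forall>\<^sub>F n in sequentially. indicator {z. z \<le> round_above n x} e = (0::real)"
    by eventually_elim simp
  then show ?thesis using False by (simp add: tendsto_eventually)
qed

context filtered_prob_space
begin

text \<open>The conditional distribution functions are regular only outside a null set which need not
  belong to \<open>Fk k\<close>, so the estimates are adapted only up to null sets.\<close>

definition ae_adapted :: "nat \<Rightarrow> ('a \<Rightarrow> 'b::topological_space) \<Rightarrow> bool" where
  "ae_adapted k X \<longleftrightarrow> (\<exists>Y\<in>borel_measurable (Fk k). AE \<omega> in M. X \<omega> = Y \<omega>)"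

lemma ae_adaptedE:
  assumes "ae_adapted k X"
  obtains Y where "Y \<in> borel_measurable (Fk k)" "AE \<omega> in M. X \<omega> = Y \<omega>"
  using assms unfolding ae_adapted_def by blast

lemma ae_adaptedI: "Y \<in> borel_measurable (Fk k) \<Longrightarrow> AE \<omega> in M. X \<omega> = Y \<omega> \<Longrightarrow> ae_adapted k X"
  unfolding ae_adapted_def by blast

lemma ae_adapted_measurable: "X \<in> borel_measurable (Fk k) \<Longrightarrow> ae_adapted k X"
  unfolding ae_adapted_def by blast

lemma ae_adapted_const: "ae_adapted k (\<lambda>_. c)"
  by (rule ae_adapted_measurable) simp

lemma ae_adapted_mono: "ae_adapted i X \<Longrightarrow> i \<le> j \<Longrightarrow> ae_adapted j X"
  unfolding ae_adapted_def using measurable_Fk_mono by blast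

lemma ae_adapted_cong:
  assumes "ae_adapted k Y" "AE \<omega> in M. X \<omega> = Y \<omega>"
  shows "ae_adapted k X"
proof -
  obtain Z where Z: "Z \<in> borel_measurable (Fk k)" "AE \<omega> in M. Y \<omega> = Z \<omega>"
    by (rule ae_adaptedE[OF assms(1)])
  have "AE \<omega> in M. X \<omega> = Z \<omega>" using assms(2) Z(2) by eventually_elim simp
  with Z(1) show ?thesis by (rule ae_adaptedI)
qed

lemma ae_adapted_compose:
  assumes "ae_adapted k X" and [measurable]: "g \<in> borel_measurable borel"
  shows "ae_adapted k (\<lambda>\<omega>. g (X \<omega>))"
proof -
  obtain Y where [measurable]: "Y \<in> borel_measurable (Fk k)" and Y: "AE \<omega> in M. X \<omega> = Y \<omega>"
    by (rule ae_adaptedE[OF assms(1)])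
  have "AE \<omega> in M. g (X \<omega>) = g (Y \<omega>)" using Y by eventually_elim simp
  moreover have "(\<lambda>\<omega>. g (Y \<omega>)) \<in> borel_measurable (Fk k)" by measurable
  ultimately show ?thesis by (rule ae_adaptedI[rotated])
qed

lemma ae_adapted_Pair:
  fixes X :: "'a \<Rightarrow> 'b::second_countable_topology" and Y :: "'a \<Rightarrow> 'c::second_countable_topology"
  assumes "ae_adapted k X" "ae_adapted k Y"
  shows "ae_adapted k (\<lambda>\<omega>. (X \<omega>, Y \<omega>))"
proof -
  obtain X' where X'[measurable]: "X' \<in> borel_measurable (Fk k)" and X: "AE \<omega> in M. X \<omega> = X' \<omega>"
    by (rule ae_adaptedE[OF assms(1)])
  obtain Y' where Y'[measurable]: "Y' \<in> borel_measurable (Fk k)" and Y: "AE \<omega> in M. Y \<omega> = Y' \<omega>"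
    by (rule ae_adaptedE[OF assms(2)])
  have "AE \<omega> in M. (X \<omega>, Y \<omega>) = (X' \<omega>, Y' \<omega>)" using X Y by eventually_elim simp
  moreover have "(\<lambda>\<omega>. (X' \<omega>, Y' \<omega>)) \<in> borel_measurable (Fk k)" by (rule borel_measurable_Pair[OF X' Y'])
  ultimately show ?thesis by (rule ae_adaptedI[rotated])
qed

lemma ae_adapted_continuous2:
  fixes X :: "'a \<Rightarrow> 'b::second_countable_topology" and Y :: "'a \<Rightarrow> 'c::second_countable_topology"
  assumes "ae_adapted k X" "ae_adapted k Y" "continuous_on UNIV (\<lambda>p. H (fst p) (snd p))"
  shows "ae_adapted k (\<lambda>\<omega>. H (X \<omega>) (Y \<omega>))"
  using ae_adapted_compose[OF ae_adapted_Pair[OF assms(1,2)] borel_measurable_continuous_onI[OF assms(3)]]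
  by simp

lemma ae_adapted_compose2:
  fixes X Y :: "'a \<Rightarrow> real"
  assumes "ae_adapted k X" "ae_adapted k Y"
    and [measurable]: "(\<lambda>p. H (fst p) (snd p)) \<in> borel_measurable (borel \<Otimes>\<^sub>M borel)"
  shows "ae_adapted k (\<lambda>\<omega>. H (X \<omega>) (Y \<omega>))"
proof -
  have "(\<lambda>p. H (fst p) (snd p)) \<in> borel_measurable borel"
    using assms(3) by (simp add: borel_prod)
  from ae_adapted_compose[OF ae_adapted_Pair[OF assms(1,2)] this] show ?thesis by simp
qed

lemma ae_adapted_arith:
  fixes X Y :: "'a \<Rightarrow> real"
  assumes "ae_adapted k X" "ae_adapted k Y"
  shows "ae_adapted k (\<lambda>\<omega>. X \<omega> + Y \<omega>)" "ae_adapted k (\<lambda>\<omega>. X \<omega> - Y \<omega>)"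
    "ae_adapted k (\<lambda>\<omega>. X \<omega> * Y \<omega>)" "ae_adapted k (\<lambda>\<omega>. X \<omega> / Y \<omega>)"
    "ae_adapted k (\<lambda>\<omega>. max (X \<omega>) (Y \<omega>))" "ae_adapted k (\<lambda>\<omega>. min (X \<omega>) (Y \<omega>))"
  by (rule ae_adapted_compose2[OF assms]; measurable)+

lemma ae_adapted_if:
  fixes X Y :: "'a \<Rightarrow> 'b::topological_space" and U V :: "'a \<Rightarrow> real"
  assumes "ae_adapted k X" "ae_adapted k Y" "ae_adapted k U" "ae_adapted k V"
  shows "ae_adapted k (\<lambda>\<omega>. if U \<omega> < V \<omega> then X \<omega> else Y \<omega>)"
    and "ae_adapted k (\<lambda>\<omega>. if U \<omega> = V \<omega> then X \<omega> else Y \<omega>)"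
proof -
  obtain X' where X'[measurable]: "X' \<in> borel_measurable (Fk k)" and X: "AE \<omega> in M. X \<omega> = X' \<omega>"
    by (rule ae_adaptedE[OF assms(1)])
  obtain Y' where Y'[measurable]: "Y' \<in> borel_measurable (Fk k)" and Y: "AE \<omega> in M. Y \<omega> = Y' \<omega>"
    by (rule ae_adaptedE[OF assms(2)])
  obtain U' where U'[measurable]: "U' \<in> borel_measurable (Fk k)" and U: "AE \<omega> in M. U \<omega> = U' \<omega>"
    by (rule ae_adaptedE[OF assms(3)])
  obtain V' where V'[measurable]: "V' \<in> borel_measurable (Fk k)" and V: "AE \<omega> in M. V \<omega> = V' \<omega>"
    by (rule ae_adaptedE[OF assms(4)])
  have lt: "AE \<omega> in M. (if U \<omega> < V \<omega> then X \<omega> else Y \<omega>) = (if U' \<omega> < V' \<omega> then X' \<omega> else Y' \<omega>)"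
    using X Y U V by eventually_elim simp
  have eq: "AE \<omega> in M. (if U \<omega> = V \<omega> then X \<omega> else Y \<omega>) = (if U' \<omega> = V' \<omega> then X' \<omega> else Y' \<omega>)"
    using X Y U V by eventually_elim simp
  have lt': "(\<lambda>\<omega>. if U' \<omega> < V' \<omega> then X' \<omega> else Y' \<omega>) \<in> borel_measurable (Fk k)"
    and eq': "(\<lambda>\<omega>. if U' \<omega> = V' \<omega> then X' \<omega> else Y' \<omega>) \<in> borel_measurable (Fk k)" by measurable
  show "ae_adapted k (\<lambda>\<omega>. if U \<omega> < V \<omega> then X \<omega> else Y \<omega>)"
    "ae_adapted k (\<lambda>\<omega>. if U \<omega> = V \<omega> then X \<omega> else Y \<omega>)"
    by (rule ae_adaptedI[OF lt' lt], rule ae_adaptedI[OF eq' eq])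
qed

section \<open>Random functions at random arguments\<close>

lemma borel_measurable_round_above_arg:
  fixes F :: "'a \<Rightarrow> real \<Rightarrow> real"
  assumes F: "\<And>x. (\<lambda>\<omega>. F \<omega> x) \<in> borel_measurable (Fk k)"
    and [measurable]: "Y \<in> borel_measurable (Fk k)"
  shows "(\<lambda>\<omega>. F \<omega> (round_above n (Y \<omega>))) \<in> borel_measurable (Fk k)"
proof -
  have "(\<lambda>\<omega>. \<lfloor>real (Suc n) * Y \<omega>\<rfloor>) \<in> measurable (Fk k) (count_space UNIV)" by measurable
  then show ?thesis
    unfolding round_above_def
    by (rule measurable_compose_countable[where f = "\<lambda>i \<omega>. F \<omega> ((real_of_int i + 1) / real (Suc n))", rotated])
      (rule F)
qed

text \<open>The limit along the grid is a measurable function for \<open>Fk k\<close> even on paths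
  where \<open>F\<close> is discontinuous, and it agrees with \<open>F \<omega> (Y \<omega>)\<close>
  almost surely. The composition itself may fail to be measurable.\<close>

lemma random_function_limit:
  fixes F :: "'a \<Rightarrow> real \<Rightarrow> real"
  assumes F: "\<And>x. (\<lambda>\<omega>. F \<omega> x) \<in> borel_measurable (Fk k)"
    and cont: "AE \<omega> in M. continuous_on UNIV (F \<omega>)"
    and Y: "Y \<in> borel_measurable (Fk k)"
  obtains Z where "Z \<in> borel_measurable (Fk k)" "AE \<omega> in M. F \<omega> (Y \<omega>) = Z \<omega>"
    "AE \<omega> in M. (\<lambda>n. F \<omega> (round_above n (Y \<omega>))) \<longlonglongrightarrow> F \<omega> (Y \<omega>)"
proof -
  define Z where "Z \<omega> = lim (\<lambda>n. F \<omega> (round_above n (Y \<omega>)))" for \<omega>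
  have Z: "Z \<in> borel_measurable (Fk k)" unfolding Z_def
    by (rule borel_measurable_lim_metric, rule borel_measurable_round_above_arg[where F = F, OF F Y])
  have lim: "AE \<omega> in M. (\<lambda>n. F \<omega> (round_above n (Y \<omega>))) \<longlonglongrightarrow> F \<omega> (Y \<omega>)"
    using cont
  proof eventually_elim
    case (elim \<omega>)
    then have "isCont (F \<omega>) (Y \<omega>)" by (simp add: continuous_on_eq_continuous_at)
    then show ?case by (rule isCont_tendsto_compose[OF _ round_above_tendsto])
  qed
  have "AE \<omega> in M. F \<omega> (Y \<omega>) = Z \<omega>"
    using lim by eventually_elim (simp add: Z_def limI)
  then show thesis by (rule that[OF Z _ lim])
qed

lemma ae_adapted_random_function:
  fixes F :: "'a \<Rightarrow> real \<Rightarrow> real"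
  assumes F: "\<And>x. (\<lambda>\<omega>. F \<omega> x) \<in> borel_measurable (Fk k)"
    and cont: "AE \<omega> in M. continuous_on UNIV (F \<omega>)"
    and X: "ae_adapted k X"
  shows "ae_adapted k (\<lambda>\<omega>. F \<omega> (X \<omega>))"
proof -
  obtain Y where Y: "Y \<in> borel_measurable (Fk k)" "AE \<omega> in M. X \<omega> = Y \<omega>"
    by (rule ae_adaptedE[OF X])
  obtain Z where Z: "Z \<in> borel_measurable (Fk k)" "AE \<omega> in M. F \<omega> (Y \<omega>) = Z \<omega>"
    by (rule random_function_limit[where F = F, OF F cont Y(1)])
  have "AE \<omega> in M. F \<omega> (X \<omega>) = Z \<omega>" using Y(2) Z(2) by eventually_elim simp
  with Z(1) show ?thesis by (rule ae_adaptedI)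
qed

lemma ae_adapted_INF:
  fixes f :: "'a \<Rightarrow> real \<Rightarrow> real"
  assumes f: "\<And>x. (\<lambda>\<omega>. f \<omega> x) \<in> borel_measurable (Fk k)"
    and cont: "AE \<omega> in M. continuous_on UNIV (f \<omega>)"
    and R: "ae_adapted k R" "AE \<omega> in M. 0 \<le> R \<omega>"
    and nonneg: "AE \<omega> in M. \<forall>x. \<bar>x\<bar> \<le> R \<omega> \<longrightarrow> 0 \<le> f \<omega> x"
  shows "ae_adapted k (\<lambda>\<omega>. INF x\<in>{x. \<bar>x\<bar> \<le> R \<omega>}. f \<omega> x)"
proof -
  have "ae_adapted k (\<lambda>\<omega>. max 0 (f \<omega> (max (- R \<omega>) (min (R \<omega>) q))))" for q
  proof -
    have "ae_adapted k (\<lambda>\<omega>. max (- R \<omega>) (min (R \<omega>) q))"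
      using ae_adapted_arith(5)[OF ae_adapted_arith(2)[OF ae_adapted_const[of k 0] R(1)]
        ae_adapted_arith(6)[OF R(1) ae_adapted_const[of k q]]] by simp
    then have "ae_adapted k (\<lambda>\<omega>. f \<omega> (max (- R \<omega>) (min (R \<omega>) q)))"
      by (rule ae_adapted_random_function[where F = f, OF f cont])
    then show ?thesis by (rule ae_adapted_arith(5)[OF ae_adapted_const])
  qed
  then have "\<forall>q. \<exists>Y\<in>borel_measurable (Fk k). AE \<omega> in M. max 0 (f \<omega> (max (- R \<omega>) (min (R \<omega>) q))) = Y \<omega>"
    unfolding ae_adapted_def by blast
  then obtain Y where Y: "\<And>q. Y q \<in> borel_measurable (Fk k)"
    "\<And>q. AE \<omega> in M. max 0 (f \<omega> (max (- R \<omega>) (min (R \<omega>) q))) = Y q \<omega>"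
    by metis
  have "AE \<omega> in M. \<forall>q\<in>\<rat>. max 0 (f \<omega> (max (- R \<omega>) (min (R \<omega>) q))) = Y q \<omega>"
    by (subst AE_ball_countable) (use Y(2) countable_rat in auto)
  then have "AE \<omega> in M. (INF x\<in>{x. \<bar>x\<bar> \<le> R \<omega>}. f \<omega> x) = (INF q\<in>\<rat>. Y q \<omega>)"
    using cont R(2) nonneg
  proof eventually_elim
    case (elim \<omega>)
    have "(INF x\<in>{x. \<bar>x\<bar> \<le> R \<omega>}. f \<omega> x) = (INF q\<in>\<rat>. max 0 (f \<omega> (max (- R \<omega>) (min (R \<omega>) q))))"
      using elim by (intro INF_symmetric_interval_rationals) auto
    also have "\<dots> = (INF q\<in>\<rat>. Y q \<omega>)"
      using elim(1) by (intro INF_cong refl) blast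
    finally show ?case .
  qed
  moreover have "(\<lambda>\<omega>. INF q\<in>\<rat>. Y q \<omega>) \<in> borel_measurable (Fk k)"
    by (intro borel_measurable_cINF_real countable_rat Y(1))
  ultimately show ?thesis by (rule ae_adaptedI[rotated])
qed

lemma ae_adapted_proj:
  fixes Q :: "'a \<Rightarrow> real^'d^'d"
  assumes D: "convex D" "compact D" "D \<noteq> {}" and c: "c > 0"
    and Q: "ae_adapted k Q" "AE \<omega> in M. Q \<omega> \<in> coercive_forms c" and X: "ae_adapted k X"
  shows "ae_adapted k (\<lambda>\<omega>. proj (Q \<omega>) D (X \<omega>))"
proof -
  let ?S = "(coercive_forms c :: (real^'d^'d) set) \<times> (UNIV :: (real^'d) set)"
  \<comment> \<open>Continuity is available on the closed set of coercive forms; the value 0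
    elsewhere gives a Borel map that returns the projection wherever \<open>Q \<omega>\<close> is
    coercive, hence almost surely.\<close>
  define g where "g p = indicator ?S p *\<^sub>R proj (fst p) D (snd p)" for p
  have "?S \<in> sets borel" by (intro borel_closed closed_Times closed_coercive_forms closed_UNIV)
  then have "g \<in> borel_measurable borel"
    unfolding g_def by (rule borel_measurable_continuous_on_indicator[OF _ continuous_on_proj[OF D c]])
  then have "ae_adapted k (\<lambda>\<omega>. g (Q \<omega>, X \<omega>))"
    by (intro ae_adapted_compose[OF ae_adapted_Pair[OF Q(1) X]])
  then show ?thesis
    by (rule ae_adapted_cong) (use Q(2) in \<open>eventually_elim; simp add: g_def\<close>)
qed

text \<open>The hypothesis \<open>cdf\<close> treats one real argument at a time, each with its own
  null set. A threshold on the grid is constant on countably many cells of \<open>Fk k\<close>,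
  where \<open>cdf\<close> applies directly; a general threshold follows by rounding up and
  dominated convergence.\<close>

lemma cond_exp_indicator_random_threshold:
  fixes F :: "'a \<Rightarrow> real \<Rightarrow> real"
  assumes F: "\<And>x. (\<lambda>\<omega>. F \<omega> x) \<in> borel_measurable (Fk k)"
    and cont: "AE \<omega> in M. continuous_on UNIV (F \<omega>)"
    and e[measurable]: "e \<in> borel_measurable M"
    and cdf: "\<And>x. AE \<omega> in M. F \<omega> x =
      real_cond_exp M (Fk k) (\<lambda>\<omega>. indicator {\<omega>' \<in> space M. e \<omega>' \<le> x} \<omega>) \<omega>"
    and Y[measurable]: "Y \<in> borel_measurable (Fk k)"
  shows "AE \<omega> in M. real_cond_exp M (Fk k) (\<lambda>\<omega>. indicator {\<omega>' \<in> space M. e \<omega>' \<le> Y \<omega>'} \<omega>) \<omega> = F \<omega> (Y \<omega>)"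
proof -
  interpret sigma_finite_subalgebra M "Fk k" by (rule sigma_finite_Fk)
  have YM[measurable]: "Y \<in> borel_measurable M" by (rule measurable_Fk[OF Y])
  have [measurable]: "(\<lambda>\<omega>. round_above n (Y \<omega>)) \<in> borel_measurable M" for n
    unfolding round_above_def by measurable
  define G where "G n \<omega> = (indicator {\<omega>' \<in> space M. e \<omega>' \<le> round_above n (Y \<omega>')} \<omega> :: real)" for n \<omega>
  define H where "H \<omega> = (indicator {\<omega>' \<in> space M. e \<omega>' \<le> Y \<omega>'} \<omega> :: real)" for \<omega>
  have [measurable]: "G n \<in> borel_measurable M" "H \<in> borel_measurable M" for n
    unfolding G_def H_def by measurable
  have G_int: "integrable M (G n)" and H_int: "integrable M H" for n
    by (rule integrable_const_bound[where B = 1]; auto simp: G_def H_def indicator_def)+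
  have step: "AE \<omega> in M. real_cond_exp M (Fk k) (G n) \<omega> = F \<omega> (round_above n (Y \<omega>))" for n
  proof -
    define S where "S i = {\<omega> \<in> space (Fk k). \<lfloor>real (Suc n) * Y \<omega>\<rfloor> = i}" for i :: int
    define x where "x i = (real_of_int i + 1) / real (Suc n)" for i
    have S[measurable]: "S i \<in> sets (Fk k)" for i unfolding S_def by measurable
    have SM[measurable]: "S i \<in> sets M" for i using S subalg by (auto simp: subalgebra_def)
    have "AE \<omega> in M. indicator (S i) \<omega> * real_cond_exp M (Fk k) (G n) \<omega> = indicator (S i) \<omega> * F \<omega> (x i)" for i
    proof -
      define J where "J \<omega> = (indicator {\<omega>' \<in> space M. e \<omega>' \<le> x i} \<omega> :: real)" for \<omega>
      have [measurable]: "J \<in> borel_measurable M" unfolding J_def by measurable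
      have eq: "(\<lambda>\<omega>. indicator (S i) \<omega> * G n \<omega>) = (\<lambda>\<omega>. indicator (S i) \<omega> * J \<omega>)"
        by (auto simp: fun_eq_iff S_def G_def J_def x_def round_above_def indicator_def)
      have "integrable M (\<lambda>\<omega>. indicator (S i) \<omega> * J \<omega>)"
        by (rule integrable_const_bound[where B = 1]) (auto simp: J_def indicator_def)
      then have "AE \<omega> in M. real_cond_exp M (Fk k) (\<lambda>\<omega>. indicator (S i) \<omega> * J \<omega>) \<omega>
          = indicator (S i) \<omega> * real_cond_exp M (Fk k) J \<omega>"
        by (intro real_cond_exp_mult) auto
      moreover have "AE \<omega> in M. real_cond_exp M (Fk k) (\<lambda>\<omega>. indicator (S i) \<omega> * G n \<omega>) \<omega>
          = indicator (S i) \<omega> * real_cond_exp M (Fk k) (G n) \<omega>"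
        using \<open>integrable M (\<lambda>\<omega>. indicator (S i) \<omega> * J \<omega>)\<close>
        by (intro real_cond_exp_mult) (auto simp: eq)
      moreover have "AE \<omega> in M. F \<omega> (x i) = real_cond_exp M (Fk k) J \<omega>"
        unfolding J_def by (rule cdf)
      ultimately show ?thesis unfolding eq by eventually_elim simp
    qed
    then have "AE \<omega> in M. \<forall>i. indicator (S i) \<omega> * real_cond_exp M (Fk k) (G n) \<omega> = indicator (S i) \<omega> * F \<omega> (x i)"
      by (subst AE_all_countable) blast
    then show ?thesis using AE_space
    proof eventually_elim
      case (elim \<omega>)
      have "\<omega> \<in> S \<lfloor>real (Suc n) * Y \<omega>\<rfloor>"
        using elim(2) subalg by (simp add: S_def subalgebra_def)
      then show ?case
        using elim(1)[rule_format, of "\<lfloor>real (Suc n) * Y \<omega>\<rfloor>"] by (simp add: x_def round_above_def)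
    qed
  qed
  obtain Z where Z[measurable]: "Z \<in> borel_measurable (Fk k)" and FZ: "AE \<omega> in M. F \<omega> (Y \<omega>) = Z \<omega>"
    and lim: "AE \<omega> in M. (\<lambda>n. F \<omega> (round_above n (Y \<omega>))) \<longlonglongrightarrow> F \<omega> (Y \<omega>)"
    by (rule random_function_limit[where F = F, OF F cont Y])
  have [measurable]: "Z \<in> borel_measurable M" by (rule measurable_Fk[OF Z])
  have bound: "AE \<omega> in M. \<bar>real_cond_exp M (Fk k) (G n) \<omega>\<bar> \<le> 1" for n
  proof -
    have "AE \<omega> in M. 0 \<le> real_cond_exp M (Fk k) (G n) \<omega> \<and> real_cond_exp M (Fk k) (G n) \<omega> \<le> 1"
      by (rule cond_exp_unit_interval) (auto simp: G_def indicator_def)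
    then show ?thesis by eventually_elim auto
  qed
  have "AE \<omega> in M. \<forall>n. real_cond_exp M (Fk k) (G n) \<omega> = F \<omega> (round_above n (Y \<omega>))"
    by (subst AE_all_countable) (use step in blast)
  then have limZ: "AE \<omega> in M. (\<lambda>n. real_cond_exp M (Fk k) (G n) \<omega>) \<longlonglongrightarrow> Z \<omega>"
    using lim FZ by eventually_elim simp
  have "AE \<omega> in M. \<forall>n. \<bar>real_cond_exp M (Fk k) (G n) \<omega>\<bar> \<le> 1"
    by (subst AE_all_countable) (use bound in blast)
  then have Z1: "AE \<omega> in M. \<bar>Z \<omega>\<bar> \<le> 1"
    using limZ
  proof eventually_elim
    case (elim \<omega>)
    then show ?case
      by (intro LIMSEQ_le_const2[OF tendsto_rabs[OF elim(2)]]) auto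
  qed
  have Z_int: "integrable M Z" by (rule integrable_const_bound[where B = 1]) (use Z1 in auto)
  have "AE \<omega> in M. real_cond_exp M (Fk k) H \<omega> = Z \<omega>"
  proof (rule real_cond_exp_charact[OF _ H_int Z_int Z])
    fix A assume A: "A \<in> sets (Fk k)"
    then have [measurable]: "A \<in> sets M" using subalg by (auto simp: subalgebra_def)
    have "(\<lambda>n. \<integral>\<omega>. indicator A \<omega> *\<^sub>R G n \<omega> \<partial>M) \<longlonglongrightarrow> (\<integral>\<omega>. indicator A \<omega> *\<^sub>R H \<omega> \<partial>M)"
    proof (rule integral_dominated_convergence[where w = "\<lambda>_. 1"])
      show "AE \<omega> in M. (\<lambda>n. indicator A \<omega> *\<^sub>R G n \<omega>) \<longlonglongrightarrow> indicator A \<omega> *\<^sub>R H \<omega>"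
        using AE_space
      proof eventually_elim
        case (elim \<omega>)
        then have "G n \<omega> = indicator {z. z \<le> round_above n (Y \<omega>)} (e \<omega>)" "H \<omega> = indicator {z. z \<le> Y \<omega>} (e \<omega>)" for n
          by (auto simp: G_def H_def indicator_def)
        then show ?case
          using tendsto_scaleR[OF tendsto_const indicator_round_above_tendsto[of "Y \<omega>" "e \<omega>"]] by simp
      qed
    qed (auto simp: G_def indicator_def)
    moreover have "(\<lambda>n. \<integral>\<omega>. indicator A \<omega> *\<^sub>R real_cond_exp M (Fk k) (G n) \<omega> \<partial>M)
        \<longlonglongrightarrow> (\<integral>\<omega>. indicator A \<omega> *\<^sub>R Z \<omega> \<partial>M)"
    proof (rule integral_dominated_convergence[where w = "\<lambda>_. 1"])
      show "AE \<omega> in M. (\<lambda>n. indicator A \<omega> *\<^sub>R real_cond_exp M (Fk k) (G n) \<omega>) \<longlonglongrightarrow> indicator A \<omega> *\<^sub>R Z \<omega>"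
        using limZ by eventually_elim (intro tendsto_scaleR tendsto_const)
      show "AE \<omega> in M. norm (indicator A \<omega> *\<^sub>R real_cond_exp M (Fk k) (G n) \<omega>) \<le> 1" for n
        using bound[of n] by eventually_elim (auto simp: indicator_def)
    qed auto
    moreover have "(\<integral>\<omega>. indicator A \<omega> *\<^sub>R G n \<omega> \<partial>M) = (\<integral>\<omega>. indicator A \<omega> *\<^sub>R real_cond_exp M (Fk k) (G n) \<omega> \<partial>M)" for n
      using real_cond_exp_intA[OF G_int A] by (simp add: set_lebesgue_integral_def)
    ultimately show "(\<integral>\<omega>\<in>A. H \<omega> \<partial>M) = (\<integral>\<omega>\<in>A. Z \<omega> \<partial>M)"
      unfolding set_lebesgue_integral_def by (metis (lifting) LIMSEQ_unique ext)
  qed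
  then show ?thesis using FZ unfolding H_def[abs_def] by eventually_elim simp
qed

text \<open>\<open>e = Y\<close> implies \<open>Y - d < e \<le> Y\<close>, whose probability is the
  mean increment of \<open>F \<omega>\<close> from \<open>Y - d\<close> to \<open>Y\<close> and
  tends to 0 with \<open>d\<close> by continuity.\<close>

lemma AE_neq_random_threshold:
  fixes F :: "'a \<Rightarrow> real \<Rightarrow> real"
  assumes F: "\<And>x. (\<lambda>\<omega>. F \<omega> x) \<in> borel_measurable (Fk k)"
    and cont: "AE \<omega> in M. continuous_on UNIV (F \<omega>)"
    and e[measurable]: "e \<in> borel_measurable M"
    and cdf: "\<And>x. AE \<omega> in M. F \<omega> x =
      real_cond_exp M (Fk k) (\<lambda>\<omega>. indicator {\<omega>' \<in> space M. e \<omega>' \<le> x} \<omega>) \<omega>"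
    and Y[measurable]: "Y \<in> borel_measurable (Fk k)"
  shows "AE \<omega> in M. e \<omega> \<noteq> Y \<omega>"
proof -
  interpret sigma_finite_subalgebra M "Fk k" by (rule sigma_finite_Fk)
  have YM[measurable]: "Y \<in> borel_measurable M" by (rule measurable_Fk[OF Y])
  define d where "d m = 1 / real (Suc m)" for m
  have d0: "d \<longlonglongrightarrow> 0" unfolding d_def by (rule LIMSEQ_Suc[OF lim_1_over_n])
  define H where "H x \<omega> = (indicator {\<omega>' \<in> space M. e \<omega>' \<le> Y \<omega>' - x} \<omega> :: real)" for x \<omega>
  have [measurable]: "H x \<in> borel_measurable M" for x unfolding H_def by measurable
  have H_int: "integrable M (H x)" for x
    by (rule integrable_const_bound[where B = 1]) (auto simp: H_def indicator_def)
  have ceH: "AE \<omega> in M. real_cond_exp M (Fk k) (H x) \<omega> = F \<omega> (Y \<omega> - x)" for x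
    unfolding H_def[abs_def]
    by (rule cond_exp_indicator_random_threshold[where F = F, OF F cont e cdf]) measurable
  have bound: "AE \<omega> in M. \<bar>real_cond_exp M (Fk k) (H x) \<omega>\<bar> \<le> 1" for x
  proof -
    have "AE \<omega> in M. 0 \<le> real_cond_exp M (Fk k) (H x) \<omega> \<and> real_cond_exp M (Fk k) (H x) \<omega> \<le> 1"
      by (rule cond_exp_unit_interval) (auto simp: H_def indicator_def)
    then show ?thesis by eventually_elim auto
  qed
  have "(\<lambda>m. \<integral>\<omega>. real_cond_exp M (Fk k) (H (d m)) \<omega> \<partial>M) \<longlonglongrightarrow> (\<integral>\<omega>. real_cond_exp M (Fk k) (H 0) \<omega> \<partial>M)"
  proof (rule integral_dominated_convergence[where w = "\<lambda>_. 1"])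
    have "AE \<omega> in M. \<forall>m. real_cond_exp M (Fk k) (H (d m)) \<omega> = F \<omega> (Y \<omega> - d m)"
      by (subst AE_all_countable) (use ceH in blast)
    then show "AE \<omega> in M. (\<lambda>m. real_cond_exp M (Fk k) (H (d m)) \<omega>) \<longlonglongrightarrow> real_cond_exp M (Fk k) (H 0) \<omega>"
      using cont ceH[of 0]
    proof eventually_elim
      case (elim \<omega>)
      then have "isCont (F \<omega>) (Y \<omega> - 0)" by (simp add: continuous_on_eq_continuous_at)
      then have "(\<lambda>m. F \<omega> (Y \<omega> - d m)) \<longlonglongrightarrow> F \<omega> (Y \<omega> - 0)"
        by (rule isCont_tendsto_compose) (intro tendsto_intros d0)
      then show ?case using elim by simp
    qed
    show "AE \<omega> in M. norm (real_cond_exp M (Fk k) (H (d m)) \<omega>) \<le> 1" for m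
      using bound[of "d m"] by simp
  qed auto
  then have lim: "(\<lambda>m. \<integral>\<omega>. H 0 \<omega> \<partial>M - \<integral>\<omega>. H (d m) \<omega> \<partial>M) \<longlonglongrightarrow> \<integral>\<omega>. H 0 \<omega> \<partial>M - \<integral>\<omega>. H 0 \<omega> \<partial>M"
    using real_cond_exp_int(2)[OF H_int] by (intro tendsto_diff tendsto_const) simp
  define A where "A = {\<omega> \<in> space M. e \<omega> = Y \<omega>}"
  have [measurable]: "A \<in> sets M" unfolding A_def by measurable
  have "measure M A \<le> \<integral>\<omega>. H 0 \<omega> \<partial>M - \<integral>\<omega>. H (d m) \<omega> \<partial>M" for m
  proof -
    have intA: "integrable M (indicator A :: 'a \<Rightarrow> real)"
      by (simp add: integrable_indicator_iff emeasure_eq_measure)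
    have "measure M A = (\<integral>\<omega>. indicator A \<omega> \<partial>M)" by simp
    also have "\<dots> \<le> (\<integral>\<omega>. H 0 \<omega> - H (d m) \<omega> \<partial>M)"
    proof (rule integral_mono[OF intA])
      show "indicator A \<omega> \<le> H 0 \<omega> - H (d m) \<omega>" for \<omega>
      proof -
        have "d m > 0" by (simp add: d_def)
        then show ?thesis by (auto simp: A_def H_def indicator_def)
      qed
    qed (use H_int in auto)
    also have "\<dots> = (\<integral>\<omega>. H 0 \<omega> \<partial>M) - (\<integral>\<omega>. H (d m) \<omega> \<partial>M)"
      by (rule Bochner_Integration.integral_diff[OF H_int H_int])
    finally show ?thesis .
  qed
  then have "measure M A \<le> \<integral>\<omega>. H 0 \<omega> \<partial>M - \<integral>\<omega>. H 0 \<omega> \<partial>M"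
    by (intro LIMSEQ_le_const[OF lim]) auto
  then have "emeasure M A = 0" by (simp add: emeasure_eq_measure measure_le_0_iff)
  then show ?thesis
    by (intro AE_I[of _ _ A]) (auto simp: A_def)
qed

end

subsection \<open>The innovation\<close>

text \<open>The conditional mean of the innovation for prediction argument \<open>z\<close> and true
  argument \<open>s\<close>, in the three saturation regimes.\<close>

definition drift :: "(real \<Rightarrow> real) \<Rightarrow> real \<Rightarrow> real \<Rightarrow> real \<Rightarrow> real \<Rightarrow> real" where
  "drift F l u z s = (if z \<le> l then F (l - z) - F (l - s)
     else if z < u then 1 - 2 * F (z - s) else F (u - z) - F (u - s))"

text \<open>The jump of the innovation as the observation crosses the prediction. Observations lie
  between \<open>l\<close> and \<open>u\<close>, so at a saturated prediction \<open>sgn\<close> has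
  only one possible nonzero value.\<close>

definition noise_gain :: "real \<Rightarrow> real \<Rightarrow> real \<Rightarrow> real" where
  "noise_gain l u z = (if z \<le> l then 1 else if z < u then 2 else 1)"

lemma noise_gain_range: "1 \<le> noise_gain l u z" "noise_gain l u z \<le> 2"
  by (auto simp: noise_gain_def)

lemma noise_gain_nonneg: "0 \<le> noise_gain l u z"
  by (simp add: noise_gain_def)

text \<open>Saturation is monotone, so off ties the comparison of observation and prediction is
  decided by the single event \<open>e \<le> sat l u l u z - zt\<close>; its centred indicator is
  the martingale part. At a tie \<open>sgn\<close> is 0, a value that the formula does not reproduce
  in the interior and upper regimes.\<close>

lemma innov_decomposition:
  assumes "l < u" "e \<noteq> sat l u l u z - zt"
  shows "innov F l u l u (sat l u l u (zt + e)) z = drift F l u z zt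
    + noise_gain l u z * (F (sat l u l u z - zt) - (if e \<le> sat l u l u z - zt then 1 else 0))"
  using assms by (auto simp: innov_def sat_def drift_def noise_gain_def ind_def sgn_if)

lemma abs_innov_le_2:
  assumes "\<And>x. 0 \<le> F x" "\<And>x. F x \<le> 1" "l < u"
  shows "\<bar>innov F l u l u y z\<bar> \<le> 2"
  using assms(1)[of "u - z"] assms(2)[of "u - z"] assms(1)[of "l - z"] assms(2)[of "l - z"] assms(3)
  by (auto simp: innov_def ind_def sgn_if abs_le_iff)

lemma mvt_in_symmetric_interval:
  fixes F f :: "real \<Rightarrow> real"
  assumes F: "\<And>x. (F has_real_derivative f x) (at x)" and "\<bar>a\<bar> \<le> R" "\<bar>b\<bar> \<le> R"
  shows "\<exists>\<xi>. \<bar>\<xi>\<bar> \<le> R \<and> F a - F b = f \<xi> * (a - b)"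
proof -
  have main: "\<exists>\<xi>. \<bar>\<xi>\<bar> \<le> R \<and> F a - F b = f \<xi> * (a - b)" if "b < a" "\<bar>a\<bar> \<le> R" "\<bar>b\<bar> \<le> R" for a b
  proof -
    obtain \<xi> where "b < \<xi>" "\<xi> < a" "F a - F b = (a - b) * f \<xi>"
      using MVT2[OF \<open>b < a\<close>, of F f] F by blast
    then show ?thesis using that by (intro exI[of _ \<xi>]) auto
  qed
  consider "b < a" | "a < b" | "a = b" by linarith
  then show ?thesis
  proof cases
    case 2
    obtain \<xi> where "\<bar>\<xi>\<bar> \<le> R" "F b - F a = f \<xi> * (b - a)"
      using main[OF 2 assms(3,2)] by blast
    then show ?thesis by (intro exI[of _ \<xi>]) (auto simp: algebra_simps)
  qed (use main assms in auto)
qed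

lemma drift_self:
  assumes "F 0 = 1 / 2"
  shows "drift F l u z z = 0"
  using assms by (auto simp: drift_def)

text \<open>All arguments of \<open>F\<close> that occur lie in the interval on which A3 bounds the density.\<close>

lemma drift_diff:
  assumes F: "\<And>x. (F has_real_derivative f x) (at x)"
    and C: "\<bar>z\<bar> \<le> C" "\<bar>s\<bar> \<le> C" "\<bar>s'\<bar> \<le> C"
  shows "\<exists>\<xi>. \<bar>\<xi>\<bar> \<le> max (2 * C) (max (C + l) (C - u)) \<and>
    drift F l u z s - drift F l u z s' = noise_gain l u z * f \<xi> * (s - s')"
proof -
  let ?R = "max (2 * C) (max (C + l) (C - u))"
  \<comment> \<open>\<open>t\<close> is the clamped prediction. In every regime \<open>s\<close>
    enters the drift only through \<open>- noise_gain l u z * F (t - s)\<close>, so one mean value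
    argument covers all three.\<close>
  define t where "t = (if z \<le> l then l else if z < u then z else u)"
  have R: "\<bar>t - r\<bar> \<le> ?R" if "\<bar>r\<bar> \<le> C" for r
    using that C(1) by (auto simp: t_def abs_le_iff)
  obtain \<xi> where \<xi>: "\<bar>\<xi>\<bar> \<le> ?R" "F (t - s') - F (t - s) = f \<xi> * ((t - s') - (t - s))"
    using mvt_in_symmetric_interval[OF F R R, of s' s] C by blast
  then have "drift F l u z s - drift F l u z s' = noise_gain l u z * (f \<xi> * (s - s'))"
    by (auto simp: drift_def noise_gain_def t_def split: if_splits)
  then show ?thesis using \<xi>(1) by (auto simp: mult.assoc)
qed

text \<open>The drift vanishes at \<open>s = z\<close> because the noise has median 0. The gain of
  step 2 is thus the secant slope of the drift from the current prediction to that of step 1, which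
  stands in for the unknown true one; the branch of equal predictions is the corresponding
  derivative.\<close>

lemma beta2_is_drift_slope:
  assumes F: "\<And>x. (F has_real_derivative f x) (at x)" and med: "F 0 = 1 / 2" and "l < u"
    and C: "\<bar>z\<bar> \<le> C" "\<bar>s\<bar> \<le> C"
  shows "drift F l u z s = beta2 F f l u l u z s * (s - z)"
    and "\<exists>\<xi>. \<bar>\<xi>\<bar> \<le> max (2 * C) (max (C + l) (C - u)) \<and>
      beta2 F f l u l u z s = noise_gain l u z * f \<xi>"
proof -
  have beta: "beta2 F f l u l u z s = (if s = z then noise_gain l u z * f (sat l u l u z - z)
      else drift F l u z s / (s - z))"
    using \<open>l < u\<close> by (auto simp: beta2_def Let_def ind_def sat_def drift_def noise_gain_def)
  show 1: "drift F l u z s = beta2 F f l u l u z s * (s - z)"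
    using drift_self[where F = F, OF med] by (simp add: beta)
  show "\<exists>\<xi>. \<bar>\<xi>\<bar> \<le> max (2 * C) (max (C + l) (C - u)) \<and>
      beta2 F f l u l u z s = noise_gain l u z * f \<xi>"
  proof (cases "s = z")
    case True
    have "\<bar>sat l u l u z - z\<bar> \<le> max (2 * C) (max (C + l) (C - u))"
      using C \<open>l < u\<close> by (auto simp: sat_def)
    then show ?thesis using True unfolding beta by auto
  next
    case False
    obtain \<xi> where "\<bar>\<xi>\<bar> \<le> max (2 * C) (max (C + l) (C - u))"
      "drift F l u z s - drift F l u z z = noise_gain l u z * f \<xi> * (s - z)"
      using drift_diff[OF F C(1) C(2) C(1), of l u] by blast
    then show ?thesis using False drift_self[where F = F, OF med] unfolding beta by auto
  qed
qed

text \<open>\<open>h\<close> and \<open>e\<close> are the prediction errors of step 2 and step 1,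
  \<open>psi\<close> is the drift at the truth and \<open>psi'\<close> the drift at the step 1
  estimate. If \<open>e = 0\<close> then \<open>be * h = psi\<close>, and the quadratic term
  consumes at most half of \<open>2 * b * h * psi\<close>; in general the discrepancy costs
  \<open>2 * C * \<bar>h\<bar> * \<bar>e\<bar>\<close>.\<close>

lemma two_step_dissipation:
  fixes be b h e g c C :: real
  assumes be: "0 \<le> be" "be \<le> C" and b: "b0 \<le> b" "0 \<le> b0" "b \<le> 1"
    and psi: "psi = g * h" "c \<le> g" "0 < c" and psi': "psi' = be * (h - e)" "\<bar>psi - psi'\<bar> \<le> C * \<bar>e\<bar>"
  shows "be * b\<^sup>2 * h\<^sup>2 - 2 * b * h * psi \<le> - (b0 * c / 2) * h\<^sup>2 + (2 * C\<^sup>2 / c) * e\<^sup>2"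
proof -
  have b': "0 \<le> b" using b by linarith
  have "be * h\<^sup>2 = h * psi + - (h * (psi - psi')) + h * (be * e)"
    by (simp add: psi'(1) algebra_simps power2_eq_square)
  also have "h * (be * e) \<le> \<bar>h\<bar> * (C * \<bar>e\<bar>)"
  proof -
    have "h * (be * e) \<le> \<bar>h * (be * e)\<bar>" by simp
    also have "\<dots> = \<bar>h\<bar> * (be * \<bar>e\<bar>)" using be by (simp add: abs_mult)
    also have "\<dots> \<le> \<bar>h\<bar> * (C * \<bar>e\<bar>)" using be by (intro mult_left_mono mult_right_mono) auto
    finally show ?thesis .
  qed
  also have "- (h * (psi - psi')) \<le> \<bar>h\<bar> * (C * \<bar>e\<bar>)"
  proof -
    have "- (h * (psi - psi')) \<le> \<bar>h * (psi - psi')\<bar>" by simp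
    also have "\<dots> \<le> \<bar>h\<bar> * (C * \<bar>e\<bar>)" unfolding abs_mult using psi'(2) by (intro mult_left_mono) auto
    finally show ?thesis .
  qed
  finally have 1: "be * h\<^sup>2 \<le> h * psi + 2 * C * (\<bar>h\<bar> * \<bar>e\<bar>)" by (simp add: algebra_simps)
  \<comment> \<open>Young's inequality with the weight that spends exactly half of the dissipation
    \<open>c * h^2\<close>.\<close>
  have "0 \<le> (c * \<bar>h\<bar> - 2 * C * \<bar>e\<bar>)\<^sup>2" by simp
  also have "\<dots> = c\<^sup>2 * h\<^sup>2 - 4 * c * C * (\<bar>h\<bar> * \<bar>e\<bar>) + 4 * C\<^sup>2 * e\<^sup>2"
    unfolding power2_diff by (simp add: power_mult_distrib)
  finally have "2 * C * (\<bar>h\<bar> * \<bar>e\<bar>) \<le> c / 2 * h\<^sup>2 + 2 * C\<^sup>2 / c * e\<^sup>2"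
    using psi(3) by (simp add: field_simps power2_eq_square)
  with 1 have "be * h\<^sup>2 - 2 * h * psi \<le> c / 2 * h\<^sup>2 + 2 * C\<^sup>2 / c * e\<^sup>2 - h * psi" by simp
  moreover have "c * h\<^sup>2 \<le> h * psi"
    using mult_right_mono[OF psi(2), of "h\<^sup>2"] by (simp add: psi(1) power2_eq_square mult_ac)
  ultimately have 2: "be * h\<^sup>2 - 2 * h * psi \<le> - (c / 2 * h\<^sup>2) + 2 * C\<^sup>2 / c * e\<^sup>2" by simp
  \<comment> \<open>The gain term carries \<open>b^2\<close> and the drift only \<open>b\<close>;
    \<open>b \<le> 1\<close> brings them to a common factor.\<close>
  have "be * b\<^sup>2 * h\<^sup>2 \<le> b * (be * h\<^sup>2)"
  proof -
    have "b\<^sup>2 \<le> b" using b' b(3) by (simp add: power2_eq_square mult_left_le)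
    then have "b\<^sup>2 * (be * h\<^sup>2) \<le> b * (be * h\<^sup>2)" using be by (intro mult_right_mono) auto
    then show ?thesis by (simp add: mult_ac)
  qed
  then have "be * b\<^sup>2 * h\<^sup>2 - 2 * b * h * psi \<le> b * (be * h\<^sup>2 - 2 * h * psi)"
    by (simp add: algebra_simps)
  also have "\<dots> \<le> b * (- (c / 2 * h\<^sup>2) + 2 * C\<^sup>2 / c * e\<^sup>2)"
    using 2 b' by (rule mult_left_mono)
  also have "\<dots> = - (b * (c / 2 * h\<^sup>2)) + b * (2 * C\<^sup>2 / c * e\<^sup>2)" by (simp only: distrib_left mult_minus_right)
  finally have "be * b\<^sup>2 * h\<^sup>2 - 2 * b * h * psi \<le> - (b * (c / 2 * h\<^sup>2)) + b * (2 * C\<^sup>2 / c * e\<^sup>2)" .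
  moreover have "b0 * (c / 2 * h\<^sup>2) \<le> b * (c / 2 * h\<^sup>2)" using b psi by (intro mult_right_mono) auto
  moreover have "b * (2 * C\<^sup>2 / c * e\<^sup>2) \<le> 1 * (2 * C\<^sup>2 / c * e\<^sup>2)" using b psi by (intro mult_right_mono) auto
  ultimately show ?thesis by simp
qed

text \<open>A gain below the slope \<open>g\<close> lets the quadratic term consume at most half of
  \<open>2 * b * h * psi\<close>.\<close>

lemma one_step_dissipation:
  fixes be b h g c :: real
  assumes be: "c \<le> be" "be \<le> g" "0 < c" and b: "b0 \<le> b" "0 \<le> b0" "b \<le> 1" and psi: "psi = g * h"
  shows "be * b\<^sup>2 * h\<^sup>2 - 2 * b * h * psi \<le> - (b0 * c) * h\<^sup>2"
proof -
  have b': "0 \<le> b" using b by linarith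
  have "b\<^sup>2 \<le> b" using b' b(3) by (simp add: power2_eq_square mult_left_le)
  then have "be * b\<^sup>2 * h\<^sup>2 \<le> g * b * h\<^sup>2"
    using be b' by (intro mult_right_mono mult_mono) auto
  then have "be * b\<^sup>2 * h\<^sup>2 - 2 * b * h * psi \<le> - (b * g * h\<^sup>2)"
    by (simp add: psi power2_eq_square algebra_simps)
  moreover have "b0 * c * h\<^sup>2 \<le> b * g * h\<^sup>2"
    using b be b' by (intro mult_right_mono mult_mono) auto
  ultimately show ?thesis by simp
qed

lemma sat_nonexpansive:
  assumes "l \<le> u"
  shows "\<bar>sat l u l u x - sat l u l u y\<bar> \<le> \<bar>x - y\<bar>"
  using assms by (auto simp: sat_def)

lemma coercive_forms_add_outer:
  assumes "Q \<in> coercive_forms c" "s \<ge> 0"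
  shows "Q + s *\<^sub>R outer v v \<in> coercive_forms c"
proof -
  have "transpose Q = Q" using assms by (simp add: coercive_forms_def)
  then have "transpose (Q + s *\<^sub>R outer v v) = Q + s *\<^sub>R outer v v"
    by (simp add: vec_eq_iff transpose_def outer_def mult_ac)
  moreover have "c * (norm x)\<^sup>2 \<le> qform (Q + s *\<^sub>R outer v v) x" for x
  proof -
    have "c * (norm x)\<^sup>2 \<le> qform Q x" using assms by (simp add: coercive_forms_def)
    moreover have "0 \<le> s * (v \<bullet> x)\<^sup>2" using assms by simp
    ultimately show ?thesis unfolding qform_add_matrix qform_outer by linarith
  qed
  ultimately show ?thesis by (simp add: coercive_forms_def)
qed

section \<open>Adaptedness of innovations, gains and estimates\<close>

context filtered_prob_space
begin

lemma ae_adapted_sat: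
  assumes "ae_adapted k l" "ae_adapted k u" "ae_adapted k L" "ae_adapted k U" "ae_adapted k z"
  shows "ae_adapted k (\<lambda>\<omega>. sat (l \<omega>) (u \<omega>) (L \<omega>) (U \<omega>) (z \<omega>))"
  unfolding sat_def by (rule ae_adapted_if(1) assms)+

lemma ae_adapted_noise_gain:
  assumes "ae_adapted k l" "ae_adapted k u" "ae_adapted k z"
  shows "ae_adapted k (\<lambda>\<omega>. noise_gain (l \<omega>) (u \<omega>) (z \<omega>))"
proof -
  have "noise_gain a b c = (if a < c then if c < b then 2 else 1 else 1)" for a b c
    by (auto simp: noise_gain_def)
  then show ?thesis
    by (simp only:) (rule ae_adapted_if(1) assms ae_adapted_const)+
qed

lemma ae_adapted_innov:
  fixes F :: "'a \<Rightarrow> real \<Rightarrow> real"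
  assumes F: "\<And>x. (\<lambda>\<omega>. F \<omega> x) \<in> borel_measurable (Fk k)" "AE \<omega> in M. continuous_on UNIV (F \<omega>)"
    and lu: "ae_adapted k l" "ae_adapted k u" "ae_adapted k L" "ae_adapted k U"
    and yz: "ae_adapted k y" "ae_adapted k z"
  shows "ae_adapted k (\<lambda>\<omega>. innov (F \<omega>) (l \<omega>) (u \<omega>) (L \<omega>) (U \<omega>) (y \<omega>) (z \<omega>))"
proof -
  note s = ae_adapted_sat[OF lu yz(2)]
  note R = ae_adapted_random_function[where F = F, OF F]
  have sgn: "ae_adapted k (\<lambda>\<omega>. sgn (y \<omega> - sat (l \<omega>) (u \<omega>) (L \<omega>) (U \<omega>) (z \<omega>)))"
    by (rule ae_adapted_compose[OF ae_adapted_arith(2)[OF yz(1) s]]) measurable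
  show ?thesis
    unfolding innov_def ind_def
    by (intro ae_adapted_arith(1-3) sgn R ae_adapted_if(2) s lu yz ae_adapted_const)
qed

lemma ae_adapted_beta2:
  fixes F f :: "'a \<Rightarrow> real \<Rightarrow> real"
  assumes F: "\<And>x. (\<lambda>\<omega>. F \<omega> x) \<in> borel_measurable (Fk k)" "AE \<omega> in M. continuous_on UNIV (F \<omega>)"
    and f: "\<And>x. (\<lambda>\<omega>. f \<omega> x) \<in> borel_measurable (Fk k)" "AE \<omega> in M. continuous_on UNIV (f \<omega>)"
    and lu: "ae_adapted k l" "ae_adapted k u" "ae_adapted k L" "ae_adapted k U"
    and z: "ae_adapted k z" "ae_adapted k z'"
  shows "ae_adapted k (\<lambda>\<omega>. beta2 (F \<omega>) (f \<omega>) (l \<omega>) (u \<omega>) (L \<omega>) (U \<omega>) (z \<omega>) (z' \<omega>))"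
proof -
  note s = ae_adapted_sat[OF lu z(1)]
  note R = ae_adapted_random_function[where F = F, OF F] ae_adapted_random_function[where F = f, OF f]
  note d = ae_adapted_arith(2)[OF z(2) z(1)]
  have ind: "ae_adapted k (\<lambda>\<omega>. ind (z' \<omega> - z \<omega> \<noteq> 0))" "ae_adapted k (\<lambda>\<omega>. ind (z' \<omega> - z \<omega> = 0))"
  proof -
    have ind_neq: "ind (r \<noteq> 0) = (if r = 0 then 0 else 1)" for r :: real by (simp add: ind_def)
    show "ae_adapted k (\<lambda>\<omega>. ind (z' \<omega> - z \<omega> \<noteq> 0))"
      unfolding ind_neq by (rule ae_adapted_if(2)[OF ae_adapted_const ae_adapted_const d ae_adapted_const])
    show "ae_adapted k (\<lambda>\<omega>. ind (z' \<omega> - z \<omega> = 0))"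
      unfolding ind_def by (rule ae_adapted_if(2)[OF ae_adapted_const ae_adapted_const d ae_adapted_const])
  qed
  have conj: "(if P \<and> Q then A else B) = (if P then if Q then A else B else B)" for P Q and A B :: real
    by simp
  show ?thesis
    unfolding beta2_def Let_def conj
    by (rule ae_adapted_if s lu ae_adapted_const ae_adapted_arith(1,3,4) ind d R
        ae_adapted_arith(2)[OF ae_adapted_const] ae_adapted_arith(2) z)+
qed

text \<open>Estimate, gain and inverse gain are followed together. The inverse is propagated by its
  own additive recursion, which avoids the measurability of matrix inversion and keeps it in
  \<open>coercive_forms c\<close> with the \<open>c\<close> of the initial inverse. The gain
  \<open>be\<close> and the innovation \<open>v\<close> may depend on the current estimate, so their
  adaptedness is assumed only given that of \<open>x k\<close>.\<close>

lemma ae_adapted_projected_recursion: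
  fixes P :: "nat \<Rightarrow> 'a \<Rightarrow> real^'d^'d" and x p :: "nat \<Rightarrow> 'a \<Rightarrow> real^'d"
    and a be b m v :: "nat \<Rightarrow> 'a \<Rightarrow> real"
  assumes D: "convex D" "compact D" "D \<noteq> {}" and P0: "pos_def P0"
    and p: "\<And>k. p k \<in> borel_measurable (Fk k)" and b: "\<And>k. b k \<in> borel_measurable (Fk k)"
    and m: "\<And>k. m k \<in> borel_measurable (Fk k)" "\<And>k \<omega>. \<omega> \<in> space M \<Longrightarrow> 0 < m k \<omega>"
    and init: "\<And>\<omega>. \<omega> \<in> space M \<Longrightarrow> x 0 \<omega> = x0" "\<And>\<omega>. \<omega> \<in> space M \<Longrightarrow> P 0 \<omega> = P0"
    and a: "\<And>k \<omega>. \<omega> \<in> space M \<Longrightarrow> a k \<omega> = 1 / (m k \<omega> + be k \<omega> * (b k \<omega>)\<^sup>2 * qform (P k \<omega>) (p k \<omega>))"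
    and P_Suc: "\<And>k \<omega>. \<omega> \<in> space M \<Longrightarrow> P (Suc k) \<omega> =
       P k \<omega> - (a k \<omega> * be k \<omega> * (b k \<omega>)\<^sup>2) *\<^sub>R (P k \<omega> ** outer (p k \<omega>) (p k \<omega>) ** P k \<omega>)"
    and x_Suc: "\<And>k \<omega>. \<omega> \<in> space M \<Longrightarrow> x (Suc k) \<omega> =
       proj (matrix_inv (P (Suc k) \<omega>)) D (x k \<omega> + (a k \<omega> * b k \<omega> * v k \<omega>) *\<^sub>R (P k \<omega> *v p k \<omega>))"
    and be: "\<And>k. ae_adapted k (x k) \<Longrightarrow> ae_adapted k (be k)" "AE \<omega> in M. \<forall>k. 0 \<le> be k \<omega>"
    and v: "\<And>k. ae_adapted k (x k) \<Longrightarrow> ae_adapted (Suc k) (v k)"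
  shows "ae_adapted k (x k)"
proof -
  have W0: "pos_def (matrix_inv P0)" by (rule pos_def_matrix_inv(1)[OF P0])
  obtain c where c: "c > 0" "matrix_inv P0 \<in> coercive_forms c" by (rule pos_def_coercive[OF W0])
  have path: "AE \<omega> in M. \<forall>k. matrix_inv (P k \<omega>) \<in> coercive_forms c \<and>
      matrix_inv (P (Suc k) \<omega>) = matrix_inv (P k \<omega>) + (be k \<omega> * (b k \<omega>)\<^sup>2 / m k \<omega>) *\<^sub>R outer (p k \<omega>) (p k \<omega>)"
    using be(2) AE_space
  proof eventually_elim
    case (elim \<omega>)
    have s: "0 \<le> be k \<omega> * (b k \<omega>)\<^sup>2" for k using elim(1) by simp
    have P': "P (Suc k) \<omega> = P k \<omega> - (a k \<omega> * (be k \<omega> * (b k \<omega>)\<^sup>2)) *\<^sub>R (P k \<omega> ** outer (p k \<omega>) (p k \<omega>) ** P k \<omega>)" for k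
      by (simp add: P_Suc[OF elim(2)] mult.assoc)
    have pd: "pos_def (P k \<omega>)" for k
      by (induction k) (use P0 init(2)[OF elim(2)] gain_update(2)[OF _ m(2)[OF elim(2)] s a[OF elim(2)] P'] in auto)
    note G = gain_update(1)[OF pd m(2)[OF elim(2)] s a[OF elim(2)] P']
    have "matrix_inv (P k \<omega>) \<in> coercive_forms c" for k
    proof (induction k)
      case (Suc k)
      have "0 \<le> be k \<omega> * (b k \<omega>)\<^sup>2 / m k \<omega>" using s[of k] m(2)[OF elim(2), of k] by simp
      then show ?case unfolding G by (rule coercive_forms_add_outer[OF Suc])
    qed (use c init(2)[OF elim(2)] in simp)
    then show ?case using G by blast
  qed
  have AE_eq: "AE \<omega> in M. X \<omega> = Y \<omega>" if "\<And>\<omega>. \<omega> \<in> space M \<Longrightarrow> X \<omega> = Y \<omega>" for X Y :: "'a \<Rightarrow> 'z"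
    using AE_space by eventually_elim (rule that)
  have "ae_adapted k (x k) \<and> ae_adapted k (P k) \<and> ae_adapted k (\<lambda>\<omega>. matrix_inv (P k \<omega>))"
  proof (induction k)
    case 0
    have "ae_adapted 0 (x 0)"
      by (rule ae_adapted_cong[OF ae_adapted_const AE_eq]) (rule init(1))
    moreover have "ae_adapted 0 (P 0)"
      by (rule ae_adapted_cong[OF ae_adapted_const AE_eq]) (rule init(2))
    moreover have "ae_adapted 0 (\<lambda>\<omega>. matrix_inv (P 0 \<omega>))"
      by (rule ae_adapted_cong[OF ae_adapted_const[of _ "matrix_inv P0"] AE_eq]) (simp add: init(2))
    ultimately show ?case by simp
  next
    case (Suc k)
    then have X: "ae_adapted k (x k)" and Pk: "ae_adapted k (P k)"
      and W: "ae_adapted k (\<lambda>\<omega>. matrix_inv (P k \<omega>))" by auto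
    note pk = ae_adapted_measurable[OF p, of k] and bk = ae_adapted_measurable[OF b, of k]
      and mk = ae_adapted_measurable[OF m(1), of k] and bek = be(1)[OF X]
    have b2: "ae_adapted k (\<lambda>\<omega>. (b k \<omega>)\<^sup>2)"
      unfolding power2_eq_square by (rule ae_adapted_arith(3)[OF bk bk])
    have q: "ae_adapted k (\<lambda>\<omega>. qform (P k \<omega>) (p k \<omega>))"
      by (rule ae_adapted_continuous2[OF Pk pk]) (intro continuous_intros)
    have beb: "ae_adapted k (\<lambda>\<omega>. be k \<omega> * (b k \<omega>)\<^sup>2)" by (rule ae_adapted_arith(3)[OF bek b2])
    have ak: "ae_adapted k (a k)"
      by (rule ae_adapted_cong[OF ae_adapted_arith(4)[OF ae_adapted_const ae_adapted_arith(1)[OF mk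
              ae_adapted_arith(3)[OF beb q]]] AE_eq]) (rule a)
    have out: "ae_adapted k (\<lambda>\<omega>. outer (p k \<omega>) (p k \<omega>))"
      by (rule ae_adapted_continuous2[OF pk pk]) (intro continuous_intros)
    have scale: "ae_adapted j (\<lambda>\<omega>. s \<omega> *\<^sub>R A \<omega>)" if "ae_adapted j s" "ae_adapted j A"
      for j s and A :: "'a \<Rightarrow> 'z::{real_normed_vector, second_countable_topology}"
      by (rule ae_adapted_continuous2[OF that]) (intro continuous_intros)
    have add: "ae_adapted j (\<lambda>\<omega>. A \<omega> + B \<omega>)" "ae_adapted j (\<lambda>\<omega>. A \<omega> - B \<omega>)"
      if "ae_adapted j A" "ae_adapted j B"
      for j and A B :: "'a \<Rightarrow> 'z::{real_normed_vector, second_countable_topology}"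
      by (rule ae_adapted_continuous2[OF that]; intro continuous_intros)+
    have mm: "ae_adapted k (\<lambda>\<omega>. A \<omega> ** B \<omega>)" if "ae_adapted k A" "ae_adapted k B"
      for A B :: "'a \<Rightarrow> real^'d^'d"
      by (rule ae_adapted_continuous2[OF that]) (intro continuous_intros)
    have Pv: "ae_adapted k (\<lambda>\<omega>. P k \<omega> *v p k \<omega>)"
      by (rule ae_adapted_continuous2[OF Pk pk]) (intro continuous_intros)
    have "ae_adapted k (P (Suc k))"
    proof (rule ae_adapted_cong[OF _ AE_eq])
      show "ae_adapted k (\<lambda>\<omega>. P k \<omega> - (a k \<omega> * be k \<omega> * (b k \<omega>)\<^sup>2) *\<^sub>R (P k \<omega> ** outer (p k \<omega>) (p k \<omega>) ** P k \<omega>))"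
        by (intro add(2) scale ae_adapted_arith(3) mm ak bek b2 Pk out)
    qed (rule P_Suc)
    then have P': "ae_adapted (Suc k) (P (Suc k))" by (rule ae_adapted_mono) simp
    have "ae_adapted k (\<lambda>\<omega>. matrix_inv (P (Suc k) \<omega>))"
    proof (rule ae_adapted_cong)
      show "ae_adapted k (\<lambda>\<omega>. matrix_inv (P k \<omega>) + (be k \<omega> * (b k \<omega>)\<^sup>2 / m k \<omega>) *\<^sub>R outer (p k \<omega>) (p k \<omega>))"
        by (intro add(1) scale ae_adapted_arith(4) W beb mk out)
      show "AE \<omega> in M. matrix_inv (P (Suc k) \<omega>) = matrix_inv (P k \<omega>) + (be k \<omega> * (b k \<omega>)\<^sup>2 / m k \<omega>) *\<^sub>R outer (p k \<omega>) (p k \<omega>)"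
        using path by eventually_elim blast
    qed
    then have W': "ae_adapted (Suc k) (\<lambda>\<omega>. matrix_inv (P (Suc k) \<omega>))" by (rule ae_adapted_mono) simp
    have "ae_adapted (Suc k) (x (Suc k))"
    proof (rule ae_adapted_cong[OF _ AE_eq])
      show "ae_adapted (Suc k) (\<lambda>\<omega>. proj (matrix_inv (P (Suc k) \<omega>)) D
          (x k \<omega> + (a k \<omega> * b k \<omega> * v k \<omega>) *\<^sub>R (P k \<omega> *v p k \<omega>)))"
      proof (rule ae_adapted_proj[OF D c(1) W'])
        show "AE \<omega> in M. matrix_inv (P (Suc k) \<omega>) \<in> coercive_forms c"
          using path by eventually_elim blast
        show "ae_adapted (Suc k) (\<lambda>\<omega>. x k \<omega> + (a k \<omega> * b k \<omega> * v k \<omega>) *\<^sub>R (P k \<omega> *v p k \<omega>))"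
          by (intro add(1) scale ae_adapted_arith(3) v X ae_adapted_mono[OF X] ae_adapted_mono[OF ak]
              ae_adapted_mono[OF bk] ae_adapted_mono[OF Pv]) auto
      qed
    qed (rule x_Suc)
    then show ?case using P' W' by simp
  qed
  then show ?thesis by simp
qed

text \<open>Coefficients and thresholds are replaced by adapted versions and the exceptional sets
  collected. The bound for all \<open>d > 0\<close> must hold off a single null set, so it is taken
  at \<open>d = 1 / (j + 1)\<close> for all \<open>j\<close> and weakened to larger
  \<open>d\<close>.\<close>

lemma AE_innovation_noise_bound:
  fixes F :: "nat \<Rightarrow> 'a \<Rightarrow> real \<Rightarrow> real" and X t e :: "nat \<Rightarrow> 'a \<Rightarrow> real"
  assumes F: "\<And>k x. (\<lambda>\<omega>. F k \<omega> x) \<in> borel_measurable (Fk k)"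
    and cont: "\<And>k. AE \<omega> in M. continuous_on UNIV (F k \<omega>)"
    and e: "\<And>k. e k \<in> borel_measurable (Fk (Suc k))"
    and cdf: "\<And>k x. AE \<omega> in M. F k \<omega> x =
      real_cond_exp M (Fk k) (\<lambda>\<omega>. indicator {\<omega>' \<in> space M. e k \<omega>' \<le> x} \<omega>) \<omega>"
    and X: "\<And>k. ae_adapted k (X k)" and t: "\<And>k. ae_adapted k (t k)"
  shows "AE \<omega> in M. (\<forall>k. e k \<omega> \<noteq> t k \<omega>) \<and> (\<forall>d>0. \<exists>K. \<forall>\<^sub>F n in sequentially.
    (\<Sum>k<n. X k \<omega> * (F k \<omega> (t k \<omega>) - (if e k \<omega> \<le> t k \<omega> then 1 else 0)))
      \<le> d * (\<Sum>k<n. (X k \<omega>)\<^sup>2) + K * sqrt (real n))"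
proof -
  have "\<exists>Y\<in>borel_measurable (Fk k). AE \<omega> in M. X k \<omega> = Y \<omega>" for k
    using X[of k] unfolding ae_adapted_def .
  then obtain Y where Y: "\<And>k. Y k \<in> borel_measurable (Fk k)" "\<And>k. AE \<omega> in M. X k \<omega> = Y k \<omega>" by metis
  have "\<exists>s\<in>borel_measurable (Fk k). AE \<omega> in M. t k \<omega> = s \<omega>" for k
    using t[of k] unfolding ae_adapted_def .
  then obtain s where s: "\<And>k. s k \<in> borel_measurable (Fk k)" "\<And>k. AE \<omega> in M. t k \<omega> = s k \<omega>" by metis
  have eM: "e k \<in> borel_measurable M" for k by (rule measurable_Fk[OF e])
  define B where "B k \<omega> = (indicator {\<omega>' \<in> space M. e k \<omega>' \<le> s k \<omega>'} \<omega> :: real)" for k \<omega>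
  have B: "B k \<in> borel_measurable (Fk (Suc k))" for k
  proof -
    have sp: "space M = space (Fk (Suc k))" using subalg by (simp add: subalgebra_def)
    have [measurable]: "e k \<in> borel_measurable (Fk (Suc k))" "s k \<in> borel_measurable (Fk (Suc k))"
      using e measurable_Fk_mono[OF _ s(1)] by auto
    show ?thesis unfolding B_def sp by measurable
  qed
  have ce: "AE \<omega> in M. real_cond_exp M (Fk k) (B k) \<omega> = F k \<omega> (s k \<omega>)" for k
    unfolding B_def[abs_def] by (rule cond_exp_indicator_random_threshold[where F = "F k", OF F cont eM cdf s(1)])
  have ne: "AE \<omega> in M. e k \<omega> \<noteq> s k \<omega>" for k
    by (rule AE_neq_random_threshold[where F = "F k", OF F cont eM cdf s(1)])
  have bnd: "AE \<omega> in M. \<forall>j::nat. \<forall>\<^sub>F n in sequentially.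
    (\<Sum>k<n. Y k \<omega> * (real_cond_exp M (Fk k) (B k) \<omega> - B k \<omega>))
      \<le> 1 / real (Suc j) * (\<Sum>k<n. (Y k \<omega>)\<^sup>2) + sqrt (real n) / (2 * (1 / real (Suc j)))"
    by (subst AE_all_countable, intro allI AE_martingale_bound Y B) (auto simp: B_def indicator_def)
  have "AE \<omega> in M. \<forall>k. X k \<omega> = Y k \<omega> \<and> t k \<omega> = s k \<omega> \<and> e k \<omega> \<noteq> s k \<omega> \<and>
      real_cond_exp M (Fk k) (B k) \<omega> = F k \<omega> (s k \<omega>)"
    using Y(2) s(2) ne ce by (subst AE_all_countable) auto
  then show ?thesis using bnd AE_space
  proof eventually_elim
    case (elim \<omega>)
    then have eq: "X k \<omega> = Y k \<omega>" "t k \<omega> = s k \<omega>" "e k \<omega> \<noteq> s k \<omega>"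
      "real_cond_exp M (Fk k) (B k) \<omega> = F k \<omega> (s k \<omega>)" for k by auto
    have Bk: "B k \<omega> = (if e k \<omega> \<le> s k \<omega> then 1 else 0)" for k
      using elim(3) by (simp add: B_def)
    have "\<exists>K. \<forall>\<^sub>F n in sequentially. (\<Sum>k<n. Y k \<omega> * (F k \<omega> (s k \<omega>) - (if e k \<omega> \<le> s k \<omega> then 1 else 0)))
      \<le> d * (\<Sum>k<n. (Y k \<omega>)\<^sup>2) + K * sqrt (real n)" if "d > 0" for d
    proof -
      obtain j :: nat where j: "1 / real (Suc j) < d"
        using \<open>d > 0\<close> by (metis nat_approx_posE)
      have "\<forall>\<^sub>F n in sequentially. (\<Sum>k<n. Y k \<omega> * (F k \<omega> (s k \<omega>) - (if e k \<omega> \<le> s k \<omega> then 1 else 0)))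
        \<le> d * (\<Sum>k<n. (Y k \<omega>)\<^sup>2) + (real (Suc j) / 2) * sqrt (real n)"
        using elim(2)[rule_format, of j]
      proof eventually_elim
        case (elim n)
        have "1 / real (Suc j) * (\<Sum>k<n. (Y k \<omega>)\<^sup>2) \<le> d * (\<Sum>k<n. (Y k \<omega>)\<^sup>2)"
          using j by (intro mult_right_mono sum_nonneg) auto
        then show ?case using elim by (simp add: eq Bk mult.commute)
      qed
      then show ?thesis by blast
    qed
    then show ?case using eq by simp
  qed
qed

end

subsection \<open>Regret and prediction error\<close>

text \<open>Common to both steps, which differ in \<open>dissip\<close> and in the inherited
  \<open>err\<close>. Splitting the innovation into drift and centred indicator brings it into the
  form of the deterministic regret bound.\<close>

lemma saturated_regret:
  fixes P :: "nat \<Rightarrow> real^'d^'d" and x p :: "nat \<Rightarrow> real^'d"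
    and a be b m h s e err l u y :: "nat \<Rightarrow> real" and F :: "nat \<Rightarrow> real \<Rightarrow> real"
  assumes h: "\<And>k. h k = p k \<bullet> (t - x k)"
    and s: "\<And>k. s k = sat (l k) (u k) (l k) (u k) (p k \<bullet> x k) - p k \<bullet> t"
    and P0: "pos_def (P 0)"
    and be: "\<And>k. c \<le> be k" "0 < c"
    and b: "\<And>k. 0 \<le> b k" "\<And>k. b k \<le> 1"
    and m: "\<And>k. m0 \<le> m k" "\<And>k. m k \<le> m1" "0 < m0"
    and p: "\<And>k. norm (p k) \<le> K"
    and a: "\<And>k. a k = 1 / (m k + be k * (b k)\<^sup>2 * qform (P k) (p k))"
    and P_Suc: "\<And>k. P (Suc k) = P k - (a k * be k * (b k)\<^sup>2) *\<^sub>R (P k ** outer (p k) (p k) ** P k)"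
    and x_Suc: "\<And>k. x (Suc k) = proj (matrix_inv (P (Suc k))) D (x k +
        (a k * b k * innov (F k) (l k) (u k) (l k) (u k) (y k) (p k \<bullet> x k)) *\<^sub>R (P k *v p k))"
    and D: "convex D" "compact D" "t \<in> D"
    and lu: "\<And>k. l k < u k" and F01: "\<And>k r. 0 \<le> F k r" "\<And>k r. F k r \<le> 1"
    and y: "\<And>k. y k = sat (l k) (u k) (l k) (u k) (p k \<bullet> t + e k)"
    and ne: "\<And>k. e k \<noteq> s k"
    and dissip: "\<And>k. be k * (b k)\<^sup>2 * (h k)\<^sup>2 - 2 * b k * h k * drift (F k) (l k) (u k) (p k \<bullet> x k) (p k \<bullet> t)
        \<le> - kap * (h k)\<^sup>2 + K2 * (err k)\<^sup>2" and kap: "kap > 0" "K2 \<ge> 0"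
    and err: "\<exists>K3. \<forall>\<^sub>F n in sequentially. (\<Sum>k<n. (err k)\<^sup>2) \<le> K3 * sqrt (real n)"
    and mart: "\<And>d. d > 0 \<Longrightarrow> \<exists>K. \<forall>\<^sub>F n in sequentially.
      (\<Sum>k<n. - (b k * h k * noise_gain (l k) (u k) (p k \<bullet> x k) / m k) * (F k (s k) - (if e k \<le> s k then 1 else 0)))
      \<le> d * (\<Sum>k<n. (- (b k * h k * noise_gain (l k) (u k) (p k \<bullet> x k) / m k))\<^sup>2) + K * sqrt (real n)"
  shows "\<exists>K. \<forall>\<^sub>F n in sequentially. (\<Sum>k<n. (h k)\<^sup>2) \<le> K * sqrt (real n)"
proof -
  define g where "g k = noise_gain (l k) (u k) (p k \<bullet> x k)" for k
  define w where "w k = F k (s k) - (if e k \<le> s k then 1 else 0)" for k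
  have innov: "innov (F k) (l k) (u k) (l k) (u k) (y k) (p k \<bullet> x k)
      = drift (F k) (l k) (u k) (p k \<bullet> x k) (p k \<bullet> t) + g k * w k" for k
    unfolding y g_def w_def s by (rule innov_decomposition[OF lu ne[unfolded s]])
  have g: "0 \<le> g k" "g k \<le> 2" for k using noise_gain_range[of "l k" "u k" "p k \<bullet> x k"] by (auto simp: g_def)
  have X2: "(- (b k * h k * g k / m k))\<^sup>2 \<le> 4 / m0\<^sup>2 * (h k)\<^sup>2" for k
  proof -
    have mk: "m k > 0" using m(1)[of k] m(3) by linarith
    have "b k * g k \<le> 1 * 2" using b g by (intro mult_mono) auto
    then have "b k * g k / m k \<le> 2 / m0" using m(1)[of k] m(3) mk by (intro frac_le) auto
    moreover have "0 \<le> b k * g k / m k" using b[of k] g[of k] mk by simp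
    ultimately have "(b k * g k / m k)\<^sup>2 \<le> (2 / m0)\<^sup>2" by (rule power_mono)
    then have "(b k * g k / m k)\<^sup>2 * (h k)\<^sup>2 \<le> (2 / m0)\<^sup>2 * (h k)\<^sup>2" by (intro mult_right_mono) auto
    then show ?thesis by (simp add: power_divide power_mult_distrib mult_ac)
  qed
  show ?thesis
  proof (rule regret_sqrt[where P = P and be = be and b = b and m = m and v = "\<lambda>k. innov (F k) (l k) (u k) (l k) (u k) (y k) (p k \<bullet> x k)"
        and z = "\<lambda>k. b k * h k * (g k * w k)" and e = err and h = h and x = x and p = p and a = a and t = t])
    show "be k * (b k)\<^sup>2 * (h k)\<^sup>2 - 2 * b k * h k * innov (F k) (l k) (u k) (l k) (u k) (y k) (p k \<bullet> x k)
        \<le> - kap * (h k)\<^sup>2 + K2 * (err k)\<^sup>2 - 2 * (b k * h k * (g k * w k))" for k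
      using dissip[of k] unfolding innov by (simp add: algebra_simps)
    show "\<bar>innov (F k) (l k) (u k) (l k) (u k) (y k) (p k \<bullet> x k)\<bar> \<le> 2" for k
      by (intro abs_innov_le_2 F01 lu)
    show "\<exists>K4. \<forall>\<^sub>F n in sequentially. - (\<Sum>k<n. b k * h k * (g k * w k) / m k)
        \<le> d * (\<Sum>k<n. (h k)\<^sup>2) + K4 * sqrt (real n)" if "d > 0" for d
    proof -
      \<comment> \<open>The martingale coefficients are at most \<open>2 / m0\<close> times
        \<open>\<bar>h k\<bar>\<close>, since weights are at most 1 and noise gains at most 2; the
        factor \<open>m0^2 / 4\<close> compensates the square of this.\<close>
      define d' where "d' = d * m0\<^sup>2 / 4"
      have "d' > 0" using that m(3) by (simp add: d'_def)
      from mart[OF this] obtain K where K: "\<forall>\<^sub>F n in sequentially.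
        (\<Sum>k<n. - (b k * h k * g k / m k) * w k) \<le> d' * (\<Sum>k<n. (- (b k * h k * g k / m k))\<^sup>2) + K * sqrt (real n)"
        unfolding g_def w_def by blast
      have "\<forall>\<^sub>F n in sequentially. - (\<Sum>k<n. b k * h k * (g k * w k) / m k)
        \<le> d * (\<Sum>k<n. (h k)\<^sup>2) + K * sqrt (real n)"
        using K
      proof eventually_elim
        case (elim n)
        have "(\<Sum>k<n. (- (b k * h k * g k / m k))\<^sup>2) \<le> (\<Sum>k<n. 4 / m0\<^sup>2 * (h k)\<^sup>2)"
          by (intro sum_mono X2)
        then have "d' * (\<Sum>k<n. (- (b k * h k * g k / m k))\<^sup>2) \<le> d' * (4 / m0\<^sup>2 * (\<Sum>k<n. (h k)\<^sup>2))"
          using \<open>d' > 0\<close> by (intro mult_left_mono) (auto simp: sum_distrib_left)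
        also have "\<dots> = d * (\<Sum>k<n. (h k)\<^sup>2)" using m(3) by (simp add: d'_def)
        finally have le: "d' * (\<Sum>k<n. (- (b k * h k * g k / m k))\<^sup>2) \<le> d * (\<Sum>k<n. (h k)\<^sup>2)" .
        have "- (\<Sum>k<n. b k * h k * (g k * w k) / m k) = (\<Sum>k<n. - (b k * h k * g k / m k) * w k)"
          by (simp add: sum_negf mult_ac)
        then show ?case using elim le by linarith
      qed
      then show ?thesis by blast
    qed
  qed (rule P0 be b m p a P_Suc x_Suc D h kap err)+
qed

text \<open>\<open>ln (ln n)\<close> is eventually at least 1, so the stated rate is no smaller than
  \<open>n powr (-1/4)\<close>.\<close>

lemma root4_loglog_ge:
  "\<forall>\<^sub>F n in sequentially. real n powr (3 / 4) / real n \<le> root 4 (ln (ln (real n)) / real n)"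
proof -
  have "\<forall>\<^sub>F n in sequentially. 1 \<le> ln (ln (real n))" by real_asymp
  then show ?thesis using eventually_ge_at_top[of 1]
  proof eventually_elim
    case (elim n)
    have n: "real n > 0" using elim(2) by simp
    have "real n powr (3 / 4) / real n = real n powr (- (1 / 4))"
      using n powr_diff[of "real n" "3 / 4" 1] by simp
    also have "\<dots> = (1 / real n) powr (1 / 4)" using n by (simp add: powr_minus powr_divide divide_simps)
    also have "\<dots> = root 4 (1 / real n)" using n by (subst root_powr_inverse) auto
    also have "\<dots> \<le> root 4 (ln (ln (real n)) / real n)"
      using elim(1) n by (intro real_root_le_mono divide_right_mono) auto
    finally show ?case .
  qed
qed

lemma prediction_error_from_regret:
  fixes b h e s2 d :: "nat \<Rightarrow> real"
  assumes regret: "\<exists>K. \<forall>\<^sub>F n in sequentially. (\<Sum>k<n. (h k)\<^sup>2) \<le> K * sqrt (real n)"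
    and noise: "\<exists>K. \<forall>\<^sub>F n in sequentially. (\<Sum>k<n. b k * \<bar>e k\<bar>)
      \<le> sqrt (real n * (\<Sum>k<n. (b k)\<^sup>2 * s2 k)) + K * real n powr (3 / 4)"
    and b: "\<And>k. 0 \<le> b k" "\<And>k. b k \<le> 1"
    and d: "\<And>k. \<bar>d k\<bar> \<le> \<bar>h k\<bar> + \<bar>e k\<bar>"
  shows "\<exists>K. \<forall>\<^sub>F n in sequentially. (\<Sum>k<n. b k * \<bar>d k\<bar>) / real n
    \<le> sqrt ((\<Sum>k<n. (b k)\<^sup>2 * s2 k) / real n) + K * root 4 (ln (ln (real n)) / real n)"
proof -
  obtain K1 where K1: "\<forall>\<^sub>F n in sequentially. (\<Sum>k<n. (h k)\<^sup>2) \<le> K1 * sqrt (real n)"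
    using regret by blast
  obtain K2 where K2: "\<forall>\<^sub>F n in sequentially. (\<Sum>k<n. b k * \<bar>e k\<bar>)
      \<le> sqrt (real n * (\<Sum>k<n. (b k)\<^sup>2 * s2 k)) + K2 * real n powr (3 / 4)"
    using noise by blast
  have "\<forall>\<^sub>F n in sequentially. (\<Sum>k<n. b k * \<bar>d k\<bar>) / real n
    \<le> sqrt ((\<Sum>k<n. (b k)\<^sup>2 * s2 k) / real n) + (sqrt \<bar>K1\<bar> + \<bar>K2\<bar>) * root 4 (ln (ln (real n)) / real n)"
    using K1 K2 root4_loglog_ge eventually_ge_at_top[of 1]
  proof eventually_elim
    case (elim n)
    let ?S = "\<Sum>k<n. (b k)\<^sup>2 * s2 k"
    have n: "real n > 0" using elim(4) by simp
    have "(\<Sum>k<n. b k * \<bar>d k\<bar>) \<le> (\<Sum>k<n. \<bar>h k\<bar> + b k * \<bar>e k\<bar>)"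
    proof (rule sum_mono)
      fix k
      have "b k * \<bar>d k\<bar> \<le> b k * (\<bar>h k\<bar> + \<bar>e k\<bar>)" by (intro mult_left_mono d b)
      also have "\<dots> \<le> \<bar>h k\<bar> + b k * \<bar>e k\<bar>"
        using b[of k] by (simp add: distrib_left mult_left_le_one_le)
      finally show "b k * \<bar>d k\<bar> \<le> \<bar>h k\<bar> + b k * \<bar>e k\<bar>" .
    qed
    also have "\<dots> = (\<Sum>k<n. \<bar>h k\<bar>) + (\<Sum>k<n. b k * \<bar>e k\<bar>)" by (rule sum.distrib)
    \<comment> \<open>Cauchy-Schwarz against \<open>n\<close> ones turns a bound of order
      \<open>sqrt n\<close> on the squares into \<open>sqrt (n * sqrt n) = n powr (3/4)\<close>, the
      order of the noise fluctuation. Nothing fixes the sign of \<open>K1\<close>, hence the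
      absolute value.\<close>
    also have "(\<Sum>k<n. \<bar>h k\<bar>) \<le> sqrt \<bar>K1\<bar> * real n powr (3 / 4)"
    proof -
      have "(\<Sum>k<n. \<bar>h k\<bar>) \<le> sqrt (real n * (\<Sum>k<n. \<bar>h k\<bar>\<^sup>2))" by (rule sum_le_sqrt_card)
      also have "\<dots> \<le> sqrt (real n * (\<bar>K1\<bar> * sqrt (real n)))"
      proof (intro real_sqrt_le_mono mult_left_mono)
        have "K1 * sqrt (real n) \<le> \<bar>K1\<bar> * sqrt (real n)" by (intro mult_right_mono) auto
        then show "(\<Sum>k<n. \<bar>h k\<bar>\<^sup>2) \<le> \<bar>K1\<bar> * sqrt (real n)" using elim(1) by simp
      qed auto
      also have "\<dots> = sqrt \<bar>K1\<bar> * sqrt (real n * sqrt (real n))"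
        by (simp add: real_sqrt_mult)
      also have "real n * sqrt (real n) = real n powr (3 / 2)"
        using n powr_add[of "real n" 1 "1 / 2"] by (simp add: powr_half_sqrt)
      also have "sqrt (real n powr (3 / 2)) = real n powr (3 / 4)"
        using n by (simp add: powr_half_sqrt[symmetric] powr_powr)
      finally show ?thesis .
    qed
    also have "(\<Sum>k<n. b k * \<bar>e k\<bar>) \<le> sqrt (real n * ?S) + \<bar>K2\<bar> * real n powr (3 / 4)"
    proof -
      have "K2 * real n powr (3 / 4) \<le> \<bar>K2\<bar> * real n powr (3 / 4)" by (intro mult_right_mono) auto
      then show ?thesis using elim(2) by linarith
    qed
    finally have "(\<Sum>k<n. b k * \<bar>d k\<bar>) \<le> sqrt (real n * ?S) + (sqrt \<bar>K1\<bar> + \<bar>K2\<bar>) * real n powr (3 / 4)"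
      by (simp add: distrib_right)
    then have "(\<Sum>k<n. b k * \<bar>d k\<bar>) / real n
        \<le> (sqrt (real n * ?S) + (sqrt \<bar>K1\<bar> + \<bar>K2\<bar>) * real n powr (3 / 4)) / real n"
      using n by (intro divide_right_mono) auto
    also have "\<dots> = sqrt (real n * ?S) / real n + (sqrt \<bar>K1\<bar> + \<bar>K2\<bar>) * (real n powr (3 / 4) / real n)"
      by (simp add: add_divide_distrib)
    also have "sqrt (real n * ?S) / real n = sqrt (?S / real n)"
    proof -
      have "sqrt (?S / real n) = sqrt ((real n * ?S) / (real n * real n))" using n by simp
      also have "\<dots> = sqrt (real n * ?S) / sqrt (real n * real n)" by (rule real_sqrt_divide)
      also have "sqrt (real n * real n) = real n" by simp
      finally show ?thesis by (rule sym)
    qed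
    also have "(sqrt \<bar>K1\<bar> + \<bar>K2\<bar>) * (real n powr (3 / 4) / real n)
        \<le> (sqrt \<bar>K1\<bar> + \<bar>K2\<bar>) * root 4 (ln (ln (real n)) / real n)"
      using elim(3) by (intro mult_left_mono) auto
    finally show ?case by simp
  qed
  then show ?thesis by blast
qed

text \<open>Bounds at fixed arguments hold off one null set each; the rationals cost countably many,
  and continuity supplies the rest.\<close>

lemma continuous_unit_interval_from_rationals:
  fixes F :: "real \<Rightarrow> real"
  assumes "continuous_on UNIV F" "\<And>q. q \<in> \<rat> \<Longrightarrow> 0 \<le> F q \<and> F q \<le> 1"
  shows "0 \<le> F x \<and> F x \<le> 1"
proof -
  have "closed {x. 0 \<le> F x}" "closed {x. F x \<le> 1}"
    by (intro closed_Collect_le continuous_intros assms)+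
  then have "closed ({x. 0 \<le> F x} \<inter> {x. F x \<le> 1})" by (rule closed_Int)
  moreover have "\<rat> \<subseteq> {x. 0 \<le> F x} \<inter> {x. F x \<le> 1}" using assms(2) by auto
  ultimately have "closure \<rat> \<subseteq> {x. 0 \<le> F x} \<inter> {x. F x \<le> 1}" by (rule closure_minimal[rotated])
  then show ?thesis by (auto simp: Rats_closure_real)
qed

theorem theorem3:
  fixes M :: "'a measure" and Fk :: "nat \<Rightarrow> 'a measure"
    and phi :: "nat \<Rightarrow> 'a \<Rightarrow> real^'d" and theta :: "real^'d"
    and eps y :: "nat \<Rightarrow> 'a \<Rightarrow> real"
    and l u L U b Ck :: "nat \<Rightarrow> 'a \<Rightarrow> real"
    and Mb r :: real and D :: "(real^'d) set"
    and Fd fd :: "nat \<Rightarrow> 'a \<Rightarrow> real \<Rightarrow> real"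
    and thb0 th0 :: "real^'d" and Pb0 P0 :: "real^'d^'d"
    and mub mu ab a betab beta :: "nat \<Rightarrow> 'a \<Rightarrow> real"
    and thb th :: "nat \<Rightarrow> 'a \<Rightarrow> real^'d" and Pb P :: "nat \<Rightarrow> 'a \<Rightarrow> real^'d^'d"
  assumes prob: "prob_space M"
    and filt: "filtration (space M) Fk" and subalg: "\<And>k. subalgebra M (Fk k)"
    \<comment> \<open>observation model\<close>
    and model: "\<And>k \<omega>. \<omega> \<in> space M \<Longrightarrow>
         y (Suc k) \<omega> = sat (l k \<omega>) (u k \<omega>) (L k \<omega>) (U k \<omega>) (phi k \<omega> \<bullet> theta + eps (Suc k) \<omega>)"
    \<comment> \<open>A1\<close>
    and phi_meas: "\<And>k. phi k \<in> borel_measurable (Fk k)"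
    and phi_bdd: "\<And>\<omega>. \<omega> \<in> space M \<Longrightarrow> bounded (range (\<lambda>k. phi k \<omega>))"
    and D: "convex D" "compact D" "theta \<in> interior D"
    and Ck_meas: "\<And>k. Ck k \<in> borel_measurable (Fk k)"
    and Ck_ge: "\<And>k \<omega> x. \<omega> \<in> space M \<Longrightarrow> x \<in> D \<Longrightarrow> \<bar>phi k \<omega> \<bullet> x\<bar> \<le> Ck k \<omega>"
    and Ck_bdd: "\<And>\<omega>. \<omega> \<in> space M \<Longrightarrow> bounded (range (\<lambda>k. Ck k \<omega>))"
    \<comment> \<open>A2\<close>
    and l_meas: "\<And>k. l k \<in> borel_measurable (Fk k)"
    and u_meas: "\<And>k. u k \<in> borel_measurable (Fk k)"
    and L_meas: "\<And>k. L k \<in> borel_measurable (Fk k)"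
    and U_meas: "\<And>k. U k \<in> borel_measurable (Fk k)"
    and order: "AE \<omega> in M. \<forall>k. L k \<omega> \<le> l k \<omega> \<and> l k \<omega> \<le> u k \<omega> \<and> u k \<omega> \<le> U k \<omega>"
    and Mb: "AE \<omega> in M. \<forall>k. max (l k \<omega>) (- u k \<omega>) \<le> Mb"
    and nondeg: "AE \<omega> in M. \<forall>k. \<not> (L k \<omega> = l k \<omega> \<and> l k \<omega> = u k \<omega> \<and> u k \<omega> = U k \<omega>)"
    and b_meas: "\<And>k. b k \<in> borel_measurable (Fk k)"
    and b_bdd: "\<And>\<omega>. \<omega> \<in> space M \<Longrightarrow> \<exists>c>0. \<forall>k. c \<le> b k \<omega> \<and> b k \<omega> \<le> 1"
    \<comment> \<open>A3: Fd k, fd k are the conditional cdf F_{k+1} and density f_{k+1} of eps (k+1) given Fk k\<close>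
    and Fd_meas: "\<And>k x. (\<lambda>\<omega>. Fd k \<omega> x) \<in> borel_measurable (Fk k)"
    and fd_meas: "\<And>k x. (\<lambda>\<omega>. fd k \<omega> x) \<in> borel_measurable (Fk k)"
    and Fd_cond: "\<And>k x. AE \<omega> in M. Fd k \<omega> x =
         real_cond_exp M (Fk k) (\<lambda>\<omega>. indicator {\<omega>' \<in> space M. eps (Suc k) \<omega>' \<le> x} \<omega> :: real) \<omega>"
    and Fd_dens: "\<And>k. AE \<omega> in M. continuous_on UNIV (fd k \<omega>) \<and>
         (\<forall>x. (Fd k \<omega> has_real_derivative fd k \<omega> x) (at x))"
    and Fd_med: "\<And>k. AE \<omega> in M. Fd k \<omega> 0 = 1 / 2"
    and fd_bnd: "\<exists>C. (\<forall>k. \<forall>\<omega>\<in>space M. Ck k \<omega> \<le> C) \<and>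
         (AE \<omega> in M. (\<exists>c>0. \<forall>k x. \<bar>x\<bar> \<le> max (2 * C) (C + Mb) \<longrightarrow> c \<le> fd k \<omega> x) \<and>
                      (\<exists>c'. \<forall>k x. \<bar>x\<bar> \<le> max (2 * C) (C + Mb) \<longrightarrow> fd k \<omega> x \<le> c'))"
    \<comment> \<open>continuous saturation\<close>
    and cont_sat: "\<And>k \<omega>. L k \<omega> = l k \<omega> \<and> U k \<omega> = u k \<omega>"
    \<comment> \<open>martingale difference noise with bounded conditional r-th moment, r > 4\<close>
    and eps_meas: "\<And>k. eps k \<in> borel_measurable (Fk k)"
    and eps_int: "\<And>k. integrable M (eps k)"
    and mds: "\<And>k. AE \<omega> in M. real_cond_exp M (Fk k) (eps (Suc k)) \<omega> = 0"
    and r: "r > 4"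
    and moment: "AE \<omega> in M. (SUP k. nn_cond_exp M (Fk k) (\<lambda>\<omega>. ennreal (\<bar>eps (Suc k) \<omega>\<bar> powr r)) \<omega>) < \<infinity>"
    \<comment> \<open>TSWLAD step 1\<close>
    and thb0: "thb0 \<in> D" and Pb0: "pos_def Pb0"
    and mub_meas: "\<And>k. mub k \<in> borel_measurable (Fk k)"
    and mub_bdd: "\<And>\<omega>. \<omega> \<in> space M \<Longrightarrow> \<exists>c>0. \<exists>c'. \<forall>k. c \<le> mub k \<omega> \<and> mub k \<omega> \<le> c'"
    and thb_0: "\<And>\<omega>. \<omega> \<in> space M \<Longrightarrow> thb 0 \<omega> = thb0"
    and Pb_0: "\<And>\<omega>. \<omega> \<in> space M \<Longrightarrow> Pb 0 \<omega> = Pb0"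
    and betab_def: "\<And>k \<omega>. \<omega> \<in> space M \<Longrightarrow> betab k \<omega> =
         (INF x\<in>{x. \<bar>x\<bar> \<le> max (2 * Ck k \<omega>) (max (Ck k \<omega> + l k \<omega>) (Ck k \<omega> - u k \<omega>))}. fd k \<omega> x)"
    and ab_def: "\<And>k \<omega>. \<omega> \<in> space M \<Longrightarrow> ab k \<omega> =
         1 / (mub k \<omega> + betab k \<omega> * (b k \<omega>)\<^sup>2 * qform (Pb k \<omega>) (phi k \<omega>))"
    and Pb_Suc: "\<And>k \<omega>. \<omega> \<in> space M \<Longrightarrow> Pb (Suc k) \<omega> =
         Pb k \<omega> - (ab k \<omega> * betab k \<omega> * (b k \<omega>)\<^sup>2) *\<^sub>R
                    (Pb k \<omega> ** outer (phi k \<omega>) (phi k \<omega>) ** Pb k \<omega>)"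
    and thb_Suc: "\<And>k \<omega>. \<omega> \<in> space M \<Longrightarrow> thb (Suc k) \<omega> =
         proj (matrix_inv (Pb (Suc k) \<omega>)) D
           (thb k \<omega> + (ab k \<omega> * b k \<omega> *
               innov (Fd k \<omega>) (l k \<omega>) (u k \<omega>) (L k \<omega>) (U k \<omega>) (y (Suc k) \<omega>) (phi k \<omega> \<bullet> thb k \<omega>))
              *\<^sub>R (Pb k \<omega> *v phi k \<omega>))"
    \<comment> \<open>TSWLAD step 2\<close>
    and th0: "th0 \<in> D" and P0: "pos_def P0"
    and mu_meas: "\<And>k. mu k \<in> borel_measurable (Fk k)"
    and mu_bdd: "\<And>\<omega>. \<omega> \<in> space M \<Longrightarrow> \<exists>c>0. \<exists>c'. \<forall>k. c \<le> mu k \<omega> \<and> mu k \<omega> \<le> c'"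
    and th_0: "\<And>\<omega>. \<omega> \<in> space M \<Longrightarrow> th 0 \<omega> = th0"
    and P_0: "\<And>\<omega>. \<omega> \<in> space M \<Longrightarrow> P 0 \<omega> = P0"
    and beta_def: "\<And>k \<omega>. \<omega> \<in> space M \<Longrightarrow> beta k \<omega> =
         beta2 (Fd k \<omega>) (fd k \<omega>) (l k \<omega>) (u k \<omega>) (L k \<omega>) (U k \<omega>)
               (phi k \<omega> \<bullet> th k \<omega>) (phi k \<omega> \<bullet> thb k \<omega>)"
    and a_def: "\<And>k \<omega>. \<omega> \<in> space M \<Longrightarrow> a k \<omega> =
         1 / (mu k \<omega> + beta k \<omega> * (b k \<omega>)\<^sup>2 * qform (P k \<omega>) (phi k \<omega>))"
    and P_Suc: "\<And>k \<omega>. \<omega> \<in> space M \<Longrightarrow> P (Suc k) \<omega> =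
         P k \<omega> - (a k \<omega> * beta k \<omega> * (b k \<omega>)\<^sup>2) *\<^sub>R
                   (P k \<omega> ** outer (phi k \<omega>) (phi k \<omega>) ** P k \<omega>)"
    and th_Suc: "\<And>k \<omega>. \<omega> \<in> space M \<Longrightarrow> th (Suc k) \<omega> =
         proj (matrix_inv (P (Suc k) \<omega>)) D
           (th k \<omega> + (a k \<omega> * b k \<omega> *
               innov (Fd k \<omega>) (l k \<omega>) (u k \<omega>) (L k \<omega>) (U k \<omega>) (y (Suc k) \<omega>) (phi k \<omega> \<bullet> th k \<omega>))
              *\<^sub>R (P k \<omega> *v phi k \<omega>))"
  shows "AE \<omega> in M. \<exists>K. \<forall>\<^sub>F n in sequentially.
           (\<Sum>k<n. b k \<omega> * \<bar>y (Suc k) \<omega> - sat (l k \<omega>) (u k \<omega>) (L k \<omega>) (U k \<omega>) (phi k \<omega> \<bullet> th k \<omega>)\<bar>) / real n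
           \<le> sqrt ((\<Sum>k<n. (b k \<omega>)\<^sup>2 * real_cond_exp M (Fk k) (\<lambda>\<omega>'. (eps (Suc k) \<omega>')\<^sup>2) \<omega>) / real n)
             + K * root 4 (ln (ln (real n)) / real n)"
proof -
  interpret filtered_prob_space M Fk
    by (intro filtered_prob_space.intro filtered_prob_space_axioms.intro prob filt subalg)
  have L: "L k = l k" "U k = u k" for k using cont_sat by auto
  have D': "theta \<in> D" "D \<noteq> {}" using D(3) interior_subset by auto
  define R where "R k \<omega> = max (2 * Ck k \<omega>) (max (Ck k \<omega> + l k \<omega>) (Ck k \<omega> - u k \<omega>))" for k \<omega>
  have betab_eq: "betab k \<omega> = (INF x\<in>{x. \<bar>x\<bar> \<le> R k \<omega>}. fd k \<omega> x)" if "\<omega> \<in> space M" for k \<omega>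
    unfolding R_def by (rule betab_def[OF that])
  obtain C where C: "\<And>k \<omega>. \<omega> \<in> space M \<Longrightarrow> Ck k \<omega> \<le> C"
    and f_bounds: "AE \<omega> in M. (\<exists>c>0. \<forall>k x. \<bar>x\<bar> \<le> max (2 * C) (C + Mb) \<longrightarrow> c \<le> fd k \<omega> x) \<and>
      (\<exists>c'. \<forall>k x. \<bar>x\<bar> \<le> max (2 * C) (C + Mb) \<longrightarrow> fd k \<omega> x \<le> c')"
    using fd_bnd by blast
  have Ck0: "0 \<le> Ck k \<omega>" if "\<omega> \<in> space M" for k \<omega>
    using Ck_ge[OF that D'(1), of k] by linarith
  have m0: "0 < mub k \<omega>" "0 < mu k \<omega>" if "\<omega> \<in> space M" for k \<omega>
    using mub_bdd[OF that] mu_bdd[OF that] less_le_trans by blast+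
  have epsM: "eps k \<in> borel_measurable M" for k by (rule measurable_Fk[OF eps_meas])
  have f_cont: "AE \<omega> in M. continuous_on UNIV (fd k \<omega>)" for k
    using Fd_dens[of k] by eventually_elim blast
  have F_cont: "AE \<omega> in M. continuous_on UNIV (Fd k \<omega>)" for k
    using Fd_dens[of k]
    by eventually_elim (auto simp: continuous_on_eq_continuous_at intro: DERIV_isCont)
  have F01: "AE \<omega> in M. \<forall>x. 0 \<le> Fd k \<omega> x \<and> Fd k \<omega> x \<le> 1" for k
  proof -
    have "AE \<omega> in M. 0 \<le> Fd k \<omega> x \<and> Fd k \<omega> x \<le> 1" for x
    proof -
      define I where "I \<omega> = (indicator {\<omega>' \<in> space M. eps (Suc k) \<omega>' \<le> x} \<omega> :: real)" for \<omega>
      have "I \<in> borel_measurable M" unfolding I_def using epsM[of "Suc k"] by measurable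
      then have "AE \<omega> in M. 0 \<le> real_cond_exp M (Fk k) I \<omega> \<and> real_cond_exp M (Fk k) I \<omega> \<le> 1"
        by (rule cond_exp_unit_interval) (auto simp: I_def indicator_def)
      moreover have "AE \<omega> in M. Fd k \<omega> x = real_cond_exp M (Fk k) I \<omega>"
        unfolding I_def by (rule Fd_cond)
      ultimately show ?thesis by eventually_elim simp
    qed
    then have "AE \<omega> in M. \<forall>q\<in>\<rat>. 0 \<le> Fd k \<omega> q \<and> Fd k \<omega> q \<le> 1"
      by (subst AE_ball_countable) (use countable_rat in auto)
    then show ?thesis using F_cont[of k]
    proof eventually_elim
      case (elim \<omega>)
      show ?case
        by (rule allI, rule continuous_unit_interval_from_rationals[OF elim(2)]) (use elim(1) in blast)
    qed
  qed
  have basic: "AE \<omega> in M. \<forall>k. l k \<omega> < u k \<omega> \<and> (\<forall>x. (Fd k \<omega> has_real_derivative fd k \<omega> x) (at x))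
      \<and> Fd k \<omega> 0 = 1 / 2 \<and> (\<forall>x. 0 \<le> Fd k \<omega> x \<and> Fd k \<omega> x \<le> 1)
      \<and> R k \<omega> \<le> max (2 * C) (C + Mb)"
  proof (subst AE_all_countable, intro allI)
    fix k
    show "AE \<omega> in M. l k \<omega> < u k \<omega> \<and> (\<forall>x. (Fd k \<omega> has_real_derivative fd k \<omega> x) (at x))
      \<and> Fd k \<omega> 0 = 1 / 2 \<and> (\<forall>x. 0 \<le> Fd k \<omega> x \<and> Fd k \<omega> x \<le> 1)
      \<and> R k \<omega> \<le> max (2 * C) (C + Mb)"
      using Fd_dens[of k] Fd_med[of k] F01[of k] order Mb nondeg AE_space
    proof eventually_elim
      case (elim \<omega>)
      have lu: "l k \<omega> \<le> u k \<omega>" "max (l k \<omega>) (- u k \<omega>) \<le> Mb" using elim(4,5) by blast+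
      \<comment> \<open>With \<open>L = l\<close> and \<open>U = u\<close>, nondegeneracy says
        exactly that the two thresholds differ; their order then makes the inequality
        strict.\<close>
      have "l k \<omega> \<noteq> u k \<omega>" using elim(6)[rule_format, of k] by (simp add: L)
      \<comment> \<open>Places the radius used on this path inside the interval on which A3 bounds
        the density.\<close>
      moreover have "R k \<omega> \<le> max (2 * C) (C + Mb)"
        using C[OF elim(7), of k] lu by (auto simp: R_def)
      ultimately show ?case using elim(1-3) lu(1) by simp
    qed
  qed
  have R0: "0 \<le> R k \<omega>" if "\<omega> \<in> space M" for k \<omega>
    using Ck0[OF that, of k] by (simp add: R_def)
  have betab_lower: "AE \<omega> in M. \<forall>k. 0 \<le> betab k \<omega>"
    and f_nonneg: "AE \<omega> in M. \<forall>k x. \<bar>x\<bar> \<le> R k \<omega> \<longrightarrow> 0 \<le> fd k \<omega> x"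
  proof -
    have "AE \<omega> in M. (\<forall>k. 0 \<le> betab k \<omega>) \<and> (\<forall>k x. \<bar>x\<bar> \<le> R k \<omega> \<longrightarrow> 0 \<le> fd k \<omega> x)"
      using f_bounds basic AE_space
    proof eventually_elim
      case (elim \<omega>)
      then obtain c where "c > 0" and c: "\<And>k x. \<bar>x\<bar> \<le> max (2 * C) (C + Mb) \<Longrightarrow> c \<le> fd k \<omega> x" by blast
      have nonneg: "0 \<le> fd k \<omega> x" if "\<bar>x\<bar> \<le> R k \<omega>" for k x
        using c[of x k] elim(2)[rule_format, of k] that \<open>c > 0\<close> by linarith
      moreover have "0 \<le> betab k \<omega>" for k
        unfolding betab_eq[OF elim(3)]
        by (rule cINF_greatest) (use nonneg R0[OF elim(3), of k] in \<open>auto intro: exI[of _ 0]\<close>)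
      ultimately show ?case by blast
    qed
    then show "AE \<omega> in M. \<forall>k. 0 \<le> betab k \<omega>" "AE \<omega> in M. \<forall>k x. \<bar>x\<bar> \<le> R k \<omega> \<longrightarrow> 0 \<le> fd k \<omega> x"
      by (auto elim: eventually_mono)
  qed
  note ad = ae_adapted_measurable[OF l_meas] ae_adapted_measurable[OF u_meas]
    ae_adapted_measurable[OF L_meas] ae_adapted_measurable[OF U_meas]
  have ad_Suc: "ae_adapted (Suc k) (l k)" "ae_adapted (Suc k) (u k)" "ae_adapted (Suc k) (L k)"
    "ae_adapted (Suc k) (U k)" for k
    by (rule ae_adapted_mono[OF ad(1)] ae_adapted_mono[OF ad(2)] ae_adapted_mono[OF ad(3)]
        ae_adapted_mono[OF ad(4)], simp)+
  have inner: "ae_adapted k (\<lambda>\<omega>. phi k \<omega> \<bullet> X \<omega>)" if "ae_adapted k X" for k X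
    by (rule ae_adapted_continuous2[OF ae_adapted_measurable[OF phi_meas] that]) (intro continuous_intros)
  have y_ad: "ae_adapted (Suc k) (y (Suc k))" for k
  proof (rule ae_adapted_cong)
    have "ae_adapted (Suc k) (\<lambda>\<omega>. phi k \<omega> \<bullet> theta)"
      by (rule ae_adapted_mono[OF inner[OF ae_adapted_const]]) simp
    then have "ae_adapted (Suc k) (\<lambda>\<omega>. phi k \<omega> \<bullet> theta + eps (Suc k) \<omega>)"
      by (rule ae_adapted_arith(1)[OF _ ae_adapted_measurable[OF eps_meas]])
    then show "ae_adapted (Suc k) (\<lambda>\<omega>. sat (l k \<omega>) (u k \<omega>) (L k \<omega>) (U k \<omega>) (phi k \<omega> \<bullet> theta + eps (Suc k) \<omega>))"
      by (intro ae_adapted_sat ad_Suc)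
    show "AE \<omega> in M. y (Suc k) \<omega> = sat (l k \<omega>) (u k \<omega>) (L k \<omega>) (U k \<omega>) (phi k \<omega> \<bullet> theta + eps (Suc k) \<omega>)"
      using AE_space by eventually_elim (rule model)
  qed
  have innov_ad: "ae_adapted (Suc k) (\<lambda>\<omega>. innov (Fd k \<omega>) (l k \<omega>) (u k \<omega>) (L k \<omega>) (U k \<omega>) (y (Suc k) \<omega>) (phi k \<omega> \<bullet> X \<omega>))"
    if "ae_adapted k X" for k X
    by (rule ae_adapted_innov[where F = "Fd k", OF measurable_Fk_mono[OF _ Fd_meas] F_cont
          ad_Suc y_ad ae_adapted_mono[OF inner[OF that]]]) simp_all
  have betab_ad: "ae_adapted k (betab k)" for k
  proof (rule ae_adapted_cong)
    have "R k \<in> borel_measurable (Fk k)"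
      unfolding R_def[abs_def] using Ck_meas[of k] l_meas[of k] u_meas[of k] by measurable
    moreover have "AE \<omega> in M. 0 \<le> R k \<omega>" using AE_space by eventually_elim (rule R0)
    moreover have "AE \<omega> in M. \<forall>x. \<bar>x\<bar> \<le> R k \<omega> \<longrightarrow> 0 \<le> fd k \<omega> x" using f_nonneg by eventually_elim blast
    ultimately show "ae_adapted k (\<lambda>\<omega>. INF x\<in>{x. \<bar>x\<bar> \<le> R k \<omega>}. fd k \<omega> x)"
      by (intro ae_adapted_INF[where f = "fd k", OF fd_meas f_cont ae_adapted_measurable])
    show "AE \<omega> in M. betab k \<omega> = (INF x\<in>{x. \<bar>x\<bar> \<le> R k \<omega>}. fd k \<omega> x)"
      using AE_space by eventually_elim (rule betab_eq)
  qed
  have thb_ad: "ae_adapted k (thb k)" for k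
    by (rule ae_adapted_projected_recursion[where x = thb and P = Pb and p = phi and b = b and m = mub
          and a = ab and be = betab and D = D and ?x0.0 = thb0 and ?P0.0 = Pb0
          and v = "\<lambda>k \<omega>. innov (Fd k \<omega>) (l k \<omega>) (u k \<omega>) (L k \<omega>) (U k \<omega>) (y (Suc k) \<omega>) (phi k \<omega> \<bullet> thb k \<omega>)"])
      (assumption | rule D(1,2) D'(2) Pb0 phi_meas b_meas mub_meas m0(1) thb_0 Pb_0 ab_def Pb_Suc thb_Suc
        betab_ad betab_lower innov_ad)+
  \<comment> \<open>Membership in \<open>D\<close> holds on every path, since the minimum over a
    compact set is attained for any matrix; the bound \<open>Ck\<close> then covers both
    predictions.\<close>
  have thb_D: "thb k \<omega> \<in> D" and th_D: "th k \<omega> \<in> D" if "\<omega> \<in> space M" for k \<omega>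
    using that thb0 th0 proj_minimizes(1)[OF D(2) D'(2)]
    by (cases k; simp add: thb_0 thb_Suc th_0 th_Suc)+
  \<comment> \<open>The gain is a density value within radius \<open>R k\<close>, times 1 or 2, so
    the two-sided density bounds of A3 pass on to it.\<close>
  have beta_pos: "\<exists>\<xi>. \<bar>\<xi>\<bar> \<le> R k \<omega> \<and> beta k \<omega> = noise_gain (l k \<omega>) (u k \<omega>) (phi k \<omega> \<bullet> th k \<omega>) * fd k \<omega> \<xi>"
    if \<omega>: "\<omega> \<in> space M" and "l k \<omega> < u k \<omega>" "\<And>x. (Fd k \<omega> has_real_derivative fd k \<omega> x) (at x)"
      "Fd k \<omega> 0 = 1 / 2" for k \<omega>
    unfolding beta_def[OF \<omega>] L R_def using that
    by (intro beta2_is_drift_slope(2) Ck_ge[OF \<omega> th_D[OF \<omega>]] Ck_ge[OF \<omega> thb_D[OF \<omega>]]) auto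
  have beta_nonneg: "AE \<omega> in M. \<forall>k. 0 \<le> beta k \<omega>"
    using basic f_nonneg AE_space
  proof eventually_elim
    case (elim \<omega>)
    show ?case
    proof
      fix k
      obtain \<xi> where "\<bar>\<xi>\<bar> \<le> R k \<omega>" and "beta k \<omega> = noise_gain (l k \<omega>) (u k \<omega>) (phi k \<omega> \<bullet> th k \<omega>) * fd k \<omega> \<xi>"
        using beta_pos[OF elim(3), of k] elim(1) by blast
      then show "0 \<le> beta k \<omega>"
        using elim(2) noise_gain_range(1)[of "l k \<omega>" "u k \<omega>" "phi k \<omega> \<bullet> th k \<omega>"] by simp
    qed
  qed
  \<comment> \<open>\<open>beta k\<close> reads both estimates at time \<open>k\<close>: that of
    step 1 is already known to be adapted, and that of step 2 is supplied by the induction in the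
    recursion.\<close>
  have beta_ad: "ae_adapted k (beta k)" if "ae_adapted k (th k)" for k
  proof (rule ae_adapted_cong)
    show "ae_adapted k (\<lambda>\<omega>. beta2 (Fd k \<omega>) (fd k \<omega>) (l k \<omega>) (u k \<omega>) (L k \<omega>) (U k \<omega>)
        (phi k \<omega> \<bullet> th k \<omega>) (phi k \<omega> \<bullet> thb k \<omega>))"
      by (rule ae_adapted_beta2[where F = "Fd k" and f = "fd k", OF Fd_meas F_cont fd_meas f_cont ad
            inner[OF that] inner[OF thb_ad]])
    show "AE \<omega> in M. beta k \<omega> = beta2 (Fd k \<omega>) (fd k \<omega>) (l k \<omega>) (u k \<omega>) (L k \<omega>) (U k \<omega>)
        (phi k \<omega> \<bullet> th k \<omega>) (phi k \<omega> \<bullet> thb k \<omega>)"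
      using AE_space by eventually_elim (rule beta_def)
  qed
  have th_ad: "ae_adapted k (th k)" for k
    by (rule ae_adapted_projected_recursion[where x = th and P = P and p = phi and b = b and m = mu
          and a = a and be = beta and D = D and ?x0.0 = th0 and ?P0.0 = P0
          and v = "\<lambda>k \<omega>. innov (Fd k \<omega>) (l k \<omega>) (u k \<omega>) (L k \<omega>) (U k \<omega>) (y (Suc k) \<omega>) (phi k \<omega> \<bullet> th k \<omega>)"])
      (assumption | rule D(1,2) D'(2) P0 phi_meas b_meas mu_meas m0(2) th_0 P_0 a_def P_Suc th_Suc
        beta_ad beta_nonneg innov_ad)+
  \<comment> \<open>Used for both sequences of estimates, each with its own normaliser. Coefficients
    and thresholds of index \<open>k\<close> are known at time \<open>k\<close>, before
    \<open>eps (Suc k)\<close>.\<close>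
  have mart: "AE \<omega> in M. (\<forall>k. eps (Suc k) \<omega> \<noteq> sat (l k \<omega>) (u k \<omega>) (l k \<omega>) (u k \<omega>) (phi k \<omega> \<bullet> X k \<omega>) - phi k \<omega> \<bullet> theta) \<and>
    (\<forall>d>0. \<exists>K. \<forall>\<^sub>F n in sequentially.
      (\<Sum>k<n. - (b k \<omega> * (phi k \<omega> \<bullet> (theta - X k \<omega>)) * noise_gain (l k \<omega>) (u k \<omega>) (phi k \<omega> \<bullet> X k \<omega>) / m k \<omega>)
        * (Fd k \<omega> (sat (l k \<omega>) (u k \<omega>) (l k \<omega>) (u k \<omega>) (phi k \<omega> \<bullet> X k \<omega>) - phi k \<omega> \<bullet> theta)
          - (if eps (Suc k) \<omega> \<le> sat (l k \<omega>) (u k \<omega>) (l k \<omega>) (u k \<omega>) (phi k \<omega> \<bullet> X k \<omega>) - phi k \<omega> \<bullet> theta then 1 else 0)))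
      \<le> d * (\<Sum>k<n. (- (b k \<omega> * (phi k \<omega> \<bullet> (theta - X k \<omega>)) * noise_gain (l k \<omega>) (u k \<omega>) (phi k \<omega> \<bullet> X k \<omega>) / m k \<omega>))\<^sup>2)
        + K * sqrt (real n))"
    if X: "\<And>k. ae_adapted k (X k)" and m: "\<And>k. m k \<in> borel_measurable (Fk k)" for X :: "nat \<Rightarrow> 'a \<Rightarrow> real^'d" and m
  proof (rule AE_innovation_noise_bound[where F = Fd and e = "\<lambda>k. eps (Suc k)"
        and X = "\<lambda>k \<omega>. - (b k \<omega> * (phi k \<omega> \<bullet> (theta - X k \<omega>)) * noise_gain (l k \<omega>) (u k \<omega>) (phi k \<omega> \<bullet> X k \<omega>) / m k \<omega>)"
        and t = "\<lambda>k \<omega>. sat (l k \<omega>) (u k \<omega>) (l k \<omega>) (u k \<omega>) (phi k \<omega> \<bullet> X k \<omega>) - phi k \<omega> \<bullet> theta"])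
    fix k
    show "eps (Suc k) \<in> borel_measurable (Fk (Suc k))" by (rule eps_meas)
    show "AE \<omega> in M. continuous_on UNIV (Fd k \<omega>)" by (rule F_cont)
    show "(\<lambda>\<omega>. Fd k \<omega> x) \<in> borel_measurable (Fk k)" for x by (rule Fd_meas)
    show "AE \<omega> in M. Fd k \<omega> x = real_cond_exp M (Fk k) (\<lambda>\<omega>. indicator {\<omega>' \<in> space M. eps (Suc k) \<omega>' \<le> x} \<omega>) \<omega>" for x
      by (rule Fd_cond)
    show "ae_adapted k (\<lambda>\<omega>. sat (l k \<omega>) (u k \<omega>) (l k \<omega>) (u k \<omega>) (phi k \<omega> \<bullet> X k \<omega>) - phi k \<omega> \<bullet> theta)"
      by (intro ae_adapted_arith(2) ae_adapted_sat ad(1,2) inner X ae_adapted_const)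
    have h: "ae_adapted k (\<lambda>\<omega>. phi k \<omega> \<bullet> (theta - X k \<omega>))"
      unfolding inner_diff_right by (intro ae_adapted_arith(2) inner X ae_adapted_const)
    \<comment> \<open>Unary minus is written as a difference, the form covered by the closure
      rules.\<close>
    have "ae_adapted k (\<lambda>\<omega>. 0 - b k \<omega> * (phi k \<omega> \<bullet> (theta - X k \<omega>)) * noise_gain (l k \<omega>) (u k \<omega>) (phi k \<omega> \<bullet> X k \<omega>) / m k \<omega>)"
      by (intro h ae_adapted_arith(2) ae_adapted_arith(3) ae_adapted_arith(4) ae_adapted_noise_gain ad(1,2) inner[OF X]
          ae_adapted_const ae_adapted_measurable[OF m] ae_adapted_measurable[OF b_meas])
    then show "ae_adapted k (\<lambda>\<omega>. - (b k \<omega> * (phi k \<omega> \<bullet> (theta - X k \<omega>)) * noise_gain (l k \<omega>) (u k \<omega>) (phi k \<omega> \<bullet> X k \<omega>) / m k \<omega>))"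
      by simp
  qed
  have b01: "0 \<le> b k \<omega>" "b k \<omega> \<le> 1" if "\<omega> \<in> space M" for k \<omega>
    using b_bdd[OF that] by (auto intro: order_trans less_imp_le)
  have noise: "AE \<omega> in M. \<exists>K. \<forall>\<^sub>F n in sequentially. (\<Sum>k<n. b k \<omega> * \<bar>eps (Suc k) \<omega>\<bar>)
    \<le> sqrt (real n * (\<Sum>k<n. (b k \<omega>)\<^sup>2 * real_cond_exp M (Fk k) (\<lambda>\<omega>. (eps (Suc k) \<omega>)\<^sup>2) \<omega>)) + K * real n powr (3 / 4)"
    by (rule AE_weighted_abs_sum_le[where X = "\<lambda>k. eps (Suc k)", OF eps_meas r moment b_meas]) (rule b01, assumption)+
  show ?thesis
    using basic f_bounds mart[OF thb_ad mub_meas] mart[OF th_ad mu_meas] noise AE_space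
  proof eventually_elim
    case (elim \<omega>)
    note \<omega> = elim(6)
    have lu: "l k \<omega> < u k \<omega>" and deriv: "(Fd k \<omega> has_real_derivative fd k \<omega> x) (at x)"
      and med: "Fd k \<omega> 0 = 1 / 2" and F01': "0 \<le> Fd k \<omega> x" "Fd k \<omega> x \<le> 1"
      and Rle: "R k \<omega> \<le> max (2 * C) (C + Mb)" for k x
      using elim(1) by blast+
    obtain c where c0: "c > 0" and "\<And>k x. \<bar>x\<bar> \<le> max (2 * C) (C + Mb) \<Longrightarrow> c \<le> fd k \<omega> x" using elim(2) by blast
    then have c: "c \<le> fd k \<omega> x" if "\<bar>x\<bar> \<le> R k \<omega>" for k x using that Rle[of k] by fastforce
    obtain c' where "\<And>k x. \<bar>x\<bar> \<le> max (2 * C) (C + Mb) \<Longrightarrow> fd k \<omega> x \<le> c'" using elim(2) by blast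
    then have c': "fd k \<omega> x \<le> c'" if "\<bar>x\<bar> \<le> R k \<omega>" for k x using that Rle[of k] by fastforce
    obtain b0 where b0: "b0 > 0" "\<And>k. b0 \<le> b k \<omega>" using b_bdd[OF \<omega>] by blast
    obtain mb0 mb1 where mb: "mb0 > 0" "\<And>k. mb0 \<le> mub k \<omega>" "\<And>k. mub k \<omega> \<le> mb1" using mub_bdd[OF \<omega>] by blast
    obtain m0 m1 where m: "m0 > 0" "\<And>k. m0 \<le> mu k \<omega>" "\<And>k. mu k \<omega> \<le> m1" using mu_bdd[OF \<omega>] by blast
    obtain K where K: "\<And>k. norm (phi k \<omega>) \<le> K"
      using phi_bdd[OF \<omega>] unfolding bounded_iff by auto
    let ?g = "\<lambda>k X. noise_gain (l k \<omega>) (u k \<omega>) (phi k \<omega> \<bullet> X k \<omega>)"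
    let ?psi = "\<lambda>k X. drift (Fd k \<omega>) (l k \<omega>) (u k \<omega>) (phi k \<omega> \<bullet> X k \<omega>)"
    have slope: "\<exists>\<xi>. \<bar>\<xi>\<bar> \<le> R k \<omega> \<and>
        drift (Fd k \<omega>) (l k \<omega>) (u k \<omega>) (phi k \<omega> \<bullet> z) (phi k \<omega> \<bullet> r) - drift (Fd k \<omega>) (l k \<omega>) (u k \<omega>) (phi k \<omega> \<bullet> z) (phi k \<omega> \<bullet> r')
        = noise_gain (l k \<omega>) (u k \<omega>) (phi k \<omega> \<bullet> z) * fd k \<omega> \<xi> * (phi k \<omega> \<bullet> r - phi k \<omega> \<bullet> r')"
      if "z \<in> D" "r \<in> D" "r' \<in> D" for k z r r'
      unfolding R_def by (rule drift_diff[OF deriv Ck_ge[OF \<omega> that(1)] Ck_ge[OF \<omega> that(2)] Ck_ge[OF \<omega> that(3)]])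
    have betab: "c \<le> betab k \<omega>" "\<bar>x\<bar> \<le> R k \<omega> \<Longrightarrow> betab k \<omega> \<le> fd k \<omega> x" for k x
    proof -
      show "c \<le> betab k \<omega>"
        unfolding betab_eq[OF \<omega>]
        by (rule cINF_greatest) (use c R0[OF \<omega>, of k] in \<open>auto intro: exI[of _ 0]\<close>)
      show "betab k \<omega> \<le> fd k \<omega> x" if "\<bar>x\<bar> \<le> R k \<omega>"
        unfolding betab_eq[OF \<omega>]
        by (rule cINF_lower) (use c that in \<open>auto intro!: bdd_belowI[of _ c]\<close>)
    qed
    have drift0: "drift (Fd k \<omega>) (l k \<omega>) (u k \<omega>) z z = 0" for k z
      by (rule drift_self[where F = "Fd k \<omega>", OF med])
    \<comment> \<open>In step 1 the gain lies below the slope, so nothing is inherited: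
      \<open>err\<close> is 0. The rate \<open>kap = b0 * c\<close> combines the lower bounds of
      weights and density on this path.\<close>
    have regret1: "\<exists>K. \<forall>\<^sub>F n in sequentially. (\<Sum>k<n. (phi k \<omega> \<bullet> (theta - thb k \<omega>))\<^sup>2) \<le> K * sqrt (real n)"
    proof (rule saturated_regret[where P = "\<lambda>k. Pb k \<omega>" and be = "\<lambda>k. betab k \<omega>" and b = "\<lambda>k. b k \<omega>"
          and m = "\<lambda>k. mub k \<omega>" and x = "\<lambda>k. thb k \<omega>" and p = "\<lambda>k. phi k \<omega>" and a = "\<lambda>k. ab k \<omega>" and t = theta
          and l = "\<lambda>k. l k \<omega>" and u = "\<lambda>k. u k \<omega>" and y = "\<lambda>k. y (Suc k) \<omega>" and F = "\<lambda>k. Fd k \<omega>"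
          and e = "\<lambda>k. eps (Suc k) \<omega>" and err = "\<lambda>_. 0" and D = D and c = c
          and kap = "b0 * c" and ?K2.0 = 0 and ?m0.0 = mb0 and ?m1.0 = mb1 and K = K
          and h = "\<lambda>k. phi k \<omega> \<bullet> (theta - thb k \<omega>)"
          and s = "\<lambda>k. sat (l k \<omega>) (u k \<omega>) (l k \<omega>) (u k \<omega>) (phi k \<omega> \<bullet> thb k \<omega>) - phi k \<omega> \<bullet> theta"])
      show "betab k \<omega> * (b k \<omega>)\<^sup>2 * (phi k \<omega> \<bullet> (theta - thb k \<omega>))\<^sup>2
          - 2 * b k \<omega> * (phi k \<omega> \<bullet> (theta - thb k \<omega>)) * ?psi k thb (phi k \<omega> \<bullet> theta)
          \<le> - (b0 * c) * (phi k \<omega> \<bullet> (theta - thb k \<omega>))\<^sup>2 + 0 * 0\<^sup>2" for k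
      proof -
        obtain \<xi> where \<xi>: "\<bar>\<xi>\<bar> \<le> R k \<omega>" "?psi k thb (phi k \<omega> \<bullet> theta) - ?psi k thb (phi k \<omega> \<bullet> thb k \<omega>)
            = ?g k thb * fd k \<omega> \<xi> * (phi k \<omega> \<bullet> theta - phi k \<omega> \<bullet> thb k \<omega>)"
          using slope[OF thb_D[OF \<omega>] D'(1) thb_D[OF \<omega>]] by blast
        \<comment> \<open>The slope is a density value within radius \<open>R k\<close>, times at
          least 1, and \<open>betab\<close> is the infimum of such values.\<close>
        have "1 * betab k \<omega> \<le> ?g k thb * fd k \<omega> \<xi>"
          using betab(2)[OF \<xi>(1)] betab(1)[of k] c0 noise_gain_range(1) noise_gain_nonneg by (intro mult_mono) auto
        then have "betab k \<omega> * (b k \<omega>)\<^sup>2 * (phi k \<omega> \<bullet> (theta - thb k \<omega>))\<^sup>2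
          - 2 * b k \<omega> * (phi k \<omega> \<bullet> (theta - thb k \<omega>)) * ?psi k thb (phi k \<omega> \<bullet> theta)
          \<le> - (b0 * c) * (phi k \<omega> \<bullet> (theta - thb k \<omega>))\<^sup>2"
          using \<xi>(2) b0 b01[OF \<omega>] betab(1) c0 unfolding drift0
          by (intro one_step_dissipation[where g = "?g k thb * fd k \<omega> \<xi>"]) (auto simp: inner_diff_right less_imp_le)
        then show ?thesis by simp
      qed
      show "\<exists>K3. \<forall>\<^sub>F n in sequentially. (\<Sum>k<n. 0\<^sup>2) \<le> K3 * sqrt (real n)"
        by (intro exI[of _ 0]) simp
      show "y (Suc k) \<omega> = sat (l k \<omega>) (u k \<omega>) (l k \<omega>) (u k \<omega>) (phi k \<omega> \<bullet> theta + eps (Suc k) \<omega>)" for k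
        using model[OF \<omega>, of k] by (simp add: L)
      show "thb (Suc k) \<omega> = proj (matrix_inv (Pb (Suc k) \<omega>)) D (thb k \<omega> + (ab k \<omega> * b k \<omega> *
          innov (Fd k \<omega>) (l k \<omega>) (u k \<omega>) (l k \<omega>) (u k \<omega>) (y (Suc k) \<omega>) (phi k \<omega> \<bullet> thb k \<omega>)) *\<^sub>R (Pb k \<omega> *v phi k \<omega>))" for k
        using thb_Suc[OF \<omega>, of k] by (simp add: L)
      show "pos_def (Pb 0 \<omega>)" using Pb0 Pb_0[OF \<omega>] by simp
      show "0 < b0 * c" using b0(1) c0 by simp
    qed (assumption | rule refl betab(1) c0 b01[OF \<omega>] mb K ab_def[OF \<omega>] Pb_Suc[OF \<omega>] D(1,2) D'(1) lu F01' order_refl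
        elim(3)[THEN conjunct1, rule_format] elim(3)[THEN conjunct2, rule_format])+
    have regret2: "\<exists>K. \<forall>\<^sub>F n in sequentially. (\<Sum>k<n. (phi k \<omega> \<bullet> (theta - th k \<omega>))\<^sup>2) \<le> K * sqrt (real n)"
    proof -
      \<comment> \<open>The gain and, below, the slope towards the step 1 estimate share the bound
        \<open>2 * c'\<close>, from noise gain 2 and density bound \<open>c'\<close>; it gives the
        inherited error its coefficient \<open>2 * (2 * c')^2 / c\<close>.\<close>
      have beta: "c \<le> beta k \<omega>" "beta k \<omega> \<le> 2 * c'" for k
      proof -
        obtain \<xi> where \<xi>: "\<bar>\<xi>\<bar> \<le> R k \<omega>" "beta k \<omega> = ?g k th * fd k \<omega> \<xi>"
          using beta_pos[OF \<omega> lu deriv med] by blast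
        have "1 * c \<le> ?g k th * fd k \<omega> \<xi>"
          using c[OF \<xi>(1)] c0 noise_gain_range(1) noise_gain_nonneg by (intro mult_mono) auto
        moreover have "?g k th * fd k \<omega> \<xi> \<le> 2 * c'"
          using c[OF \<xi>(1)] c'[OF \<xi>(1)] c0 noise_gain_range(2) noise_gain_nonneg by (intro mult_mono) auto
        ultimately show "c \<le> beta k \<omega>" "beta k \<omega> \<le> 2 * c'" using \<xi>(2) by simp_all
      qed
      show ?thesis
      proof (rule saturated_regret[where P = "\<lambda>k. P k \<omega>" and be = "\<lambda>k. beta k \<omega>" and b = "\<lambda>k. b k \<omega>"
            and m = "\<lambda>k. mu k \<omega>" and x = "\<lambda>k. th k \<omega>" and p = "\<lambda>k. phi k \<omega>" and a = "\<lambda>k. a k \<omega>" and t = theta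
            and l = "\<lambda>k. l k \<omega>" and u = "\<lambda>k. u k \<omega>" and y = "\<lambda>k. y (Suc k) \<omega>" and F = "\<lambda>k. Fd k \<omega>"
            and e = "\<lambda>k. eps (Suc k) \<omega>" and err = "\<lambda>k. phi k \<omega> \<bullet> (theta - thb k \<omega>)" and D = D and c = c
            and kap = "b0 * c / 2" and ?K2.0 = "2 * (2 * c')\<^sup>2 / c" and ?m0.0 = m0 and ?m1.0 = m1 and K = K
          and h = "\<lambda>k. phi k \<omega> \<bullet> (theta - th k \<omega>)"
          and s = "\<lambda>k. sat (l k \<omega>) (u k \<omega>) (l k \<omega>) (u k \<omega>) (phi k \<omega> \<bullet> th k \<omega>) - phi k \<omega> \<bullet> theta"])
        show "beta k \<omega> * (b k \<omega>)\<^sup>2 * (phi k \<omega> \<bullet> (theta - th k \<omega>))\<^sup>2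
            - 2 * b k \<omega> * (phi k \<omega> \<bullet> (theta - th k \<omega>)) * ?psi k th (phi k \<omega> \<bullet> theta)
            \<le> - (b0 * c / 2) * (phi k \<omega> \<bullet> (theta - th k \<omega>))\<^sup>2
              + 2 * (2 * c')\<^sup>2 / c * (phi k \<omega> \<bullet> (theta - thb k \<omega>))\<^sup>2" for k
        proof -
          \<comment> \<open>\<open>\<xi>\<close> gives the drift itself, relative to the current
            estimate where it vanishes; \<open>\<xi>'\<close> gives its change between the truth and
            the step 1 estimate, which is controlled by the step 1 error.\<close>
          obtain \<xi> where \<xi>: "\<bar>\<xi>\<bar> \<le> R k \<omega>" "?psi k th (phi k \<omega> \<bullet> theta) - ?psi k th (phi k \<omega> \<bullet> th k \<omega>)
              = ?g k th * fd k \<omega> \<xi> * (phi k \<omega> \<bullet> theta - phi k \<omega> \<bullet> th k \<omega>)"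
            using slope[OF th_D[OF \<omega>] D'(1) th_D[OF \<omega>]] by blast
          obtain \<xi>' where \<xi>': "\<bar>\<xi>'\<bar> \<le> R k \<omega>" "?psi k th (phi k \<omega> \<bullet> theta) - ?psi k th (phi k \<omega> \<bullet> thb k \<omega>)
              = ?g k th * fd k \<omega> \<xi>' * (phi k \<omega> \<bullet> theta - phi k \<omega> \<bullet> thb k \<omega>)"
            using slope[OF th_D[OF \<omega>] D'(1) thb_D[OF \<omega>]] by blast
          show ?thesis
          proof (rule two_step_dissipation[where g = "?g k th * fd k \<omega> \<xi>" and psi' = "?psi k th (phi k \<omega> \<bullet> thb k \<omega>)"])
            show "?psi k th (phi k \<omega> \<bullet> theta) = ?g k th * fd k \<omega> \<xi> * (phi k \<omega> \<bullet> (theta - th k \<omega>))"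
              using \<xi>(2) unfolding drift0 by (simp add: inner_diff_right)
            have "1 * c \<le> ?g k th * fd k \<omega> \<xi>"
              using c[OF \<xi>(1)] c0 noise_gain_range(1) noise_gain_nonneg by (intro mult_mono) auto
            then show "c \<le> ?g k th * fd k \<omega> \<xi>" by simp
            have "?psi k th (phi k \<omega> \<bullet> thb k \<omega>) = beta k \<omega> * (phi k \<omega> \<bullet> thb k \<omega> - phi k \<omega> \<bullet> th k \<omega>)"
              unfolding beta_def[OF \<omega>] L by (rule beta2_is_drift_slope(1)[OF deriv med lu Ck_ge[OF \<omega> th_D[OF \<omega>]] Ck_ge[OF \<omega> thb_D[OF \<omega>]]])
            then show "?psi k th (phi k \<omega> \<bullet> thb k \<omega>)
                = beta k \<omega> * (phi k \<omega> \<bullet> (theta - th k \<omega>) - phi k \<omega> \<bullet> (theta - thb k \<omega>))"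
              by (simp add: inner_diff_right)
            have g': "0 \<le> ?g k th * fd k \<omega> \<xi>'" "?g k th * fd k \<omega> \<xi>' \<le> 2 * c'"
            proof -
              show "0 \<le> ?g k th * fd k \<omega> \<xi>'"
                using c[OF \<xi>'(1)] c0 noise_gain_range(1)[of "l k \<omega>" "u k \<omega>" "phi k \<omega> \<bullet> th k \<omega>"] by simp
              show "?g k th * fd k \<omega> \<xi>' \<le> 2 * c'"
                using c[OF \<xi>'(1)] c'[OF \<xi>'(1)] c0 noise_gain_range(2) noise_gain_nonneg by (intro mult_mono) auto
            qed
            show "\<bar>?psi k th (phi k \<omega> \<bullet> theta) - ?psi k th (phi k \<omega> \<bullet> thb k \<omega>)\<bar>
                \<le> 2 * c' * \<bar>phi k \<omega> \<bullet> (theta - thb k \<omega>)\<bar>"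
              unfolding \<xi>'(2) inner_diff_right[symmetric] abs_mult[of "?g k th * fd k \<omega> \<xi>'"]
              using g' by (intro mult_right_mono) auto
          qed (use beta[of k] b0 b01[OF \<omega>, of k] c0 in auto)
        qed
        show "y (Suc k) \<omega> = sat (l k \<omega>) (u k \<omega>) (l k \<omega>) (u k \<omega>) (phi k \<omega> \<bullet> theta + eps (Suc k) \<omega>)" for k
          using model[OF \<omega>, of k] by (simp add: L)
        show "th (Suc k) \<omega> = proj (matrix_inv (P (Suc k) \<omega>)) D (th k \<omega> + (a k \<omega> * b k \<omega> *
            innov (Fd k \<omega>) (l k \<omega>) (u k \<omega>) (l k \<omega>) (u k \<omega>) (y (Suc k) \<omega>) (phi k \<omega> \<bullet> th k \<omega>)) *\<^sub>R (P k \<omega> *v phi k \<omega>))" for k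
          using th_Suc[OF \<omega>, of k] by (simp add: L)
        show "pos_def (P 0 \<omega>)" using P0 P_0[OF \<omega>] by simp
        show "0 \<le> 2 * (2 * c')\<^sup>2 / c" using c0 by simp
        show "0 < b0 * c / 2" using b0(1) c0 by simp
      qed (assumption | rule refl beta(1) c0 b01[OF \<omega>] m K a_def[OF \<omega>] P_Suc[OF \<omega>] D(1,2) D'(1) lu F01' regret1
          elim(4)[THEN conjunct1, rule_format] elim(4)[THEN conjunct2, rule_format])+
    qed
    show ?case
    proof (rule prediction_error_from_regret[OF regret2 elim(5)])
      show "\<bar>y (Suc k) \<omega> - sat (l k \<omega>) (u k \<omega>) (L k \<omega>) (U k \<omega>) (phi k \<omega> \<bullet> th k \<omega>)\<bar>
          \<le> \<bar>phi k \<omega> \<bullet> (theta - th k \<omega>)\<bar> + \<bar>eps (Suc k) \<omega>\<bar>" for k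
      proof -
        have "\<bar>y (Suc k) \<omega> - sat (l k \<omega>) (u k \<omega>) (L k \<omega>) (U k \<omega>) (phi k \<omega> \<bullet> th k \<omega>)\<bar>
            \<le> \<bar>(phi k \<omega> \<bullet> theta + eps (Suc k) \<omega>) - phi k \<omega> \<bullet> th k \<omega>\<bar>"
          unfolding model[OF \<omega>] L by (rule sat_nonexpansive[OF less_imp_le[OF lu]])
        also have "\<dots> \<le> \<bar>phi k \<omega> \<bullet> (theta - th k \<omega>)\<bar> + \<bar>eps (Suc k) \<omega>\<bar>"
          unfolding inner_diff_right by linarith
        finally show ?thesis .
      qed
    qed (rule b01[OF \<omega>])+
  qed
qed

end
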